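(* The theory $V^0$ proves that if $A_\varphi$ is injective on $\mathrm{Config}_{n,m}$, then $\varphi$ is not satisfiable. That is, $V^0$ proves the (formalized) statement: for all numbers $n,m\ge1$ with $n$ odd and every set $\varphi$ with $\mathrm{CNF}(n,m,\varphi)$, if for all sets $C,C'$ coding elements of $\mathrm{Config}_{n,m}$ the equality $A_\varphi(C)=A_\varphi(C')$ implies $C=C'$, then for every (coded) assignment $\mathbf a\in\{0,1\}^m$, $\neg\mathrm{Sat}(n,m,\mathbf a,\varphi)$.
   Context: The theory $V^0$. It is two-sorted: number variables $x,y,\dots$ (natural numbers) and set variables $X,Y,\dots$ (finite sets of naturals), language $\{0,1,+,\cdot,|\ |;=_1,=_2,\le,\in\}$; $X(t)$ abbreviates $t\in X$, and $|X|$ is the largest element of $X$ plus one. Axioms of $2$-BASIC: $x+1\ne0$; $x+1=y+1\to x=y$; $x+0=x$; $x+(y+1)=(x+y)+1$; $x\cdot0=0$; $x\cdot(y+1)=x\cdot y+x$; $(x\le y\wedge y\le x)\to x=y$; $x\le x+y$; $0\le x$; $x\le y\vee y\le x$; $x\le y\leftrightarrow x<y+1$; $x\ne0\to\exists y\le x\,(y+1=x)$; $X(y)\to y<|X|$; $y+1=|X|\to X(y)$; $(|X|=|Y|\wedge\forall i<|X|(X(i)\leftrightarrow Y(i)))\to X=Y$. $\Sigma^B_0$-formulas are those whose only quantifiers are bounded number quantifiers (free set variables allowed). $V^0$ is $2$-BASIC plus $\Sigma^B_0$-COMP: $\exists X\,(|X|\le y\wedge\forall z<y\,(X(z)\leftrightarrow\psi(z)))$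 for all $\Sigma^B_0$-formulas $\psi$ in which $X$ is not free. Coding. Tuples are coded by iterating $\langle x,y\rangle=\frac{(x+y)(x+y+1)}2+x$; finite relations are sets of codes of tuples; functions and sequences are coded by their graphs. The symbols $\square$ ("absent") and $-1$ are represented by fixed codes distinct from the other admissible values of the component concerned. A CNF formula $\varphi=C_1\wedge\dots\wedge C_n$ in $x_1,\dots,x_m$ is coded by a relation $\varphi\subseteq\{1,\dots,n\}\times\{1,\dots,m\}\times\{-1,0,1\}$ with $(i,j,1)\in\varphi$ iff $x_j\in C_i$, $(i,j,-1)\in\varphi$ iff $\neg x_j\in C_i$, $(i,j,0)\in\varphi$ iff neither; $\mathrm{CNF}(n,m,\varphi)$ says that $\varphi$ is the graph of a function $\{1,\dots,n\}\times\{1,\dots,m\}\to\{-1,0,1\}$. $\mathrm{Sat}(n,m,\mathbf a,\varphi)$ is: $\forall i\in\{1,\dots,n\}\,\exists j\in\{1,\dots,m\}\,\exists s\in\{-1,1\}\,[(i,j,s)\in\varphi\wedge((s=1\wedge a_j=1)\vee(s=-1\wedge a_j=0))]$. The objects below are defined by $\Sigma^B_0$-formulas by writing out their definitions; an element of $\mathrm{Config}_{n,m}$ is coded by its graph, a subset of $[n+1]\times[m+2]\times S_{n,m}$ (positions outside have state $\mathbf q$), and $A_\varphi(C)=A_\varphi(C')$ means that at each position of $[n+1]\times[m+2]$ the values of $f_\varphi$ on the neighbourhood states in $C$ and in $C'$ coincide. States ($[k]=\{0,\dots,k-1\}$). A state is $s=((i,j),\mathrm{flag},a,\mathsf{pd},\mathsf{pc},\mathrm{label})$,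 with components $\mathrm{coord}(s)=(i,j)$, $\mathrm{flag}(s)$, $a(s)$, $\mathsf{pd}(s)$, $\mathsf{pc}(s)$, $\mathrm{label}(s)$. $S_{n,m}$ consists of (with $\mathrm{label}\in\{0,1\}$ in (1)-(6)): (1) $((0,0),\square,\square,\square,\square,\mathrm{label})$; (2) $((i,0),\square,\square,\square,\square,\mathrm{label})$, $1\le i\le n$; (3) $((0,j),\square,a,\square,\square,\mathrm{label})$, $1\le j\le m$, $a\in\{0,1\}$; (4) $((0,m+1),\square,\square,\square,\square,\mathrm{label})$; (5) $((i,m+1),\square,\square,\square,\mathsf{pc},\mathrm{label})$, $1\le i\le n$, $\mathsf{pc}\in\{0,1\}$; (6) $((i,j),\mathrm{flag},a,\mathsf{pd},\square,\mathrm{label})$, $1\le i\le n$, $1\le j\le m$, $\mathrm{flag}\in\{-1,0,1\}$, $a,\mathsf{pd}\in\{0,1\}$; (7) $\mathbf q=((\square,\square),\square,\square,\square,\square,\square)$ (quiescent). $\mathrm{Config}_{n,m}$ is the set of maps $C:\mathbb Z^2\to S_{n,m}$ with $C(p)\ne\mathbf q$ for $p\in[n+1]\times[m+2]$ and $C(p)=\mathbf q$ otherwise. The right, left, below, above neighbours of $p$ are $p+(0,1),p+(0,-1),p+(1,0),p+(-1,0)$. Local correctness. Let $s_1\neq\mathbf q$, $\mathrm{coord}(s_1)=(i,j)$, and let $s_2,s_3,s_4,s_5$ be the states of the right, left, below, above neighbours. $s_1$ is locally correct with respect to $s_2,\dots,s_5$ if: (A) for each $(k,d)$ among $(2,(0,1)),(3,(0,-1)),(4,(1,0)),(5,(-1,0))$: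 if $(i,j)+d\in[n+1]\times[m+2]$ then $\mathrm{coord}(s_k)=(i,j)+d$; otherwise $s_k=\mathbf q$; (B) if $1\le i\le n$, $1\le j\le m$: $\mathrm{flag}(s_1)=1$ iff $x_j\in C_i$, $\mathrm{flag}(s_1)=-1$ iff $\neg x_j\in C_i$, $\mathrm{flag}(s_1)=0$ iff neither; (C1) if $1\le j\le m$: $a(s_k)=a(s_1)$ for $k\in\{4,5\}$ with $s_k\ne\mathbf q$; (C2) if $j=m+1$, $i\ge2$: $\mathsf{pc}(s_1)=\mathsf{pc}(s_5)\wedge\mathsf{pd}(s_3)$; (C3) if $(i,j)=(1,m+1)$: $\mathsf{pc}(s_1)=1$ iff $\mathsf{pd}(s_3)=1$; (D1) if $1\le i\le n$, $2\le j\le m$: $\mathsf{pd}(s_1)=1$ iff $\mathsf{pd}(s_3)=1$ or ($\mathrm{flag}(s_1)=1$, $a(s_1)=1$) or ($\mathrm{flag}(s_1)=-1$, $a(s_1)=0$); (D2) if $1\le i\le n$, $j=1$: $\mathsf{pd}(s_1)=1$ iff ($\mathrm{flag}(s_1)=1$, $a(s_1)=1$) or ($\mathrm{flag}(s_1)=-1$, $a(s_1)=0$); (E) components not used by the type (1)-(6) belonging to $(i,j)$ are $\square$. $s_1$ is blue (with respect to $s_2,\dots,s_5$) if it is locally correct and, if $\mathrm{coord}(s_1)=(n,m+1)$, also $\mathsf{pc}(s_1)=1$; otherwise (including $s_1=\mathbf q$) it is red. Successor. For $(i,j)\in[n+1]\times[m+2]$, $\mathrm{suc}(i,j)$ is given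 by the first applicable case: $(i,j+1)$ if $(i,j)=(0,0)$ or ($i$ even, $1\le j\le m$); $(i,j-1)$ if $(i,j)=(n,1)$ or ($i$ odd, $2\le j\le m+1$); $(i+1,j)$ if ($i$ odd, $j=1$) or ($i$ even, $j=m+1$); $(i-1,j)$ if $i\ge1$, $j=0$. If $s_1$ is blue, its successor is the unique $s_k$, $k\in\{2,3,4,5\}$, with $\mathrm{coord}(s_k)=\mathrm{suc}(\mathrm{coord}(s_1))$. Automaton. $A_\varphi=(2,S_{n,m},N,f_\varphi)$ with $N=((0,0),(0,1),(0,-1),(1,0),(-1,0))$; $f_\varphi(s_1,\dots,s_5)=s_1$ if $s_1$ is red, and otherwise $f_\varphi(s_1,\dots,s_5)$ is $s_1$ with label replaced by $\mathrm{label}(s_1)\oplus\mathrm{label}(s_k)$, $s_k$ being the successor ($\oplus$ is addition mod 2). *)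

theory Defs
  imports Main
begin

section \<open>Two-sorted first-order logic over the language of bounded arithmetic\<close>

text \<open>
  Terms and formulas in de Bruijn representation, with separate index spaces for number
  variables and set variables. The only set terms are set variables, represented by their
  index; \<open>AllN\<close> binds number index \<open>0\<close> and \<open>AllS\<close> binds set index \<open>0\<close>.
\<close>

datatype tm =
    NV nat
  | Zero
  | One
  | Add tm tm
  | Mul tm tm
  | Len nat

datatype fm =
    Fls
  | EqN tm tm
  | EqS nat nat
  | Le tm tm
  | Mem tm nat
  | Imp fm fm
  | AllN fm
  | AllS fm

definition Neg :: "fm \<Rightarrow> fm" where "Neg p = Imp p Fls"
definition Disj :: "fm \<Rightarrow> fm \<Rightarrow> fm" where "Disj p q = Imp (Neg p) q"
definition Conj :: "fm \<Rightarrow> fm \<Rightarrow> fm" where "Conj p q = Neg (Imp p (Neg q))"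
definition Iff :: "fm \<Rightarrow> fm \<Rightarrow> fm" where "Iff p q = Conj (Imp p q) (Imp q p)"
definition ExN :: "fm \<Rightarrow> fm" where "ExN p = Neg (AllN (Neg p))"
definition ExS :: "fm \<Rightarrow> fm" where "ExS p = Neg (AllS (Neg p))"
definition Lt :: "tm \<Rightarrow> tm \<Rightarrow> fm" where "Lt t u = Conj (Le t u) (Neg (EqN t u))"

text \<open>
  Simultaneous substitution of terms \<open>\<sigma>\<close> for number variables and of set variables \<open>\<rho>\<close> for
  set variables.
\<close>

primrec subst_tm :: "(nat \<Rightarrow> tm) \<Rightarrow> (nat \<Rightarrow> nat) \<Rightarrow> tm \<Rightarrow> tm" where
  "subst_tm \<sigma> \<rho> (NV i) = \<sigma> i"
| "subst_tm \<sigma> \<rho> Zero = Zero"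
| "subst_tm \<sigma> \<rho> One = One"
| "subst_tm \<sigma> \<rho> (Add t u) = Add (subst_tm \<sigma> \<rho> t) (subst_tm \<sigma> \<rho> u)"
| "subst_tm \<sigma> \<rho> (Mul t u) = Mul (subst_tm \<sigma> \<rho> t) (subst_tm \<sigma> \<rho> u)"
| "subst_tm \<sigma> \<rho> (Len X) = Len (\<rho> X)"

abbreviation shiftN_tm :: "tm \<Rightarrow> tm" where
  "shiftN_tm \<equiv> subst_tm (\<lambda>i. NV (Suc i)) (\<lambda>X. X)"

abbreviation shiftS_tm :: "tm \<Rightarrow> tm" where
  "shiftS_tm \<equiv> subst_tm NV Suc"

primrec subst :: "(nat \<Rightarrow> tm) \<Rightarrow> (nat \<Rightarrow> nat) \<Rightarrow> fm \<Rightarrow> fm" where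
  "subst \<sigma> \<rho> Fls = Fls"
| "subst \<sigma> \<rho> (EqN t u) = EqN (subst_tm \<sigma> \<rho> t) (subst_tm \<sigma> \<rho> u)"
| "subst \<sigma> \<rho> (EqS X Y) = EqS (\<rho> X) (\<rho> Y)"
| "subst \<sigma> \<rho> (Le t u) = Le (subst_tm \<sigma> \<rho> t) (subst_tm \<sigma> \<rho> u)"
| "subst \<sigma> \<rho> (Mem t X) = Mem (subst_tm \<sigma> \<rho> t) (\<rho> X)"
| "subst \<sigma> \<rho> (Imp p q) = Imp (subst \<sigma> \<rho> p) (subst \<sigma> \<rho> q)"
| "subst \<sigma> \<rho> (AllN p) = AllN (subst (case_nat (NV 0) (\<lambda>i. shiftN_tm (\<sigma> i))) \<rho> p)"
| "subst \<sigma> \<rho> (AllS p) = AllS (subst (\<lambda>i. shiftS_tm (\<sigma> i)) (case_nat 0 (\<lambda>X. Suc (\<rho> X))) p)"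

abbreviation shiftN :: "fm \<Rightarrow> fm" where
  "shiftN \<equiv> subst (\<lambda>i. NV (Suc i)) (\<lambda>X. X)"

abbreviation shiftS :: "fm \<Rightarrow> fm" where
  "shiftS \<equiv> subst NV Suc"

abbreviation instN :: "tm \<Rightarrow> fm \<Rightarrow> fm" where
  "instN t \<equiv> subst (case_nat t NV) (\<lambda>X. X)"

abbreviation instS :: "nat \<Rightarrow> fm \<Rightarrow> fm" where
  "instS X \<equiv> subst NV (case_nat X (\<lambda>Y. Y))"

text \<open>
  Classical natural deduction with equality. The formulas of the theory \<open>T\<close> may be open and
  stand for their universal closures: rule \<open>Ax\<close> is available under any context, so their free
  variables can be generalised. The formulas of the context \<open>\<Gamma>\<close> are local hypotheses, whose
  free variables are fixed.
\<close>

inductive derivable :: "fm set \<Rightarrow> fm set \<Rightarrow> fm \<Rightarrow> bool" for T :: "fm set" where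
  Ax: "p \<in> T \<Longrightarrow> derivable T \<Gamma> p"
| Hyp: "p \<in> \<Gamma> \<Longrightarrow> derivable T \<Gamma> p"
| ImpI: "derivable T (insert p \<Gamma>) q \<Longrightarrow> derivable T \<Gamma> (Imp p q)"
| ImpE: "derivable T \<Gamma> (Imp p q) \<Longrightarrow> derivable T \<Gamma> p \<Longrightarrow> derivable T \<Gamma> q"
| RAA: "derivable T (insert (Neg p) \<Gamma>) Fls \<Longrightarrow> derivable T \<Gamma> p"
| AllNI: "derivable T (shiftN ` \<Gamma>) p \<Longrightarrow> derivable T \<Gamma> (AllN p)"
| AllNE: "derivable T \<Gamma> (AllN p) \<Longrightarrow> derivable T \<Gamma> (instN t p)"
| AllSI: "derivable T (shiftS ` \<Gamma>) p \<Longrightarrow> derivable T \<Gamma> (AllS p)"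
| AllSE: "derivable T \<Gamma> (AllS p) \<Longrightarrow> derivable T \<Gamma> (instS X p)"
| EqN_refl: "derivable T \<Gamma> (EqN t t)"
| EqN_subst: "derivable T \<Gamma> (EqN t u) \<Longrightarrow> derivable T \<Gamma> (instN t p) \<Longrightarrow> derivable T \<Gamma> (instN u p)"
| EqS_refl: "derivable T \<Gamma> (EqS X X)"
| EqS_subst: "derivable T \<Gamma> (EqS X Y) \<Longrightarrow> derivable T \<Gamma> (instS X p) \<Longrightarrow> derivable T \<Gamma> (instS Y p)"

definition proves :: "fm set \<Rightarrow> fm \<Rightarrow> bool" (infix "\<turnstile>" 50) where
  "T \<turnstile> p \<longleftrightarrow> derivable T {} p"


section \<open>The theory \<open>V\<^sup>0\<close>\<close>

text \<open>In the following axioms \<open>x, y\<close> are number variables 0, 1, and \<open>X, Y\<close> are set variables 0, 1.\<close>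

definition BASIC2 :: "fm set" where
  "BASIC2 = (let x = NV 0; y = NV 1; X = 0; Y = 1 in
    { Neg (EqN (Add x One) Zero),
      Imp (EqN (Add x One) (Add y One)) (EqN x y),
      EqN (Add x Zero) x,
      EqN (Add x (Add y One)) (Add (Add x y) One),
      EqN (Mul x Zero) Zero,
      EqN (Mul x (Add y One)) (Add (Mul x y) x),
      Imp (Conj (Le x y) (Le y x)) (EqN x y),
      Le x (Add x y),
      Le Zero x,
      Disj (Le x y) (Le y x),
      Iff (Le x y) (Lt x (Add y One)),
      Imp (Neg (EqN x Zero))
          (ExN (Conj (Le (NV 0) (shiftN_tm x)) (EqN (Add (NV 0) One) (shiftN_tm x)))),
      Imp (Mem y X) (Lt y (Len X)),
      Imp (EqN (Add y One) (Len X)) (Mem y X),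
      Imp (Conj (EqN (Len X) (Len Y))
                (AllN (Imp (Lt (NV 0) (Len X)) (Iff (Mem (NV 0) X) (Mem (NV 0) Y)))))
          (EqS X Y) })"

inductive SigmaB0 :: "fm \<Rightarrow> bool" where
  "SigmaB0 Fls"
| "SigmaB0 (EqN t u)"
| "SigmaB0 (EqS X Y)"
| "SigmaB0 (Le t u)"
| "SigmaB0 (Mem t X)"
| "SigmaB0 p \<Longrightarrow> SigmaB0 q \<Longrightarrow> SigmaB0 (Imp p q)"
| "SigmaB0 p \<Longrightarrow> SigmaB0 (AllN (Imp (Le (NV 0) (shiftN_tm t)) p))"
| "SigmaB0 p \<Longrightarrow> SigmaB0 (ExN (Conj (Le (NV 0) (shiftN_tm t)) p))"

text \<open>
  In the comprehension formula for \<open>p\<close>, the number variable 0 of \<open>p\<close> is the element variable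
  \<open>z\<close>, all its other variables are parameters (number variable 1 being the bound \<open>y\<close>); the
  shift makes the comprehended set not free in \<open>p\<close>.
\<close>

definition comprehension :: "fm \<Rightarrow> fm" where
  "comprehension p =
    ExS (Conj (Le (Len 0) (NV 0))
              (AllN (Imp (Lt (NV 0) (NV 1)) (Iff (Mem (NV 0) 0) (shiftS p)))))"

definition V0 :: "fm set" where
  "V0 = BASIC2 \<union> {comprehension p | p. SigmaB0 p}"


section \<open>Writing formulas with named binders\<close>

text \<open>
  To write large formulas legibly, we use expressions that are functions of the numbers \<open>k\<close>
  and \<open>l\<close> of enclosing number and set quantifiers. A quantifier at depth \<open>k\<close> passes to its
  body an expression for the bound variable, which at the depth \<open>k' > k\<close> of an occurrence
  yields the de Bruijn index \<open>k' - Suc k\<close>. Thus HOL binders name the object-level variables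
  and no explicit shifting is needed.
\<close>

type_synonym nexp = "nat \<Rightarrow> nat \<Rightarrow> tm"
type_synonym sexp = "nat \<Rightarrow> nat \<Rightarrow> nat"
type_synonym form = "nat \<Rightarrow> nat \<Rightarrow> fm"

definition sentence :: "form \<Rightarrow> fm" where "sentence P = P 0 0"

definition zero :: nexp ("\<^bold>0") where "\<^bold>0 = (\<lambda>k l. Zero)"
definition one :: nexp ("\<^bold>1") where "\<^bold>1 = (\<lambda>k l. One)"
definition add :: "nexp \<Rightarrow> nexp \<Rightarrow> nexp" (infixl "\<^bold>+" 65) where
  "x \<^bold>+ y = (\<lambda>k l. Add (x k l) (y k l))"
definition mul :: "nexp \<Rightarrow> nexp \<Rightarrow> nexp" (infixl "\<^bold>*" 70) where
  "x \<^bold>* y = (\<lambda>k l. Mul (x k l) (y k l))"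
definition len :: "sexp \<Rightarrow> nexp" where
  "len X = (\<lambda>k l. Len (X k l))"

definition eqn :: "nexp \<Rightarrow> nexp \<Rightarrow> form" (infix "\<^bold>=" 50) where
  "x \<^bold>= y = (\<lambda>k l. EqN (x k l) (y k l))"
definition eqs :: "sexp \<Rightarrow> sexp \<Rightarrow> form" (infix "\<^bold>\<approx>" 50) where
  "X \<^bold>\<approx> Y = (\<lambda>k l. EqS (X k l) (Y k l))"
definition le :: "nexp \<Rightarrow> nexp \<Rightarrow> form" (infix "\<^bold>\<le>" 50) where
  "x \<^bold>\<le> y = (\<lambda>k l. Le (x k l) (y k l))"
definition mem :: "nexp \<Rightarrow> sexp \<Rightarrow> form" (infix "\<^bold>\<in>" 50) where
  "x \<^bold>\<in> X = (\<lambda>k l. Mem (x k l) (X k l))"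

definition neg :: "form \<Rightarrow> form" ("\<^bold>\<not> _" [40] 40) where
  "(\<^bold>\<not> P) = (\<lambda>k l. Neg (P k l))"
definition conj :: "form \<Rightarrow> form \<Rightarrow> form" (infixr "\<^bold>\<and>" 35) where
  "(P \<^bold>\<and> Q) = (\<lambda>k l. Conj (P k l) (Q k l))"
definition disj :: "form \<Rightarrow> form \<Rightarrow> form" (infixr "\<^bold>\<or>" 30) where
  "(P \<^bold>\<or> Q) = (\<lambda>k l. Disj (P k l) (Q k l))"
definition imp :: "form \<Rightarrow> form \<Rightarrow> form" (infixr "\<^bold>\<longrightarrow>" 25) where
  "(P \<^bold>\<longrightarrow> Q) = (\<lambda>k l. Imp (P k l) (Q k l))"
definition iff :: "form \<Rightarrow> form \<Rightarrow> form" (infixr "\<^bold>\<longleftrightarrow>" 25) where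
  "(P \<^bold>\<longleftrightarrow> Q) = (\<lambda>k l. Iff (P k l) (Q k l))"
definition ite :: "form \<Rightarrow> form \<Rightarrow> form \<Rightarrow> form" where
  "ite P Q R = (P \<^bold>\<and> Q \<^bold>\<or> \<^bold>\<not> P \<^bold>\<and> R)"

definition alln :: "(nexp \<Rightarrow> form) \<Rightarrow> form" (binder "\<^bold>\<forall>" 10) where
  "alln F = (\<lambda>k l. AllN (F (\<lambda>k' l'. NV (k' - Suc k)) (Suc k) l))"
definition exn :: "(nexp \<Rightarrow> form) \<Rightarrow> form" (binder "\<^bold>\<exists>" 10) where
  "exn F = (\<lambda>k l. ExN (F (\<lambda>k' l'. NV (k' - Suc k)) (Suc k) l))"
definition alls :: "(sexp \<Rightarrow> form) \<Rightarrow> form" (binder "\<^bold>\<forall>\<^sub>S" 10) where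
  "alls F = (\<lambda>k l. AllS (F (\<lambda>k' l'. l' - Suc l) k (Suc l)))"

definition all_le :: "nexp \<Rightarrow> (nexp \<Rightarrow> form) \<Rightarrow> form" where
  "all_le t F = (\<^bold>\<forall>x. x \<^bold>\<le> t \<^bold>\<longrightarrow> F x)"
definition ex_le :: "nexp \<Rightarrow> (nexp \<Rightarrow> form) \<Rightarrow> form" where
  "ex_le t F = (\<^bold>\<exists>x. x \<^bold>\<le> t \<^bold>\<and> F x)"

definition all_from1 :: "nexp \<Rightarrow> (nexp \<Rightarrow> form) \<Rightarrow> form" where
  "all_from1 t F = all_le t (\<lambda>x. \<^bold>1 \<^bold>\<le> x \<^bold>\<longrightarrow> F x)"
definition ex_from1 :: "nexp \<Rightarrow> (nexp \<Rightarrow> form) \<Rightarrow> form" where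
  "ex_from1 t F = ex_le t (\<lambda>x. \<^bold>1 \<^bold>\<le> x \<^bold>\<and> F x)"

abbreviation two :: nexp ("\<^bold>2") where "\<^bold>2 \<equiv> \<^bold>1 \<^bold>+ \<^bold>1"
abbreviation three :: nexp ("\<^bold>3") where "\<^bold>3 \<equiv> \<^bold>1 \<^bold>+ \<^bold>1 \<^bold>+ \<^bold>1"

definition evn :: "nexp \<Rightarrow> form" where "evn x = ex_le x (\<lambda>h. x \<^bold>= h \<^bold>+ h)"
definition odd1 :: "nexp \<Rightarrow> form" where "odd1 x = ex_le x (\<lambda>h. x \<^bold>= h \<^bold>+ h \<^bold>+ \<^bold>1)"


section \<open>Coding of tuples, CNFs and assignments\<close>

text \<open>
  \<open>pair x y K\<close> says \<open>K \<langle>x, y\<rangle>\<close> for the Cantor pairing \<open>\<langle>x, y\<rangle> = (x + y)(x + y + 1)/2 + x\<close>,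
  which is not a term of the language. The quantified \<open>z\<close> is determined by its defining equation.
\<close>

definition pair :: "nexp \<Rightarrow> nexp \<Rightarrow> (nexp \<Rightarrow> form) \<Rightarrow> form" where
  "pair x y K = ex_le ((x \<^bold>+ y) \<^bold>* (x \<^bold>+ y \<^bold>+ \<^bold>1) \<^bold>+ (x \<^bold>+ x))
     (\<lambda>z. z \<^bold>+ z \<^bold>= (x \<^bold>+ y) \<^bold>* (x \<^bold>+ y \<^bold>+ \<^bold>1) \<^bold>+ (x \<^bold>+ x) \<^bold>\<and> K z)"

definition triple :: "nexp \<Rightarrow> nexp \<Rightarrow> nexp \<Rightarrow> (nexp \<Rightarrow> form) \<Rightarrow> form" where
  "triple x y z K = pair x y (\<lambda>w. pair w z K)"

definition mem2 :: "nexp \<Rightarrow> nexp \<Rightarrow> sexp \<Rightarrow> form" where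
  "mem2 x y X = pair x y (\<lambda>w. w \<^bold>\<in> X)"
definition mem3 :: "nexp \<Rightarrow> nexp \<Rightarrow> nexp \<Rightarrow> sexp \<Rightarrow> form" where
  "mem3 x y z X = triple x y z (\<lambda>w. w \<^bold>\<in> X)"

text \<open>The symbol \<open>-1\<close>, both in \<open>\<phi>\<close> and as a flag, is represented by 2.\<close>

abbreviation minus1 :: nexp where "minus1 \<equiv> \<^bold>2"

definition is_sign :: "nexp \<Rightarrow> form" where
  "is_sign s = (s \<^bold>= minus1 \<^bold>\<or> s \<^bold>= \<^bold>0 \<^bold>\<or> s \<^bold>= \<^bold>1)"
definition is_bit :: "nexp \<Rightarrow> form" where
  "is_bit s = (s \<^bold>= \<^bold>0 \<^bold>\<or> s \<^bold>= \<^bold>1)"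

definition CNF :: "nexp \<Rightarrow> nexp \<Rightarrow> sexp \<Rightarrow> form" where
  "CNF n m \<phi> =
    (all_le (len \<phi>) (\<lambda>z. z \<^bold>\<in> \<phi> \<^bold>\<longrightarrow>
        ex_from1 n (\<lambda>i. ex_from1 m (\<lambda>j. ex_le \<^bold>2 (\<lambda>s.
          is_sign s \<^bold>\<and> triple i j s (\<lambda>w. w \<^bold>= z))))) \<^bold>\<and>
     all_from1 n (\<lambda>i. all_from1 m (\<lambda>j.
        ex_le \<^bold>2 (\<lambda>s. is_sign s \<^bold>\<and> mem3 i j s \<phi>) \<^bold>\<and>
        all_le \<^bold>2 (\<lambda>s. all_le \<^bold>2 (\<lambda>s'. mem3 i j s \<phi> \<^bold>\<and> mem3 i j s' \<phi> \<^bold>\<longrightarrow> s \<^bold>= s')))))"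

definition assignment :: "nexp \<Rightarrow> sexp \<Rightarrow> form" where
  "assignment m a =
    (all_le (len a) (\<lambda>z. z \<^bold>\<in> a \<^bold>\<longrightarrow>
        ex_from1 m (\<lambda>j. ex_le \<^bold>1 (\<lambda>v. is_bit v \<^bold>\<and> pair j v (\<lambda>w. w \<^bold>= z)))) \<^bold>\<and>
     all_from1 m (\<lambda>j.
        ex_le \<^bold>1 (\<lambda>v. is_bit v \<^bold>\<and> mem2 j v a) \<^bold>\<and>
        all_le \<^bold>1 (\<lambda>v. all_le \<^bold>1 (\<lambda>v'. mem2 j v a \<^bold>\<and> mem2 j v' a \<^bold>\<longrightarrow> v \<^bold>= v'))))"

definition Sat :: "nexp \<Rightarrow> nexp \<Rightarrow> sexp \<Rightarrow> sexp \<Rightarrow> form" where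
  "Sat n m a \<phi> =
    all_from1 n (\<lambda>i. ex_from1 m (\<lambda>j. ex_le \<^bold>2 (\<lambda>s. (s \<^bold>= minus1 \<^bold>\<or> s \<^bold>= \<^bold>1) \<^bold>\<and>
      mem3 i j s \<phi> \<^bold>\<and>
      (s \<^bold>= \<^bold>1 \<^bold>\<and> mem2 j \<^bold>1 a \<^bold>\<or> s \<^bold>= minus1 \<^bold>\<and> mem2 j \<^bold>0 a))))"


section \<open>States and configurations\<close>

text \<open>
  A state is handled as the tuple of its components; its code is the code of the tuple
  \<open>((row, col), flag, av, pd, pc, label)\<close>, where \<open>(row, col) = coord\<close> and \<open>av\<close> is the
  component \<open>a\<close>. The symbol \<open>\<box>\<close> is represented by 3, except in
  the two entries of \<open>coord\<close>, where it is represented by \<open>n + m + 2\<close>.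
\<close>

datatype state = State (row: nexp) (col: nexp) (flag: nexp) (av: nexp) (pd: nexp) (pc: nexp)
  (label: nexp)

abbreviation absent :: nexp where "absent \<equiv> \<^bold>3"

definition quiescent :: "nexp \<Rightarrow> nexp \<Rightarrow> state" where
  "quiescent n m = State (n \<^bold>+ m \<^bold>+ \<^bold>2) (n \<^bold>+ m \<^bold>+ \<^bold>2) absent absent absent absent absent"

definition state_eq :: "state \<Rightarrow> state \<Rightarrow> form" where
  "state_eq s t = (row s \<^bold>= row t \<^bold>\<and> col s \<^bold>= col t \<^bold>\<and> flag s \<^bold>= flag t \<^bold>\<and> av s \<^bold>= av t \<^bold>\<and>
     pd s \<^bold>= pd t \<^bold>\<and> pc s \<^bold>= pc t \<^bold>\<and> label s \<^bold>= label t)"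

text \<open>The codes of all components of states are bounded by \<open>n + m + 3\<close>.\<close>

definition ex_state :: "nexp \<Rightarrow> nexp \<Rightarrow> (state \<Rightarrow> form) \<Rightarrow> form" where
  "ex_state n m F = (let b = n \<^bold>+ m \<^bold>+ \<^bold>3 in
     ex_le b (\<lambda>i. ex_le b (\<lambda>j. ex_le b (\<lambda>f. ex_le b (\<lambda>a. ex_le b (\<lambda>d. ex_le b (\<lambda>c.
       ex_le b (\<lambda>e. F (State i j f a d c e)))))))))"

definition state_code :: "state \<Rightarrow> (nexp \<Rightarrow> form) \<Rightarrow> form" where
  "state_code s K =
     pair (row s) (col s) (\<lambda>w. pair w (flag s) (\<lambda>w. pair w (av s) (\<lambda>w. pair w (pd s) (\<lambda>w.
       pair w (pc s) (\<lambda>w. pair w (label s) K)))))"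

text \<open>\<open>s\<close> belongs to \<open>S\<^bsub>n,m\<^esub>\<close> and is not quiescent; the disjuncts are the types (1)-(6).\<close>

definition active_state :: "nexp \<Rightarrow> nexp \<Rightarrow> state \<Rightarrow> form" where
  "active_state n m s = (is_bit (label s) \<^bold>\<and>
    ( row s \<^bold>= \<^bold>0 \<^bold>\<and> col s \<^bold>= \<^bold>0 \<^bold>\<and> flag s \<^bold>= absent \<^bold>\<and> av s \<^bold>= absent \<^bold>\<and>
        pd s \<^bold>= absent \<^bold>\<and> pc s \<^bold>= absent
    \<^bold>\<or> \<^bold>1 \<^bold>\<le> row s \<^bold>\<and> row s \<^bold>\<le> n \<^bold>\<and> col s \<^bold>= \<^bold>0 \<^bold>\<and> flag s \<^bold>= absent \<^bold>\<and> av s \<^bold>= absent \<^bold>\<and>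
        pd s \<^bold>= absent \<^bold>\<and> pc s \<^bold>= absent
    \<^bold>\<or> row s \<^bold>= \<^bold>0 \<^bold>\<and> \<^bold>1 \<^bold>\<le> col s \<^bold>\<and> col s \<^bold>\<le> m \<^bold>\<and> flag s \<^bold>= absent \<^bold>\<and> is_bit (av s) \<^bold>\<and>
        pd s \<^bold>= absent \<^bold>\<and> pc s \<^bold>= absent
    \<^bold>\<or> row s \<^bold>= \<^bold>0 \<^bold>\<and> col s \<^bold>= m \<^bold>+ \<^bold>1 \<^bold>\<and> flag s \<^bold>= absent \<^bold>\<and> av s \<^bold>= absent \<^bold>\<and>
        pd s \<^bold>= absent \<^bold>\<and> pc s \<^bold>= absent
    \<^bold>\<or> \<^bold>1 \<^bold>\<le> row s \<^bold>\<and> row s \<^bold>\<le> n \<^bold>\<and> col s \<^bold>= m \<^bold>+ \<^bold>1 \<^bold>\<and> flag s \<^bold>= absent \<^bold>\<and> av s \<^bold>= absent \<^bold>\<and>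
        pd s \<^bold>= absent \<^bold>\<and> is_bit (pc s)
    \<^bold>\<or> \<^bold>1 \<^bold>\<le> row s \<^bold>\<and> row s \<^bold>\<le> n \<^bold>\<and> \<^bold>1 \<^bold>\<le> col s \<^bold>\<and> col s \<^bold>\<le> m \<^bold>\<and> is_sign (flag s) \<^bold>\<and>
        is_bit (av s) \<^bold>\<and> is_bit (pd s) \<^bold>\<and> pc s \<^bold>= absent ))"

text \<open>
  \<open>C\<close> is the graph of a function from \<open>[n+1] \<times> [m+2]\<close> to the non-quiescent states. Existence and
  uniqueness of the value are expressed through the code \<open>z\<close> of the state.
\<close>

definition config :: "nexp \<Rightarrow> nexp \<Rightarrow> sexp \<Rightarrow> form" where
  "config n m C =
    (all_le (len C) (\<lambda>z. z \<^bold>\<in> C \<^bold>\<longrightarrow>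
        ex_le n (\<lambda>p. ex_le (m \<^bold>+ \<^bold>1) (\<lambda>q. ex_state n m (\<lambda>s.
          active_state n m s \<^bold>\<and> state_code s (\<lambda>w. triple p q w (\<lambda>u. u \<^bold>= z)))))) \<^bold>\<and>
     all_le n (\<lambda>p. all_le (m \<^bold>+ \<^bold>1) (\<lambda>q.
        ex_state n m (\<lambda>s. active_state n m s \<^bold>\<and> state_code s (\<lambda>w. mem3 p q w C)) \<^bold>\<and>
        all_le (len C) (\<lambda>z. all_le (len C) (\<lambda>z'.
          mem3 p q z C \<^bold>\<and> mem3 p q z' C \<^bold>\<longrightarrow> z \<^bold>= z')))))"

datatype dir = Right | Left | Below | Above

text \<open>\<open>step d p q p' q'\<close> says that \<open>(p', q')\<close> is the neighbour of \<open>(p, q)\<close> in direction \<open>d\<close>.\<close>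

fun step :: "dir \<Rightarrow> nexp \<Rightarrow> nexp \<Rightarrow> nexp \<Rightarrow> nexp \<Rightarrow> form" where
  "step Right p q p' q' = (p' \<^bold>= p \<^bold>\<and> q' \<^bold>= q \<^bold>+ \<^bold>1)"
| "step Left p q p' q' = (p' \<^bold>= p \<^bold>\<and> q' \<^bold>+ \<^bold>1 \<^bold>= q)"
| "step Below p q p' q' = (p' \<^bold>= p \<^bold>+ \<^bold>1 \<^bold>\<and> q' \<^bold>= q)"
| "step Above p q p' q' = (p' \<^bold>+ \<^bold>1 \<^bold>= p \<^bold>\<and> q' \<^bold>= q)"

text \<open>
  If the neighbour of \<open>(p, q)\<close> in direction \<open>d\<close> is a position \<open>(p', q')\<close> in \<open>[n+1] \<times> [m+2]\<close>, then
  \<open>P p' q'\<close>; otherwise \<open>Q\<close>.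
\<close>

definition at_neighbour ::
  "nexp \<Rightarrow> nexp \<Rightarrow> dir \<Rightarrow> nexp \<Rightarrow> nexp \<Rightarrow> (nexp \<Rightarrow> nexp \<Rightarrow> form) \<Rightarrow> form \<Rightarrow> form" where
  "at_neighbour n m d p q P Q =
    (ex_le n (\<lambda>p'. ex_le (m \<^bold>+ \<^bold>1) (\<lambda>q'. step d p q p' q' \<^bold>\<and> P p' q')) \<^bold>\<or>
     (\<^bold>\<not> ex_le n (\<lambda>p'. ex_le (m \<^bold>+ \<^bold>1) (\<lambda>q'. step d p q p' q'))) \<^bold>\<and> Q)"

text \<open>\<open>s\<close> is the state in configuration \<open>C\<close> of the neighbour of \<open>(p, q)\<close> in direction \<open>d\<close>.\<close>

definition neighbour_state ::
  "nexp \<Rightarrow> nexp \<Rightarrow> sexp \<Rightarrow> dir \<Rightarrow> nexp \<Rightarrow> nexp \<Rightarrow> state \<Rightarrow> form" where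
  "neighbour_state n m C d p q s =
    at_neighbour n m d p q (\<lambda>p' q'. state_code s (\<lambda>w. mem3 p' q' w C))
      (state_eq s (quiescent n m))"

definition neighbourhood ::
  "nexp \<Rightarrow> nexp \<Rightarrow> sexp \<Rightarrow> nexp \<Rightarrow> nexp \<Rightarrow> state \<Rightarrow> state \<Rightarrow> state \<Rightarrow> state \<Rightarrow> state \<Rightarrow> form" where
  "neighbourhood n m C p q s1 s2 s3 s4 s5 =
    (state_code s1 (\<lambda>w. mem3 p q w C) \<^bold>\<and>
     neighbour_state n m C Right p q s2 \<^bold>\<and> neighbour_state n m C Left p q s3 \<^bold>\<and>
     neighbour_state n m C Below p q s4 \<^bold>\<and> neighbour_state n m C Above p q s5)"


section \<open>The automaton\<close>

text \<open>\<open>(flag, av)\<close> of \<open>s\<close> makes the literal at its coordinates true.\<close>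

definition lit_true :: "state \<Rightarrow> form" where
  "lit_true s = (flag s \<^bold>= \<^bold>1 \<^bold>\<and> av s \<^bold>= \<^bold>1 \<^bold>\<or> flag s \<^bold>= minus1 \<^bold>\<and> av s \<^bold>= \<^bold>0)"

definition coord_ok :: "nexp \<Rightarrow> nexp \<Rightarrow> state \<Rightarrow> dir \<Rightarrow> state \<Rightarrow> form" where
  "coord_ok n m s1 d s =
    at_neighbour n m d (row s1) (col s1) (\<lambda>i j. row s \<^bold>= i \<^bold>\<and> col s \<^bold>= j)
      (state_eq s (quiescent n m))"

text \<open>The conjuncts are the conditions (A), (B), (C1)-(C3), (D1), (D2) and (E).\<close>

definition locally_correct ::
  "nexp \<Rightarrow> nexp \<Rightarrow> sexp \<Rightarrow> state \<Rightarrow> state \<Rightarrow> state \<Rightarrow> state \<Rightarrow> state \<Rightarrow> form" where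
  "locally_correct n m \<phi> s1 s2 s3 s4 s5 =
    (let i = row s1; j = col s1; q = quiescent n m;
         clause_row = (\<^bold>1 \<^bold>\<le> i \<^bold>\<and> i \<^bold>\<le> n);
         variable_col = (\<^bold>1 \<^bold>\<le> j \<^bold>\<and> j \<^bold>\<le> m);
         pos = mem3 i j \<^bold>1 \<phi>;
         ngt = mem3 i j minus1 \<phi>
     in
      (coord_ok n m s1 Right s2 \<^bold>\<and> coord_ok n m s1 Left s3 \<^bold>\<and>
       coord_ok n m s1 Below s4 \<^bold>\<and> coord_ok n m s1 Above s5) \<^bold>\<and>
      (clause_row \<^bold>\<and> variable_col \<^bold>\<longrightarrow>
        (flag s1 \<^bold>= \<^bold>1 \<^bold>\<longleftrightarrow> pos) \<^bold>\<and> (flag s1 \<^bold>= minus1 \<^bold>\<longleftrightarrow> ngt) \<^bold>\<and>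
        (flag s1 \<^bold>= \<^bold>0 \<^bold>\<longleftrightarrow> \<^bold>\<not> pos \<^bold>\<and> \<^bold>\<not> ngt)) \<^bold>\<and>
      (variable_col \<^bold>\<longrightarrow>
        (\<^bold>\<not> state_eq s4 q \<^bold>\<longrightarrow> av s4 \<^bold>= av s1) \<^bold>\<and>
        (\<^bold>\<not> state_eq s5 q \<^bold>\<longrightarrow> av s5 \<^bold>= av s1)) \<^bold>\<and>
      (j \<^bold>= m \<^bold>+ \<^bold>1 \<^bold>\<and> \<^bold>2 \<^bold>\<le> i \<^bold>\<longrightarrow> (pc s1 \<^bold>= \<^bold>1 \<^bold>\<longleftrightarrow> pc s5 \<^bold>= \<^bold>1 \<^bold>\<and> pd s3 \<^bold>= \<^bold>1)) \<^bold>\<and>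
      (i \<^bold>= \<^bold>1 \<^bold>\<and> j \<^bold>= m \<^bold>+ \<^bold>1 \<^bold>\<longrightarrow> (pc s1 \<^bold>= \<^bold>1 \<^bold>\<longleftrightarrow> pd s3 \<^bold>= \<^bold>1)) \<^bold>\<and>
      (clause_row \<^bold>\<and> \<^bold>2 \<^bold>\<le> j \<^bold>\<and> j \<^bold>\<le> m \<^bold>\<longrightarrow> (pd s1 \<^bold>= \<^bold>1 \<^bold>\<longleftrightarrow> pd s3 \<^bold>= \<^bold>1 \<^bold>\<or> lit_true s1)) \<^bold>\<and>
      (clause_row \<^bold>\<and> j \<^bold>= \<^bold>1 \<^bold>\<longrightarrow> (pd s1 \<^bold>= \<^bold>1 \<^bold>\<longleftrightarrow> lit_true s1)) \<^bold>\<and>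
      ((\<^bold>\<not> (clause_row \<^bold>\<and> variable_col) \<^bold>\<longrightarrow> flag s1 \<^bold>= absent \<^bold>\<and> pd s1 \<^bold>= absent) \<^bold>\<and>
       (\<^bold>\<not> variable_col \<^bold>\<longrightarrow> av s1 \<^bold>= absent) \<^bold>\<and>
       (\<^bold>\<not> (clause_row \<^bold>\<and> j \<^bold>= m \<^bold>+ \<^bold>1) \<^bold>\<longrightarrow> pc s1 \<^bold>= absent)))"

definition blue ::
  "nexp \<Rightarrow> nexp \<Rightarrow> sexp \<Rightarrow> state \<Rightarrow> state \<Rightarrow> state \<Rightarrow> state \<Rightarrow> state \<Rightarrow> form" where
  "blue n m \<phi> s1 s2 s3 s4 s5 =
    ((\<^bold>\<not> state_eq s1 (quiescent n m)) \<^bold>\<and>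
     locally_correct n m \<phi> s1 s2 s3 s4 s5 \<^bold>\<and>
     (row s1 \<^bold>= n \<^bold>\<and> col s1 \<^bold>= m \<^bold>+ \<^bold>1 \<^bold>\<longrightarrow> pc s1 \<^bold>= \<^bold>1))"

text \<open>\<open>suc(i, j) = (i', j')\<close>\<close>

definition successor ::
  "nexp \<Rightarrow> nexp \<Rightarrow> nexp \<Rightarrow> nexp \<Rightarrow> nexp \<Rightarrow> nexp \<Rightarrow> form" where
  "successor n m i j i' j' =
    ite (i \<^bold>= \<^bold>0 \<^bold>\<and> j \<^bold>= \<^bold>0 \<^bold>\<or> evn i \<^bold>\<and> \<^bold>1 \<^bold>\<le> j \<^bold>\<and> j \<^bold>\<le> m) (step Right i j i' j')
   (ite (i \<^bold>= n \<^bold>\<and> j \<^bold>= \<^bold>1 \<^bold>\<or> odd1 i \<^bold>\<and> \<^bold>2 \<^bold>\<le> j \<^bold>\<and> j \<^bold>\<le> m \<^bold>+ \<^bold>1) (step Left i j i' j')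
   (ite (odd1 i \<^bold>\<and> j \<^bold>= \<^bold>1 \<^bold>\<or> evn i \<^bold>\<and> j \<^bold>= m \<^bold>+ \<^bold>1) (step Below i j i' j')
        (\<^bold>1 \<^bold>\<le> i \<^bold>\<and> j \<^bold>= \<^bold>0 \<^bold>\<and> step Above i j i' j')))"

text \<open>\<open>v\<close> is \<open>s1\<close> with label replaced by \<open>label(s1) \<oplus> label(s)\<close>.\<close>

definition xor_label :: "state \<Rightarrow> state \<Rightarrow> state \<Rightarrow> form" where
  "xor_label v s1 s =
    (row v \<^bold>= row s1 \<^bold>\<and> col v \<^bold>= col s1 \<^bold>\<and> flag v \<^bold>= flag s1 \<^bold>\<and> av v \<^bold>= av s1 \<^bold>\<and>
     pd v \<^bold>= pd s1 \<^bold>\<and> pc v \<^bold>= pc s1 \<^bold>\<and>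
     ite (label s1 \<^bold>= label s) (label v \<^bold>= \<^bold>0) (label v \<^bold>= \<^bold>1))"

definition xor_if_successor :: "nexp \<Rightarrow> nexp \<Rightarrow> state \<Rightarrow> state \<Rightarrow> state \<Rightarrow> form" where
  "xor_if_successor n m s1 s v =
    (successor n m (row s1) (col s1) (row s) (col s) \<^bold>\<and> xor_label v s1 s)"

text \<open>\<open>f\<^sub>\<phi>(s1, ..., s5) = v\<close>\<close>

definition local_rule ::
  "nexp \<Rightarrow> nexp \<Rightarrow> sexp \<Rightarrow> state \<Rightarrow> state \<Rightarrow> state \<Rightarrow> state \<Rightarrow> state \<Rightarrow> state \<Rightarrow> form" where
  "local_rule n m \<phi> s1 s2 s3 s4 s5 v =
    ite (blue n m \<phi> s1 s2 s3 s4 s5)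
      (xor_if_successor n m s1 s2 v \<^bold>\<or> xor_if_successor n m s1 s3 v \<^bold>\<or>
       xor_if_successor n m s1 s4 v \<^bold>\<or> xor_if_successor n m s1 s5 v)
      (state_eq v s1)"

text \<open>\<open>v\<close> is the value of \<open>f\<^sub>\<phi>\<close> on the neighbourhood of \<open>(p, q)\<close> in \<open>C\<close>, that is, \<open>A\<^sub>\<phi>(C)(p, q) = v\<close>.\<close>

definition image_state ::
  "nexp \<Rightarrow> nexp \<Rightarrow> sexp \<Rightarrow> sexp \<Rightarrow> nexp \<Rightarrow> nexp \<Rightarrow> state \<Rightarrow> form" where
  "image_state n m \<phi> C p q v =
    ex_state n m (\<lambda>s1. ex_state n m (\<lambda>s2. ex_state n m (\<lambda>s3. ex_state n m (\<lambda>s4. ex_state n m (\<lambda>s5.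
      neighbourhood n m C p q s1 s2 s3 s4 s5 \<^bold>\<and> local_rule n m \<phi> s1 s2 s3 s4 s5 v)))))"

definition same_image :: "nexp \<Rightarrow> nexp \<Rightarrow> sexp \<Rightarrow> sexp \<Rightarrow> sexp \<Rightarrow> form" where
  "same_image n m \<phi> C C' =
    all_le n (\<lambda>p. all_le (m \<^bold>+ \<^bold>1) (\<lambda>q. ex_state n m (\<lambda>v.
      image_state n m \<phi> C p q v \<^bold>\<and> image_state n m \<phi> C' p q v)))"

end

theory Submission
  imports Defs "HOL-Library.Countable_Set"
begin

text \<open>
  If an assignment satisfies \<open>\<phi>\<close>, then the two configurations with correct coordinates, flags,
  assignment values, partial disjunctions and partial conjunctions, and with label 0 everywhere or
  label 1 everywhere, have only blue states. Since \<open>0 \<oplus> 0 = 1 \<oplus> 1 = 0\<close>, both are mapped to the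
  first one, so \<open>A\<^sub>\<phi>\<close> is not injective; no counting along the cycle of successors is needed, only
  that the successor of each position is a neighbour inside the rectangle. Both configurations
  exist by \<open>\<Sigma>\<^sup>B\<^sub>0\<close>-comprehension. The argument is carried out in an arbitrary model of \<open>V\<^sup>0\<close> and
  transferred to derivability by a Henkin construction; since derivations may start from open
  axioms and finite contexts, fresh variables serve as Henkin witnesses.
\<close>

section \<open>Substitution\<close>

text \<open>Reasoning in a model avoids formal derivations, but the model may be nonstandard: its
  numbers obey induction only for predicates defined by \<Sigma>^B_0-formulas with parameters. This
  obstacle shapes most of the development. Each predicate used in an induction or a comprehension
  must come with a bounded formula, so a calculus of denotations establishes boundedness and truth
  value in one go. For the same reason the partial disjunctions and conjunctions of the two
  configurations cannot be obtained by recursion along rows and columns; they are given in closed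
  form, by a bounded quantifier and by the constant 1. Oddness of n enters at one place only: it
  keeps the successor of a position in row n from leaving the rectangle downwards.\<close>

abbreviation liftN :: "(nat \<Rightarrow> tm) \<Rightarrow> nat \<Rightarrow> tm" where
  "liftN \<sigma> \<equiv> case_nat (NV 0) (\<lambda>i. shiftN_tm (\<sigma> i))"

abbreviation liftS :: "(nat \<Rightarrow> nat) \<Rightarrow> nat \<Rightarrow> nat" where
  "liftS \<rho> \<equiv> case_nat 0 (\<lambda>X. Suc (\<rho> X))"

lemma subst_tm_subst_tm:
  "subst_tm \<sigma> \<rho> (subst_tm \<sigma>' \<rho>' t) = subst_tm (\<lambda>i. subst_tm \<sigma> \<rho> (\<sigma>' i)) (\<lambda>X. \<rho> (\<rho>' X)) t"
  by (induction t) auto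

lemma liftN_comp: "subst_tm (liftN \<sigma>) \<rho> (liftN \<sigma>' i) = liftN (\<lambda>i. subst_tm \<sigma> \<rho> (\<sigma>' i)) i"
  by (cases i) (simp_all add: subst_tm_subst_tm)

lemma liftS_comp: "liftS \<rho> (liftS \<rho>' i) = liftS (\<lambda>i. \<rho> (\<rho>' i)) i"
  by (cases i) simp_all

lemma subst_subst:
  "subst \<sigma> \<rho> (subst \<sigma>' \<rho>' p) = subst (\<lambda>i. subst_tm \<sigma> \<rho> (\<sigma>' i)) (\<lambda>X. \<rho> (\<rho>' X)) p"
proof (induction p arbitrary: \<sigma> \<rho> \<sigma>' \<rho>')
  case (AllN p)
  show ?case by (simp add: AllN liftN_comp)
next
  case (AllS p)
  show ?case by (simp add: AllS liftS_comp subst_tm_subst_tm)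
qed (simp_all add: subst_tm_subst_tm)

lemma subst_tm_NV: "subst_tm NV (\<lambda>X. X) t = t"
  by (induction t) auto

text \<open>A formula has finitely many free variables. Stating this as dependence of substitution
  on an initial segment avoids a separate definition of free variables and is directly the form in
  which freshness is used.\<close>

lemma subst_cong_upto:
  "\<exists>k. \<forall>\<sigma> \<sigma>' \<rho> \<rho>'. (\<forall>i<k. \<sigma> i = \<sigma>' i) \<and> (\<forall>X<k. \<rho> X = \<rho>' X) \<longrightarrow> subst \<sigma> \<rho> p = subst \<sigma>' \<rho>' p"
  (is "\<exists>k. ?P k p")
proof -
  have tm: "\<exists>k. \<forall>\<sigma> \<sigma>' \<rho> \<rho>'. (\<forall>i<k. \<sigma> i = \<sigma>' i) \<and> (\<forall>X<k. \<rho> X = \<rho>' X) \<longrightarrow>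
      subst_tm \<sigma> \<rho> t = subst_tm \<sigma>' \<rho>' t" (is "\<exists>k. ?Q k t") for t
  proof (induction t)
    case (NV x)
    show ?case by (rule exI[of _ "Suc x"]) simp
  next
    case (Len x)
    show ?case by (rule exI[of _ "Suc x"]) simp
  next
    case (Add t u)
    then obtain k k' where "?Q k t" "?Q k' u" by blast
    then show ?case by (intro exI[of _ "max k k'"]) (metis less_max_iff_disj subst_tm.simps(4))
  next
    case (Mul t u)
    then obtain k k' where "?Q k t" "?Q k' u" by blast
    then show ?case by (intro exI[of _ "max k k'"]) (metis less_max_iff_disj subst_tm.simps(5))
  qed auto
  show ?thesis
  proof (induction p)
    case (EqN t u)
    from tm[of t] tm[of u] obtain k k' where "?Q k t" "?Q k' u" by blast
    then show ?case by (intro exI[of _ "max k k'"]) (metis less_max_iff_disj subst.simps(2))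
  next
    case (Le t u)
    from tm[of t] tm[of u] obtain k k' where "?Q k t" "?Q k' u" by blast
    then show ?case by (intro exI[of _ "max k k'"]) (metis less_max_iff_disj subst.simps(4))
  next
    case (Mem t X)
    from tm[of t] obtain k where "?Q k t" by blast
    then show ?case
      by (intro exI[of _ "max k (Suc X)"]) (metis less_max_iff_disj subst.simps(5) lessI)
  next
    case (Imp p q)
    then obtain k k' where "?P k p" "?P k' q" by blast
    then show ?case by (intro exI[of _ "max k k'"]) (metis less_max_iff_disj subst.simps(6))
  next
    case (EqS X Y)
    show ?case by (rule exI[of _ "Suc (max X Y)"]) (simp add: less_Suc_eq_le)
  next
    case (AllN p)
    then obtain k where k: "?P k p" by blast
    show ?case
    proof (intro exI allI impI)
      fix \<sigma> \<sigma>' :: "nat \<Rightarrow> tm" and \<rho> \<rho>' :: "nat \<Rightarrow> nat"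
      assume eq: "(\<forall>i<k. \<sigma> i = \<sigma>' i) \<and> (\<forall>X<k. \<rho> X = \<rho>' X)"
      \<comment> \<open>The bound for the body also serves for the quantified formula: at indices
        below k the lifted substitution reads the old one only at smaller indices.\<close>
      have "\<forall>i<k. liftN \<sigma> i = liftN \<sigma>' i" using eq by (auto split: nat.split)
      then show "subst \<sigma> \<rho> (AllN p) = subst \<sigma>' \<rho>' (AllN p)" using k eq by simp
    qed
  next
    case (AllS p)
    then obtain k where k: "?P k p" by blast
    show ?case
    proof (intro exI allI impI)
      fix \<sigma> \<sigma>' :: "nat \<Rightarrow> tm" and \<rho> \<rho>' :: "nat \<Rightarrow> nat"
      assume eq: "(\<forall>i<k. \<sigma> i = \<sigma>' i) \<and> (\<forall>X<k. \<rho> X = \<rho>' X)"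
      have "\<forall>i<k. liftS \<rho> i = liftS \<rho>' i" using eq by (auto split: nat.split)
      then show "subst \<sigma> \<rho> (AllS p) = subst \<sigma>' \<rho>' (AllS p)" using k eq by simp
    qed
  qed auto
qed

text \<open>All free variables of both sorts are among the first \<open>k\<close>.\<close>

definition fv_below :: "nat \<Rightarrow> fm \<Rightarrow> bool" where
  "fv_below k p \<longleftrightarrow>
    (\<forall>\<sigma> \<sigma>' \<rho> \<rho>'. (\<forall>i<k. \<sigma> i = \<sigma>' i) \<and> (\<forall>X<k. \<rho> X = \<rho>' X) \<longrightarrow> subst \<sigma> \<rho> p = subst \<sigma>' \<rho>' p)"

lemma fv_belowD:
  "fv_below k p \<Longrightarrow> (\<And>i. i < k \<Longrightarrow> \<sigma> i = \<sigma>' i) \<Longrightarrow> (\<And>X. X < k \<Longrightarrow> \<rho> X = \<rho>' X) \<Longrightarrow>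
    subst \<sigma> \<rho> p = subst \<sigma>' \<rho>' p"
  unfolding fv_below_def by blast

lemma fv_below_mono: "fv_below k p \<Longrightarrow> k \<le> k' \<Longrightarrow> fv_below k' p"
  unfolding fv_below_def by (meson less_le_trans)

lemma fv_below_ex: "\<exists>k. fv_below k p"
  unfolding fv_below_def by (rule subst_cong_upto)

lemma fv_below_finite: "finite \<Gamma> \<Longrightarrow> \<exists>k. \<forall>p\<in>\<Gamma>. fv_below k p"
proof (induction rule: finite_induct)
  case (insert p \<Gamma>)
  then obtain k where k: "\<forall>p\<in>\<Gamma>. fv_below k p" by blast
  obtain k' where "fv_below k' p" using fv_below_ex by blast
  then show ?case using k fv_below_mono[of _ _ "max k k'"]
    by (intro exI[of _ "max k k'"]) (auto intro: fv_below_mono)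
qed simp

lemma liftN_NV: "case_nat (NV 0) (\<lambda>i. NV (Suc i)) = NV"
  by (rule ext) (simp split: nat.split)

lemma liftS_id: "case_nat 0 Suc = (\<lambda>X. X)"
  by (rule ext) (simp split: nat.split)

lemma subst_NV: "subst NV (\<lambda>X. X) p = p"
  by (induction p) (simp_all add: subst_tm_NV liftN_NV liftS_id)


section \<open>Derivations\<close>

lemma weaken: "derivable T \<Gamma> p \<Longrightarrow> \<Gamma> \<subseteq> \<Delta> \<Longrightarrow> derivable T \<Delta> p"
proof (induction arbitrary: \<Delta> rule: derivable.induct)
  case (ImpI p \<Gamma> q)
  show ?case by (intro derivable.ImpI ImpI.IH insert_mono ImpI.prems)
next
  case (RAA p \<Gamma>)
  show ?case by (rule derivable.RAA) (intro RAA.IH insert_mono RAA.prems)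
next
  case (AllNI \<Gamma> p)
  show ?case by (intro derivable.AllNI AllNI.IH image_mono AllNI.prems)
next
  case (AllSI \<Gamma> p)
  show ?case by (intro derivable.AllSI AllSI.IH image_mono AllSI.prems)
next
  case (ImpE \<Gamma> p q)
  show ?case by (rule derivable.ImpE[OF ImpE.IH]) (rule ImpE.prems)+
next
  case (EqN_subst \<Gamma> t u p)
  show ?case by (rule derivable.EqN_subst[OF EqN_subst.IH]) (rule EqN_subst.prems)+
next
  case (EqS_subst \<Gamma> X Y p)
  show ?case by (rule derivable.EqS_subst[OF EqS_subst.IH]) (rule EqS_subst.prems)+
qed (auto intro: Ax Hyp AllNE AllSE EqN_refl EqS_refl)

text \<open>A simultaneous substitution is built from k rounds of generalising variable 0 and
  instantiating it. Derivability in every context is assumed because \<open>AllNI\<close> passes to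
  a shifted context in each round.\<close>

lemma instN_all_contexts:
  assumes "\<And>\<Gamma>. derivable T \<Gamma> p"
  shows "derivable T \<Gamma> (subst (\<lambda>i. if i < k then \<sigma> i else NV (i - k)) (\<lambda>X. X) p)"
  using assms
proof (induction k arbitrary: p \<sigma> \<Gamma>)
  case 0
  then show ?case by (simp add: subst_NV)
next
  case (Suc k)
  \<comment> \<open>The remaining k rounds lower the indices of the inserted term by k, so it is
    raised by k beforehand.\<close>
  let ?t = "subst_tm (\<lambda>i. NV (i + k)) (\<lambda>X. X) (\<sigma> 0)"
  have "derivable T \<Gamma> (instN ?t p)" for \<Gamma>
    using Suc.prems by (blast intro: AllNI AllNE)
  from Suc.IH[OF this, where \<sigma> = "\<lambda>i. \<sigma> (Suc i)"]
  have *: "derivable T \<Gamma> (subst (\<lambda>i. if i < k then \<sigma> (Suc i) else NV (i - k)) (\<lambda>X. X) (instN ?t p))" .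
  have "(\<lambda>i. subst_tm (\<lambda>i. if i < k then \<sigma> (Suc i) else NV (i - k)) (\<lambda>X. X) (case_nat ?t NV i))
      = (\<lambda>i. if i < Suc k then \<sigma> i else NV (i - Suc k))"
  proof
    fix i
    show "subst_tm (\<lambda>i. if i < k then \<sigma> (Suc i) else NV (i - k)) (\<lambda>X. X) (case_nat ?t NV i)
      = (if i < Suc k then \<sigma> i else NV (i - Suc k))"
      by (cases i) (simp_all add: subst_tm_subst_tm subst_tm_NV)
  qed
  then show ?case using * by (simp add: subst_subst)
qed

lemma instS_all_contexts:
  assumes "\<And>\<Gamma>. derivable T \<Gamma> p"
  shows "derivable T \<Gamma> (subst NV (\<lambda>i. if i < k then \<rho> i else i - k) p)"
  using assms
proof (induction k arbitrary: p \<rho> \<Gamma>)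
  case 0
  then show ?case by (simp add: subst_NV)
next
  case (Suc k)
  have "derivable T \<Gamma> (instS (\<rho> 0 + k) p)" for \<Gamma>
    using Suc.prems by (blast intro: AllSI AllSE)
  from Suc.IH[OF this, where \<rho> = "\<lambda>i. \<rho> (Suc i)"]
  have *: "derivable T \<Gamma> (subst NV (\<lambda>i. if i < k then \<rho> (Suc i) else i - k) (instS (\<rho> 0 + k) p))" .
  have "(\<lambda>i. (if case_nat (\<rho> 0 + k) (\<lambda>Y. Y) i < k then \<rho> (Suc (case_nat (\<rho> 0 + k) (\<lambda>Y. Y) i))
        else case_nat (\<rho> 0 + k) (\<lambda>Y. Y) i - k)) = (\<lambda>i. if i < Suc k then \<rho> i else i - Suc k)"
    by (rule ext) (auto split: nat.split)
  then show ?case using * by (simp add: subst_subst)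
qed

text \<open>Here the open axioms act as their universal closures, even under local hypotheses that
  share their variables.\<close>

lemma axiom_instance:
  assumes "p \<in> T"
  shows "derivable T \<Gamma> (subst \<sigma> \<rho> p)"
proof -
  obtain k where k: "fv_below k p" using fv_below_ex by blast
  \<comment> \<open>Set variables are replaced first: the terms inserted for number variables may
    contain lengths of sets, which a later renaming of set variables would change.\<close>
  let ?p = "subst NV (\<lambda>i. if i < k then \<rho> i else i - k) p"
  have "derivable T \<Gamma> ?p" for \<Gamma>
    using assms by (intro instS_all_contexts Ax)
  then have "derivable T \<Gamma> (subst (\<lambda>i. if i < k then \<sigma> i else NV (i - k)) (\<lambda>X. X) ?p)"
    by (rule instN_all_contexts)
  also have "subst (\<lambda>i. if i < k then \<sigma> i else NV (i - k)) (\<lambda>X. X) ?p = subst \<sigma> \<rho> p"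
    by (simp add: subst_subst) (rule fv_belowD[OF k], auto)
  finally show ?thesis .
qed

lemma lift_shiftN: "subst (liftN \<sigma>) \<rho> (shiftN p) = shiftN (subst \<sigma> \<rho> p)"
  by (simp add: subst_subst)

lemma lift_shiftS: "subst (\<lambda>i. shiftS_tm (\<sigma> i)) (liftS \<rho>) (shiftS p) = shiftS (subst \<sigma> \<rho> p)"
  by (simp add: subst_subst)

lemma subst_instN: "subst \<sigma> \<rho> (instN t p) = instN (subst_tm \<sigma> \<rho> t) (subst (liftN \<sigma>) \<rho> p)"
proof -
  have "(\<lambda>i. subst_tm \<sigma> \<rho> (case_nat t NV i)) =
      (\<lambda>i. subst_tm (case_nat (subst_tm \<sigma> \<rho> t) NV) (\<lambda>X. X) (liftN \<sigma> i))"
    by (rule ext) (simp add: subst_tm_subst_tm subst_tm_NV split: nat.split)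
  then show ?thesis by (simp add: subst_subst)
qed

lemma subst_instS:
  "subst \<sigma> \<rho> (instS X p) = instS (\<rho> X) (subst (\<lambda>i. shiftS_tm (\<sigma> i)) (liftS \<rho>) p)"
proof -
  have "(\<lambda>i. \<rho> (case_nat X (\<lambda>Y. Y) i)) = (\<lambda>i. case_nat (\<rho> X) (\<lambda>Y. Y) (liftS \<rho> i))"
    by (rule ext) (simp split: nat.split)
  then show ?thesis by (simp add: subst_subst subst_tm_subst_tm subst_tm_NV)
qed

text \<open>This allows a fresh variable to be renamed into a bound position. \<open>T\<close>
  itself need not be closed under substitution; the axiom case is covered by
  \<open>axiom_instance\<close>.\<close>

lemma derivable_subst:
  "derivable T \<Gamma> p \<Longrightarrow> derivable T (subst \<sigma> \<rho> ` \<Gamma>) (subst \<sigma> \<rho> p)"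
proof (induction arbitrary: \<sigma> \<rho> rule: derivable.induct)
  case (Ax p \<Gamma>)
  then show ?case by (rule axiom_instance)
next
  case (RAA p \<Gamma>)
  then show ?case by (simp add: derivable.RAA Neg_def)
next
  case (AllNI \<Gamma> p)
  have "derivable T (subst (liftN \<sigma>) \<rho> ` shiftN ` \<Gamma>) (subst (liftN \<sigma>) \<rho> p)" by (rule AllNI.IH)
  also have "subst (liftN \<sigma>) \<rho> ` shiftN ` \<Gamma> = shiftN ` subst \<sigma> \<rho> ` \<Gamma>"
    unfolding image_image lift_shiftN ..
  finally show ?case by (simp add: derivable.AllNI)
next
  case (AllSI \<Gamma> p)
  let ?\<sigma> = "\<lambda>i. shiftS_tm (\<sigma> i)"
  have "derivable T (subst ?\<sigma> (liftS \<rho>) ` shiftS ` \<Gamma>) (subst ?\<sigma> (liftS \<rho>) p)" by (rule AllSI.IH)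
  also have "subst ?\<sigma> (liftS \<rho>) ` shiftS ` \<Gamma> = shiftS ` subst \<sigma> \<rho> ` \<Gamma>"
    unfolding image_image lift_shiftS ..
  finally show ?case by (simp add: derivable.AllSI)
next
  case (AllNE \<Gamma> p t)
  then have "derivable T (subst \<sigma> \<rho> ` \<Gamma>) (AllN (subst (liftN \<sigma>) \<rho> p))" by simp
  then show ?case unfolding subst_instN by (rule derivable.AllNE)
next
  case (AllSE \<Gamma> p X)
  then have "derivable T (subst \<sigma> \<rho> ` \<Gamma>) (AllS (subst (\<lambda>i. shiftS_tm (\<sigma> i)) (liftS \<rho>) p))" by simp
  then show ?case unfolding subst_instS by (rule derivable.AllSE)
next
  case (EqN_subst \<Gamma> t u p)
  then show ?case unfolding subst_instN by (metis derivable.EqN_subst subst.simps(2))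
next
  case (EqS_subst \<Gamma> X Y p)
  then show ?case unfolding subst_instS by (metis derivable.EqS_subst subst.simps(3))
next
  case (ImpI p \<Gamma> q)
  then show ?case by (simp add: derivable.ImpI)
next
  case (ImpE \<Gamma> p q)
  then show ?case by (metis derivable.ImpE subst.simps(6))
qed (auto intro: Hyp EqN_refl EqS_refl)


section \<open>Henkin theories\<close>

instance tm :: countable by countable_datatype
instance fm :: countable by countable_datatype

abbreviation consistent :: "fm set \<Rightarrow> fm set \<Rightarrow> bool" where
  "consistent T \<Gamma> \<equiv> \<not> derivable T \<Gamma> Fls"

lemma ex_falso: "derivable T \<Gamma> Fls \<Longrightarrow> derivable T \<Gamma> p"
  by (rule RAA) (auto elim: weaken)

lemma consistent_Neg: "\<not> derivable T \<Gamma> p \<Longrightarrow> consistent T (insert (Neg p) \<Gamma>)"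
  using RAA by metis

lemma derivable_NegE: "derivable T \<Gamma> (Neg p) \<Longrightarrow> derivable T \<Gamma> p \<Longrightarrow> derivable T \<Gamma> Fls"
  unfolding Neg_def by (rule ImpE)

text \<open>The variable c lies above all free variables of the context and of q, hence is fresh.
  Sending c to 0 and raising all other indices acts on the context as \<open>shiftN\<close> and
  turns the instance at c back into q, so that \<open>AllNI\<close> applies.\<close>

lemma generalizeN:
  assumes "\<forall>p\<in>\<Gamma>. fv_below c p" "fv_below c q" "derivable T \<Gamma> (instN (NV c) q)"
  shows "derivable T \<Gamma> (AllN q)"
proof -
  let ?\<sigma> = "\<lambda>i. if i = c then NV 0 else NV (Suc i)"
  have "derivable T (subst ?\<sigma> (\<lambda>X. X) ` \<Gamma>) (subst ?\<sigma> (\<lambda>X. X) (instN (NV c) q))"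
    by (rule derivable_subst) (rule assms)
  moreover have "subst ?\<sigma> (\<lambda>X. X) ` \<Gamma> = shiftN ` \<Gamma>"
    using assms(1) by (intro image_cong refl) (rule fv_belowD[of c], auto)
  moreover have "subst ?\<sigma> (\<lambda>X. X) (instN (NV c) q) = subst NV (\<lambda>X. X) q"
    unfolding subst_subst by (rule fv_belowD[OF assms(2)]) (auto split: nat.split)
  ultimately show ?thesis by (simp add: subst_NV AllNI)
qed

lemma generalizeS:
  assumes "\<forall>p\<in>\<Gamma>. fv_below c p" "fv_below c q" "derivable T \<Gamma> (instS c q)"
  shows "derivable T \<Gamma> (AllS q)"
proof -
  let ?\<rho> = "\<lambda>i. if i = c then 0 else Suc i"
  have "derivable T (subst NV ?\<rho> ` \<Gamma>) (subst NV ?\<rho> (instS c q))"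
    by (rule derivable_subst) (rule assms)
  moreover have "subst NV ?\<rho> ` \<Gamma> = shiftS ` \<Gamma>"
    using assms(1) by (intro image_cong refl) (rule fv_belowD[of c], auto)
  moreover have "subst NV ?\<rho> (instS c q) = subst NV (\<lambda>X. X) q"
    unfolding subst_subst by (rule fv_belowD[OF assms(2)]) (auto split: nat.split)
  ultimately show ?thesis by (simp add: subst_NV AllSI)
qed

text \<open>Completeness and the Henkin property are combined: a refuted universal formula must have
  a refuted instance. A single enumeration of formulas then achieves both.\<close>

definition decides :: "fm set \<Rightarrow> fm set \<Rightarrow> fm \<Rightarrow> bool" where
  "decides T \<Gamma> p \<longleftrightarrow> derivable T \<Gamma> p \<or>
    derivable T \<Gamma> (Neg p) \<and>
    (\<forall>q. p = AllN q \<longrightarrow> (\<exists>t. derivable T \<Gamma> (Neg (instN t q)))) \<and>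
    (\<forall>q. p = AllS q \<longrightarrow> (\<exists>X. derivable T \<Gamma> (Neg (instS X q))))"

lemma decides_extension:
  assumes "finite \<Gamma>" "consistent T \<Gamma>"
  shows "\<exists>\<Delta>. \<Gamma> \<subseteq> \<Delta> \<and> finite \<Delta> \<and> consistent T \<Delta> \<and> decides T \<Delta> p"
proof (cases "derivable T \<Gamma> p")
  case True
  with assms show ?thesis unfolding decides_def by blast
next
  case False
  have neg: "derivable T (insert (Neg q) \<Gamma>) (Neg q)" for q by (simp add: Hyp)
  show ?thesis
  proof (cases "(\<exists>q. p = AllN q) \<or> (\<exists>q. p = AllS q)")
    case False
    have "consistent T (insert (Neg p) \<Gamma>)"
      using \<open>\<not> derivable T \<Gamma> p\<close> by (rule consistent_Neg)
    then show ?thesis using assms neg False unfolding decides_def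
      by (intro exI[of _ "insert (Neg p) \<Gamma>"]) auto
  next
    case True
    then show ?thesis
    proof (elim disjE exE)
      fix q assume p: "p = AllN q"
      obtain c where c: "\<forall>p\<in>insert q \<Gamma>. fv_below c p"
        using fv_below_finite[of "insert q \<Gamma>"] assms by auto
      \<comment> \<open>Only the negated instance at a fresh variable is added. It refutes p and
        supplies the witness at once, and it is consistent because otherwise p would be derivable by
        generalisation.\<close>
      let ?q = "instN (NV c) q"
      have cons: "consistent T (insert (Neg ?q) \<Gamma>)"
        using consistent_Neg generalizeN[of \<Gamma> c q T] c \<open>\<not> derivable T \<Gamma> p\<close> unfolding p by blast
      have "derivable T (insert p (insert (Neg ?q) \<Gamma>)) Fls"
        by (rule derivable_NegE[of _ _ ?q]) (auto simp: p intro: Hyp AllNE)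
      then have "derivable T (insert (Neg ?q) \<Gamma>) (Neg p)"
        unfolding Neg_def by (rule ImpI)
      then show ?thesis using cons assms neg unfolding decides_def
        by (intro exI[of _ "insert (Neg ?q) \<Gamma>"]) (auto simp: p)
    next
      fix q assume p: "p = AllS q"
      obtain c where c: "\<forall>p\<in>insert q \<Gamma>. fv_below c p"
        using fv_below_finite[of "insert q \<Gamma>"] assms by auto
      let ?q = "instS c q"
      have cons: "consistent T (insert (Neg ?q) \<Gamma>)"
        using consistent_Neg generalizeS[of \<Gamma> c q T] c \<open>\<not> derivable T \<Gamma> p\<close> unfolding p by blast
      have "derivable T (insert p (insert (Neg ?q) \<Gamma>)) Fls"
        by (rule derivable_NegE[of _ _ ?q]) (auto simp: p intro: Hyp AllSE)
      then have "derivable T (insert (Neg ?q) \<Gamma>) (Neg p)"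
        unfolding Neg_def by (rule ImpI)
      then show ?thesis using cons assms neg unfolding decides_def
        by (intro exI[of _ "insert (Neg ?q) \<Gamma>"]) (auto simp: p)
    qed
  qed
qed

text \<open>The closure properties that the truth lemma for the term model needs, detached from
  derivability. Taking q to be \<open>Fls\<close>, the first two give consistency and
  completeness.\<close>

locale henkin =
  fixes Th :: "fm set"
  assumes Fls_notin: "Fls \<notin> Th"
    and Imp_iff: "Imp p q \<in> Th \<longleftrightarrow> (p \<in> Th \<longrightarrow> q \<in> Th)"
    and AllN_iff: "AllN p \<in> Th \<longleftrightarrow> (\<forall>t. instN t p \<in> Th)"
    and AllS_iff: "AllS p \<in> Th \<longleftrightarrow> (\<forall>X. instS X p \<in> Th)"
    and EqN_refl: "EqN t t \<in> Th"
    and EqN_subst: "EqN t u \<in> Th \<Longrightarrow> instN t p \<in> Th \<Longrightarrow> instN u p \<in> Th"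
    and EqS_refl: "EqS X X \<in> Th"
    and EqS_subst: "EqS X Y \<in> Th \<Longrightarrow> instS X p \<in> Th \<Longrightarrow> instS Y p \<in> Th"

lemma henkin_extension:
  assumes "\<not> T \<turnstile> p"
  obtains Th where "henkin Th" "p \<notin> Th" "\<And>q \<sigma> \<rho>. q \<in> T \<Longrightarrow> subst \<sigma> \<rho> q \<in> Th"
proof -
  \<comment> \<open>All stages are finite, so that a fresh variable is available at each of
    them.\<close>
  define P where "P \<Gamma> \<longleftrightarrow> finite \<Gamma> \<and> consistent T \<Gamma> \<and> Neg p \<in> \<Gamma>" for \<Gamma>
  have "\<exists>G. \<forall>k::nat. P (G k) \<and> (G k \<subseteq> G (Suc k) \<and> decides T (G (Suc k)) (from_nat k))"
  proof (rule dependent_nat_choice)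
    show "\<exists>\<Gamma>. P \<Gamma>"
      using assms consistent_Neg[of T "{}" p] unfolding P_def proves_def by (intro exI[of _ "{Neg p}"]) auto
  next
    fix \<Gamma> k assume "P \<Gamma>"
    then show "\<exists>\<Delta>. P \<Delta> \<and> \<Gamma> \<subseteq> \<Delta> \<and> decides T \<Delta> (from_nat k)"
      using decides_extension[of \<Gamma> T "from_nat k"] unfolding P_def by blast
  qed
  then obtain G where G: "P (G k)" "G k \<subseteq> G (Suc k)" "decides T (G (Suc k)) (from_nat k)" for k
    by blast
  have mono: "G i \<subseteq> G j" if "i \<le> j" for i j
    using that G(2) by (rule lift_Suc_mono_le[rotated])
  define Th where "Th = {q. \<exists>k. derivable T (G k) q}"
  have Th1: "q \<in> Th" if "\<And>k. derivable T (G k) q' \<Longrightarrow> derivable T (G k) q" "q' \<in> Th" for q q'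
    using that unfolding Th_def by blast
  \<comment> \<open>Premises derived at two different stages are both available at the later
    one.\<close>
  have Th2: "q \<in> Th"
    if "\<And>k. derivable T (G k) q' \<Longrightarrow> derivable T (G k) q'' \<Longrightarrow> derivable T (G k) q"
      "q' \<in> Th" "q'' \<in> Th" for q q' q''
  proof -
    from that obtain i j where "derivable T (G i) q'" "derivable T (G j) q''"
      unfolding Th_def by blast
    then have "derivable T (G (max i j)) q'" "derivable T (G (max i j)) q''"
      using weaken mono by (meson max.cobounded1 max.cobounded2)+
    then show ?thesis using that(1) unfolding Th_def by blast
  qed
  have Fls: "Fls \<notin> Th" using G(1) unfolding Th_def P_def by blast
  have cons: "\<not> (q \<in> Th \<and> Neg q \<in> Th)" for q
    using Th2[of "Neg q" q Fls] derivable_NegE Fls by blast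
  \<comment> \<open>Stage k settles the k-th formula, so every formula is settled immediately after
    the stage of its own number.\<close>
  have decide: "decides T (G (Suc (to_nat q))) q" for q
    using G(3)[of "to_nat q"] by simp
  have compl: "q \<in> Th \<or> Neg q \<in> Th" for q
    using decide[of q] unfolding decides_def Th_def by blast
  have "henkin Th"
  proof
    show "Fls \<notin> Th" by (rule Fls)
  next
    fix p q
    have "Imp p q \<in> Th" if "q \<in> Th"
      by (rule Th1[OF _ that]) (blast intro: ImpI weaken)
    moreover have "Imp p q \<in> Th" if "Neg p \<in> Th"
      by (rule Th1[OF _ that])
        (metis (no_types) Hyp ImpI derivable_NegE ex_falso insertI1 subset_insertI weaken)
    ultimately show "Imp p q \<in> Th \<longleftrightarrow> (p \<in> Th \<longrightarrow> q \<in> Th)"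
      using compl[of p] Th2[of "Imp p q" p q] ImpE by blast
  next
    fix q
    have "\<exists>t. instN t q \<notin> Th" if "AllN q \<notin> Th"
      using decide[of "AllN q"] that cons unfolding decides_def Th_def by blast
    then show "AllN q \<in> Th \<longleftrightarrow> (\<forall>t. instN t q \<in> Th)"
      using Th1 AllNE by blast
  next
    fix q
    have "\<exists>X. instS X q \<notin> Th" if "AllS q \<notin> Th"
      using decide[of "AllS q"] that cons unfolding decides_def Th_def by blast
    then show "AllS q \<in> Th \<longleftrightarrow> (\<forall>X. instS X q \<in> Th)"
      using Th1 AllSE by blast
  next
    fix t show "EqN t t \<in> Th" unfolding Th_def by (blast intro: derivable.EqN_refl)
  next
    fix X show "EqS X X \<in> Th" unfolding Th_def by (blast intro: derivable.EqS_refl)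
  next
    fix t u q assume "EqN t u \<in> Th" "instN t q \<in> Th"
    then show "instN u q \<in> Th" by (rule Th2[rotated]) (rule derivable.EqN_subst)
  next
    fix X Y q assume "EqS X Y \<in> Th" "instS X q \<in> Th"
    then show "instS Y q \<in> Th" by (rule Th2[rotated]) (rule derivable.EqS_subst)
  qed
  moreover have "Neg p \<in> Th" using G(1)[of 0] unfolding Th_def P_def by (blast intro: Hyp)
  then have "p \<notin> Th" using cons by blast
  moreover have "subst \<sigma> \<rho> q \<in> Th" if "q \<in> T" for q \<sigma> \<rho>
    using axiom_instance[OF that] unfolding Th_def by blast
  ultimately show ?thesis using that by blast
qed


section \<open>Structures and term models\<close>

text \<open>Number equality is interpreted by HOL equality, so that algebraic facts can be used as
  they are. Set equality is an arbitrary relation, which spares a quotient of the sets in the term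
  model.\<close>

locale two_sorted =
  fixes zer :: 'a ("\<zero>")
    and uno :: 'a ("\<one>")
    and pls :: "'a \<Rightarrow> 'a \<Rightarrow> 'a" (infixl "\<oplus>" 65)
    and tms :: "'a \<Rightarrow> 'a \<Rightarrow> 'a" (infixl "\<otimes>" 70)
    and leq :: "'a \<Rightarrow> 'a \<Rightarrow> bool" (infix "\<preceq>" 50)
    and siz :: "'b \<Rightarrow> 'a"
    and elt :: "'a \<Rightarrow> 'b \<Rightarrow> bool" (infix "\<epsilon>" 50)
    and eqv :: "'b \<Rightarrow> 'b \<Rightarrow> bool" (infix "\<simeq>" 50)
begin

primrec tval :: "(nat \<Rightarrow> 'a) \<Rightarrow> (nat \<Rightarrow> 'b) \<Rightarrow> tm \<Rightarrow> 'a" where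
  "tval e s (NV i) = e i"
| "tval e s Zero = \<zero>"
| "tval e s One = \<one>"
| "tval e s (Add t u) = tval e s t \<oplus> tval e s u"
| "tval e s (Mul t u) = tval e s t \<otimes> tval e s u"
| "tval e s (Len X) = siz (s X)"

primrec sat :: "(nat \<Rightarrow> 'a) \<Rightarrow> (nat \<Rightarrow> 'b) \<Rightarrow> fm \<Rightarrow> bool" where
  "sat e s Fls \<longleftrightarrow> False"
| "sat e s (EqN t u) \<longleftrightarrow> tval e s t = tval e s u"
| "sat e s (EqS X Y) \<longleftrightarrow> s X \<simeq> s Y"
| "sat e s (Le t u) \<longleftrightarrow> tval e s t \<preceq> tval e s u"
| "sat e s (Mem t X) \<longleftrightarrow> tval e s t \<epsilon> s X"
| "sat e s (Imp p q) \<longleftrightarrow> (sat e s p \<longrightarrow> sat e s q)"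
| "sat e s (AllN p) \<longleftrightarrow> (\<forall>v. sat (case_nat v e) s p)"
| "sat e s (AllS p) \<longleftrightarrow> (\<forall>S. sat e (case_nat S s) p)"

lemma tval_subst: "tval e s (subst_tm \<sigma> \<rho> t) = tval (\<lambda>i. tval e s (\<sigma> i)) (\<lambda>X. s (\<rho> X)) t"
  by (induction t) auto

lemma sat_subst: "sat e s (subst \<sigma> \<rho> p) \<longleftrightarrow> sat (\<lambda>i. tval e s (\<sigma> i)) (\<lambda>X. s (\<rho> X)) p"
proof (induction p arbitrary: e s \<sigma> \<rho>)
  case (AllN p)
  have "(\<lambda>i. tval (case_nat v e) s (liftN \<sigma> i)) = case_nat v (\<lambda>i. tval e s (\<sigma> i))" for v
    by (rule ext) (simp add: tval_subst split: nat.split)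
  then show ?case by (simp add: AllN)
next
  case (AllS p)
  have "(\<lambda>X. case_nat S s (liftS \<rho> X)) = case_nat S (\<lambda>X. s (\<rho> X))" for S
    by (rule ext) (simp split: nat.split)
  then show ?case by (simp add: AllS tval_subst)
qed (auto simp: tval_subst)

lemma sat_connectives [simp]:
  "sat e s (Neg p) \<longleftrightarrow> \<not> sat e s p"
  "sat e s (Disj p q) \<longleftrightarrow> sat e s p \<or> sat e s q"
  "sat e s (Conj p q) \<longleftrightarrow> sat e s p \<and> sat e s q"
  "sat e s (Iff p q) \<longleftrightarrow> (sat e s p \<longleftrightarrow> sat e s q)"
  "sat e s (ExN p) \<longleftrightarrow> (\<exists>v. sat (case_nat v e) s p)"
  "sat e s (ExS p) \<longleftrightarrow> (\<exists>S. sat e (case_nat S s) p)"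
  "sat e s (Lt t u) \<longleftrightarrow> tval e s t \<preceq> tval e s u \<and> tval e s t \<noteq> tval e s u"
  by (auto simp: Neg_def Disj_def Conj_def Iff_def ExN_def ExS_def Lt_def)

end

context henkin
begin

definition cls :: "tm \<Rightarrow> tm set" where "cls t = {u. EqN t u \<in> Th}"

text \<open>In this and the following congruences, variable 0 marks the place to be rewritten, and
  shifting protects the other terms from the instantiation.\<close>

lemma EqN_sym: "EqN t u \<in> Th \<Longrightarrow> EqN u t \<in> Th"
  using EqN_subst[of t u "EqN (NV 0) (shiftN_tm t)"]
  by (simp add: subst_tm_subst_tm subst_tm_NV EqN_refl)

lemma EqN_trans: "EqN t u \<in> Th \<Longrightarrow> EqN u v \<in> Th \<Longrightarrow> EqN t v \<in> Th"
  using EqN_subst[of u v "EqN (shiftN_tm t) (NV 0)"]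
  by (simp add: subst_tm_subst_tm subst_tm_NV)

lemma cls_eq: "cls t = cls u \<longleftrightarrow> EqN t u \<in> Th"
  unfolding cls_def using EqN_refl EqN_sym EqN_trans by blast

lemma EqN_Add:
  assumes "EqN t t' \<in> Th" "EqN u u' \<in> Th"
  shows "EqN (Add t u) (Add t' u') \<in> Th"
proof -
  have "EqN (Add t u) (Add t' u) \<in> Th"
    using EqN_subst[OF assms(1), of "EqN (shiftN_tm (Add t u)) (Add (NV 0) (shiftN_tm u))"]
    by (simp add: subst_tm_subst_tm subst_tm_NV EqN_refl)
  moreover have "EqN (Add t' u) (Add t' u') \<in> Th"
    using EqN_subst[OF assms(2), of "EqN (shiftN_tm (Add t' u)) (Add (shiftN_tm t') (NV 0))"]
    by (simp add: subst_tm_subst_tm subst_tm_NV EqN_refl)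
  ultimately show ?thesis by (rule EqN_trans)
qed

lemma EqN_Mul:
  assumes "EqN t t' \<in> Th" "EqN u u' \<in> Th"
  shows "EqN (Mul t u) (Mul t' u') \<in> Th"
proof -
  have "EqN (Mul t u) (Mul t' u) \<in> Th"
    using EqN_subst[OF assms(1), of "EqN (shiftN_tm (Mul t u)) (Mul (NV 0) (shiftN_tm u))"]
    by (simp add: subst_tm_subst_tm subst_tm_NV EqN_refl)
  moreover have "EqN (Mul t' u) (Mul t' u') \<in> Th"
    using EqN_subst[OF assms(2), of "EqN (shiftN_tm (Mul t' u)) (Mul (shiftN_tm t') (NV 0))"]
    by (simp add: subst_tm_subst_tm subst_tm_NV EqN_refl)
  ultimately show ?thesis by (rule EqN_trans)
qed

lemma Le_cong:
  assumes "EqN t t' \<in> Th" "EqN u u' \<in> Th" "Le t u \<in> Th"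
  shows "Le t' u' \<in> Th"
proof -
  have "Le t' u \<in> Th"
    using EqN_subst[OF assms(1), of "Le (NV 0) (shiftN_tm u)"] assms(3)
    by (simp add: subst_tm_subst_tm subst_tm_NV)
  then show ?thesis
    using EqN_subst[OF assms(2), of "Le (shiftN_tm t') (NV 0)"]
    by (simp add: subst_tm_subst_tm subst_tm_NV)
qed

lemma Mem_cong: "EqN t t' \<in> Th \<Longrightarrow> Mem t X \<in> Th \<Longrightarrow> Mem t' X \<in> Th"
  using EqN_subst[of t t' "Mem (NV 0) X"] by simp

lemma Mem_EqS: "EqS X Y \<in> Th \<Longrightarrow> Mem t X \<in> Th \<Longrightarrow> Mem t Y \<in> Th"
  using EqS_subst[of X Y "Mem (shiftS_tm t) 0"] by (simp add: subst_tm_subst_tm subst_tm_NV)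

text \<open>
  Infinitely many classes of terms are needed only to let all of \<open>nat\<close> be the domain of numbers.
\<close>

lemma term_model:
  assumes "infinite (range cls)"
  obtains zer uno :: nat and pls tms leq siz and elt :: "nat \<Rightarrow> nat \<Rightarrow> bool" and eqv
  where "\<And>p. (\<And>\<sigma> \<rho>. subst \<sigma> \<rho> p \<in> Th) \<Longrightarrow>
      (\<And>e s. two_sorted.sat zer uno pls tms leq siz elt eqv e s p)"
    and "\<And>p. p \<notin> Th \<Longrightarrow> \<exists>e s. \<not> two_sorted.sat zer uno pls tms leq siz elt eqv e s p"
    and "\<And>X Y z. eqv X Y \<Longrightarrow> elt z X \<Longrightarrow> elt z Y"
proof -
  have bij: "bij_betw (to_nat_on (range cls)) (range cls) UNIV"
    using assms by (intro to_nat_on_infinite) auto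
  define f where "f t = to_nat_on (range cls) (cls t)" for t
  have f_eq: "f t = f u \<longleftrightarrow> EqN t u \<in> Th" for t u
    using bij unfolding f_def cls_eq[symmetric] by (auto simp: bij_betw_def inj_on_eq_iff)
  have "surj f"
    using bij unfolding f_def bij_betw_def by (metis image_image)
  \<comment> \<open>\<open>f\<close> numbers the classes of terms and \<open>g\<close> picks a
    representative of each; the operations on numbers are computed on representatives.\<close>
  define g where "g = inv f"
  have f_g: "f (g x) = x" for x
    unfolding g_def by (rule surj_f_inv_f) fact
  have g_f: "EqN (g (f t)) t \<in> Th" for t
    unfolding f_eq[symmetric] by (rule f_g)
  define zer where "zer = f Zero"
  define uno where "uno = f One"
  define pls where "pls x y = f (Add (g x) (g y))" for x y
  define tms where "tms x y = f (Mul (g x) (g y))" for x y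
  define leq where "leq x y \<longleftrightarrow> Le (g x) (g y) \<in> Th" for x y
  define siz where "siz X = f (Len X)" for X
  define elt where "elt x X \<longleftrightarrow> Mem (g x) X \<in> Th" for x X
  define eqv where "eqv X Y \<longleftrightarrow> EqS X Y \<in> Th" for X Y
  have pls_f: "pls (f t) (f u) = f (Add t u)" for t u
    unfolding pls_def f_eq by (intro EqN_Add g_f)
  have tms_f: "tms (f t) (f u) = f (Mul t u)" for t u
    unfolding tms_def f_eq by (intro EqN_Mul g_f)
  have leq_f: "leq (f t) (f u) \<longleftrightarrow> Le t u \<in> Th" for t u
    unfolding leq_def by (blast intro: Le_cong g_f EqN_sym[OF g_f])
  have elt_f: "elt (f t) X \<longleftrightarrow> Mem t X \<in> Th" for t X
    unfolding elt_def by (blast intro: Mem_cong g_f EqN_sym[OF g_f])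
  interpret two_sorted zer uno pls tms leq siz elt eqv .
  have tval: "tval (\<lambda>i. f (\<sigma> i)) \<rho> t = f (subst_tm \<sigma> \<rho> t)" for \<sigma> \<rho> t
    by (induction t)
      (simp_all add: zer_def[symmetric] uno_def[symmetric] pls_f tms_f siz_def[symmetric])
  \<comment> \<open>The truth lemma: numbers are evaluated to classes of terms, while set variables
    are their own values. Surjectivity of \<open>f\<close> turns a number quantifier into one over
    terms.\<close>
  have truth: "sat (\<lambda>i. f (\<sigma> i)) \<rho> p \<longleftrightarrow> subst \<sigma> \<rho> p \<in> Th" for \<sigma> \<rho> p
  proof (induction p arbitrary: \<sigma> \<rho>)
    case (AllN p)
    have "sat (\<lambda>i. f (\<sigma> i)) \<rho> (AllN p) \<longleftrightarrow> (\<forall>t. sat (case_nat (f t) (\<lambda>i. f (\<sigma> i))) \<rho> p)"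
      by simp (metis f_g)
    also have "\<dots> \<longleftrightarrow> (\<forall>t. subst (case_nat t \<sigma>) \<rho> p \<in> Th)"
    proof -
      have "case_nat (f t) (\<lambda>i. f (\<sigma> i)) = (\<lambda>i. f (case_nat t \<sigma> i))" for t
        by (rule ext) (simp split: nat.split)
      then show ?thesis by (simp add: AllN.IH)
    qed
    also have "\<dots> \<longleftrightarrow> (\<forall>t. instN t (subst (liftN \<sigma>) \<rho> p) \<in> Th)"
    proof -
      have "(\<lambda>i. subst_tm (case_nat t NV) (\<lambda>X. X) (liftN \<sigma> i)) = case_nat t \<sigma>" for t
        by (rule ext) (simp add: subst_tm_subst_tm subst_tm_NV split: nat.split)
      then show ?thesis by (simp add: subst_subst)
    qed
    finally show ?case using AllN_iff by simp
  next
    case (AllS p)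
    have "(\<lambda>X. case_nat Y (\<lambda>Y. Y) (liftS \<rho> X)) = case_nat Y \<rho>" for Y
      by (rule ext) (simp split: nat.split)
    then show ?case
      using AllS_iff[of "subst (\<lambda>i. shiftS_tm (\<sigma> i)) (liftS \<rho>) p"]
      by (simp add: AllS.IH subst_subst subst_tm_subst_tm subst_tm_NV)
  qed (simp_all add: tval f_eq leq_f elt_f Fls_notin Imp_iff eqv_def[symmetric])
  show ?thesis
  proof (rule that)
    fix p e s
    assume "\<And>\<sigma> \<rho>. subst \<sigma> \<rho> p \<in> Th"
    then have "sat (\<lambda>i. f (g (e i))) s p" unfolding truth by blast
    then show "sat e s p" by (simp add: f_g)
  next
    fix p assume "p \<notin> Th"
    then have "\<not> sat (\<lambda>i. f (NV i)) (\<lambda>X. X) p" unfolding truth by (simp add: subst_NV)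
    then show "\<exists>e s. \<not> sat e s p" by blast
  next
    fix X Y z assume "eqv X Y" "elt z X"
    then show "elt z Y" unfolding eqv_def elt_def by (rule Mem_EqS)
  qed
qed

end

text \<open>As \<open>eqv\<close> is an arbitrary relation, \<open>eqv_elt\<close> does not follow
  from the axioms; it is what makes sets with different elements unequal. The term model owes it to
  the replacement rule for set equality.\<close>

locale v0_model = two_sorted +
  assumes V0: "p \<in> V0 \<Longrightarrow> sat e s p"
    and eqv_elt: "X \<simeq> Y \<Longrightarrow> z \<epsilon> X \<Longrightarrow> z \<epsilon> Y"

lemma V0_countermodel:
  assumes "\<not> V0 \<turnstile> p"
  obtains zer uno :: nat and pls tms leq siz and elt :: "nat \<Rightarrow> nat \<Rightarrow> bool" and eqv e s
  where "v0_model zer uno pls tms leq siz elt eqv"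
    and "\<not> two_sorted.sat zer uno pls tms leq siz elt eqv e s p"
proof -
  obtain Th where Th: "henkin Th" "p \<notin> Th" "\<And>q \<sigma> \<rho>. q \<in> V0 \<Longrightarrow> subst \<sigma> \<rho> q \<in> Th"
    using henkin_extension[OF assms] by blast
  interpret henkin Th by fact
  have "subst (case_nat t (case_nat u NV)) (\<lambda>X. X)
      (Imp (EqN (Add (NV 0) One) (Add (NV 1) One)) (EqN (NV 0) (NV 1))) \<in> Th" for t u
    by (rule Th) (simp add: V0_def BASIC2_def Let_def)
  then have inj: "EqN (Add t One) (Add u One) \<in> Th \<Longrightarrow> EqN t u \<in> Th" for t u
    by (simp add: Imp_iff)
  have "subst (case_nat t NV) (\<lambda>X. X) (Neg (EqN (Add (NV 0) One) Zero)) \<in> Th" for t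
    by (rule Th) (simp add: V0_def BASIC2_def Let_def)
  then have nz: "EqN (Add t One) Zero \<notin> Th" for t
    by (simp add: Neg_def Imp_iff Fls_notin)
  \<comment> \<open>On a finite set of classes the injective successor map would be onto, but zero
    is not a successor.\<close>
  have inf: "infinite (range cls)"
  proof
    assume fin: "finite (range cls)"
    \<comment> \<open>The chosen representative does not matter, because addition respects provable
      equality.\<close>
    define f where "f c = cls (Add (SOME t. cls t = c) One)" for c
    have f: "f (cls t) = cls (Add t One)" for t
      unfolding f_def using someI[of "\<lambda>u. cls u = cls t" t]
      by (simp add: cls_eq EqN_Add EqN_refl)
    have "inj_on f (range cls)"
      by (rule inj_onI, elim imageE) (simp add: f cls_eq inj)
    moreover have "f ` range cls \<subseteq> range cls" by (auto simp: f)
    ultimately have "f ` range cls = range cls"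
      using fin by (simp add: endo_inj_surj)
    then obtain t where "cls Zero = f (cls t)" by (metis imageE rangeI)
    then show False using nz[of t] by (simp add: f cls_eq EqN_sym)
  qed
  show ?thesis
  proof (rule term_model[OF inf])
    fix zer uno :: nat and pls tms leq siz and elt :: "nat \<Rightarrow> nat \<Rightarrow> bool" and eqv
    assume sat: "\<And>p e s. (\<And>\<sigma> \<rho>. subst \<sigma> \<rho> p \<in> Th) \<Longrightarrow>
        two_sorted.sat zer uno pls tms leq siz elt eqv e s p"
      and not_sat: "\<And>p. p \<notin> Th \<Longrightarrow> \<exists>e s. \<not> two_sorted.sat zer uno pls tms leq siz elt eqv e s p"
      and cong: "\<And>X Y z. eqv X Y \<Longrightarrow> elt z X \<Longrightarrow> elt z Y"
    have "v0_model zer uno pls tms leq siz elt eqv"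
      by (rule v0_model.intro) (use sat Th cong in blast)+
    moreover obtain e s where "\<not> two_sorted.sat zer uno pls tms leq siz elt eqv e s p"
      using not_sat[OF Th(2)] by blast
    ultimately show ?thesis by (rule that)
  qed
qed


section \<open>Evaluation of expressions with named binders\<close>

text \<open>
  A world \<open>(k, e, l, s)\<close> consists of numbers of enclosing quantifiers and of environments for the
  de Bruijn indices. An expression denotes a value at a world if it evaluates to it under
  all further quantifiers. The shift equation in \<open>denN\<close> makes bounded quantifiers over the
  expression literally of the form required by \<open>SigmaB0\<close>.
\<close>

type_synonym ('a, 'b) world = "nat \<times> (nat \<Rightarrow> 'a) \<times> nat \<times> (nat \<Rightarrow> 'b)"

fun extends :: "('a, 'b) world \<Rightarrow> ('a, 'b) world \<Rightarrow> bool" (infix "\<lesssim>" 50) where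
  "(k, e, l, s) \<lesssim> (k', e', l', s') \<longleftrightarrow>
    k \<le> k' \<and> l \<le> l' \<and> (\<forall>i. e' (i + (k' - k)) = e i) \<and> (\<forall>i. s' (i + (l' - l)) = s i)"

lemma extends_refl: "w \<lesssim> w"
  by (cases w) simp

lemma extends_trans: "w \<lesssim> w' \<Longrightarrow> w' \<lesssim> w'' \<Longrightarrow> w \<lesssim> w''"
proof (cases w; cases w'; cases w'')
  fix k e l s k' e' l' s' k'' e'' l'' s''
  assume w: "w = (k, e, l, s)" "w' = (k', e', l', s')" "w'' = (k'', e'', l'', s'')"
    and ext: "w \<lesssim> w'" "w' \<lesssim> w''"
  have "e'' (i + (k'' - k)) = e i" for i
  proof -
    have "i + (k'' - k) = i + (k' - k) + (k'' - k')" using ext w by simp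
    then show ?thesis using ext unfolding w extends.simps by metis
  qed
  moreover have "s'' (i + (l'' - l)) = s i" for i
  proof -
    have "i + (l'' - l) = i + (l' - l) + (l'' - l')" using ext w by simp
    then show ?thesis using ext unfolding w extends.simps by metis
  qed
  ultimately show "w \<lesssim> w''" using ext w by simp
qed

lemma SigmaB0_connectives:
  "SigmaB0 p \<Longrightarrow> SigmaB0 (Neg p)"
  "SigmaB0 p \<Longrightarrow> SigmaB0 q \<Longrightarrow> SigmaB0 (Conj p q)"
  "SigmaB0 p \<Longrightarrow> SigmaB0 q \<Longrightarrow> SigmaB0 (Disj p q)"
  "SigmaB0 p \<Longrightarrow> SigmaB0 q \<Longrightarrow> SigmaB0 (Imp p q)"
  "SigmaB0 p \<Longrightarrow> SigmaB0 q \<Longrightarrow> SigmaB0 (Iff p q)"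
  unfolding Neg_def Conj_def Disj_def Iff_def by (intro SigmaB0.intros; assumption)+

lemma extends_num: "(k, e, l, s) \<lesssim> (Suc k, case_nat v e, l, s)"
  by simp

lemma extends_set: "(k, e, l, s) \<lesssim> (k, e, Suc l, case_nat S s)"
  by simp

context two_sorted
begin

definition denN :: "('a, 'b) world \<Rightarrow> nexp \<Rightarrow> 'a \<Rightarrow> bool" where
  "denN w x v \<longleftrightarrow> (\<forall>k e l s. w \<lesssim> (k, e, l, s) \<longrightarrow>
    tval e s (x k l) = v \<and> x (Suc k) l = shiftN_tm (x k l))"

text \<open>Indifference to further number quantifiers is what gives \<open>len X\<close> the shift
  equation of \<open>denN\<close>.\<close>

definition denS :: "('a, 'b) world \<Rightarrow> sexp \<Rightarrow> 'b \<Rightarrow> bool" where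
  "denS w X S \<longleftrightarrow> (\<forall>k e l s. w \<lesssim> (k, e, l, s) \<longrightarrow> s (X k l) = S \<and> X (Suc k) l = X k l)"

text \<open>Boundedness and truth value are kept together, so that evaluating a formula also
  certifies it for comprehension.\<close>

definition denF :: "('a, 'b) world \<Rightarrow> form \<Rightarrow> bool \<Rightarrow> bool" where
  "denF w P b \<longleftrightarrow> (\<forall>k e l s. w \<lesssim> (k, e, l, s) \<longrightarrow> SigmaB0 (P k l) \<and> (sat e s (P k l) \<longleftrightarrow> b))"

lemma denN_mono: "denN w x v \<Longrightarrow> w \<lesssim> w' \<Longrightarrow> denN w' x v"
  unfolding denN_def using extends_trans by blast

lemma denS_mono: "denS w X S \<Longrightarrow> w \<lesssim> w' \<Longrightarrow> denS w' X S"
  unfolding denS_def using extends_trans by blast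

lemma denF_mono: "denF w P b \<Longrightarrow> w \<lesssim> w' \<Longrightarrow> denF w' P b"
  unfolding denF_def using extends_trans by blast

lemma denN_var: "denN (Suc k, case_nat v e, l, s) (\<lambda>k' l'. NV (k' - Suc k)) v"
  unfolding denN_def by (auto simp: Suc_diff_le) (metis add_0 old.nat.simps(4))

lemma denS_var: "denS (k, e, Suc l, case_nat S s) (\<lambda>k' l'. l' - Suc l) S"
  unfolding denS_def by auto (metis add_0 old.nat.simps(4))

lemma ex_denN: "\<exists>w' x. w \<lesssim> w' \<and> denN w' x v"
  by (cases w) (metis denN_var extends_num)

lemma ex_denS: "\<exists>w' X. w \<lesssim> w' \<and> denS w' X S"
  by (cases w) (metis denS_var extends_set)

lemma den_zero: "denN w \<^bold>0 \<zero>"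
  unfolding denN_def zero_def by simp

lemma den_one: "denN w \<^bold>1 \<one>"
  unfolding denN_def one_def by simp

lemma den_add: "denN w x a \<Longrightarrow> denN w y b \<Longrightarrow> denN w (x \<^bold>+ y) (a \<oplus> b)"
  unfolding denN_def add_def by simp

lemma den_mul: "denN w x a \<Longrightarrow> denN w y b \<Longrightarrow> denN w (x \<^bold>* y) (a \<otimes> b)"
  unfolding denN_def mul_def by simp

lemma den_len: "denS w X A \<Longrightarrow> denN w (len X) (siz A)"
  unfolding denN_def denS_def len_def by simp

lemma den_eqn: "denN w x a \<Longrightarrow> denN w y b \<Longrightarrow> denF w (x \<^bold>= y) (a = b)"
  unfolding denN_def denF_def eqn_def by (simp add: SigmaB0.intros)

lemma den_le: "denN w x a \<Longrightarrow> denN w y b \<Longrightarrow> denF w (x \<^bold>\<le> y) (a \<preceq> b)"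
  unfolding denN_def denF_def le_def by (simp add: SigmaB0.intros)

lemma den_mem: "denN w x a \<Longrightarrow> denS w X A \<Longrightarrow> denF w (x \<^bold>\<in> X) (a \<epsilon> A)"
  unfolding denN_def denS_def denF_def mem_def by (simp add: SigmaB0.intros)

lemma den_neg: "denF w P p \<Longrightarrow> denF w (\<^bold>\<not> P) (\<not> p)"
  unfolding denF_def neg_def by (simp add: SigmaB0_connectives)

lemma den_conj: "denF w P p \<Longrightarrow> denF w Q q \<Longrightarrow> denF w (P \<^bold>\<and> Q) (p \<and> q)"
  unfolding denF_def conj_def by (simp add: SigmaB0_connectives)

lemma den_disj: "denF w P p \<Longrightarrow> denF w Q q \<Longrightarrow> denF w (P \<^bold>\<or> Q) (p \<or> q)"
  unfolding denF_def disj_def by (simp add: SigmaB0_connectives)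

lemma den_imp: "denF w P p \<Longrightarrow> denF w Q q \<Longrightarrow> denF w (P \<^bold>\<longrightarrow> Q) (p \<longrightarrow> q)"
  unfolding denF_def imp_def by (simp add: SigmaB0_connectives)

lemma den_iff: "denF w P p \<Longrightarrow> denF w Q q \<Longrightarrow> denF w (P \<^bold>\<longleftrightarrow> Q) (p \<longleftrightarrow> q)"
  unfolding denF_def iff_def by (simp add: SigmaB0_connectives)

lemma den_cong: "denF w P p \<Longrightarrow> p = q \<Longrightarrow> denF w P q"
  by simp

lemma den_ite:
  "denF w P p \<Longrightarrow> denF w Q q \<Longrightarrow> denF w R r \<Longrightarrow> denF w (ite P Q R) (if p then q else r)"
  unfolding ite_def by (rule den_cong, (rule den_disj den_conj den_neg | assumption)+) auto

text \<open>The premise speaks of all extensions and all expressions, not just of the new variable;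
  in this form the rules can be applied repeatedly through nested binders. The proof uses it at the
  world enlarged by the bound variable.\<close>

lemma den_all_le:
  assumes t: "denN w t a"
    and F: "\<And>w' x v. w \<lesssim> w' \<Longrightarrow> denN w' x v \<Longrightarrow> denF w' (F x) (B v)"
  shows "denF w (all_le t F) (\<forall>v. v \<preceq> a \<longrightarrow> B v)"
  unfolding denF_def
proof (intro allI impI)
  fix k e l s assume w: "w \<lesssim> (k, e, l, s)"
  define p where "p = F (\<lambda>k' l'. NV (k' - Suc k)) (Suc k) l"
  have "all_le t F k l = AllN (Imp (Le (NV 0) (t (Suc k) l)) p)"
    unfolding all_le_def alln_def imp_def le_def p_def by simp
  moreover have "t (Suc k) l = shiftN_tm (t k l)" "tval e s (t k l) = a"
    using t w unfolding denN_def by blast+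
  moreover have "denF (Suc k, case_nat v e, l, s) (F (\<lambda>k' l'. NV (k' - Suc k))) (B v)" for v
    using extends_trans[OF w extends_num] denN_var by (rule F)
  then have "SigmaB0 p" "sat (case_nat v e) s p \<longleftrightarrow> B v" for v
    using extends_refl unfolding denF_def p_def by blast+
  ultimately show "SigmaB0 (all_le t F k l) \<and> (sat e s (all_le t F k l) \<longleftrightarrow> (\<forall>v. v \<preceq> a \<longrightarrow> B v))"
    by (auto simp: tval_subst intro: SigmaB0.intros)
qed

lemma den_ex_le:
  assumes t: "denN w t a"
    and F: "\<And>w' x v. w \<lesssim> w' \<Longrightarrow> denN w' x v \<Longrightarrow> denF w' (F x) (B v)"
  shows "denF w (ex_le t F) (\<exists>v. v \<preceq> a \<and> B v)"
  unfolding denF_def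
proof (intro allI impI)
  fix k e l s assume w: "w \<lesssim> (k, e, l, s)"
  define p where "p = F (\<lambda>k' l'. NV (k' - Suc k)) (Suc k) l"
  have "ex_le t F k l = ExN (Conj (Le (NV 0) (t (Suc k) l)) p)"
    unfolding ex_le_def exn_def conj_def le_def p_def by simp
  moreover have "t (Suc k) l = shiftN_tm (t k l)" "tval e s (t k l) = a"
    using t w unfolding denN_def by blast+
  moreover have "denF (Suc k, case_nat v e, l, s) (F (\<lambda>k' l'. NV (k' - Suc k))) (B v)" for v
    using extends_trans[OF w extends_num] denN_var by (rule F)
  then have "SigmaB0 p" "sat (case_nat v e) s p \<longleftrightarrow> B v" for v
    using extends_refl unfolding denF_def p_def by blast+
  ultimately show "SigmaB0 (ex_le t F k l) \<and> (sat e s (ex_le t F k l) \<longleftrightarrow> (\<exists>v. v \<preceq> a \<and> B v))"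
    by (auto simp: tval_subst intro: SigmaB0.intros)
qed

lemma den_all_from1:
  assumes "denN w t a"
    and "\<And>w' x v. w \<lesssim> w' \<Longrightarrow> denN w' x v \<Longrightarrow> denF w' (F x) (B v)"
  shows "denF w (all_from1 t F) (\<forall>v. v \<preceq> a \<longrightarrow> \<one> \<preceq> v \<longrightarrow> B v)"
  unfolding all_from1_def by (intro den_all_le den_imp den_le den_one assms)

lemma den_ex_from1:
  assumes "denN w t a"
    and "\<And>w' x v. w \<lesssim> w' \<Longrightarrow> denN w' x v \<Longrightarrow> denF w' (F x) (B v)"
  shows "denF w (ex_from1 t F) (\<exists>v. v \<preceq> a \<and> \<one> \<preceq> v \<and> B v)"
  unfolding ex_from1_def by (intro den_ex_le den_conj den_le den_one assms)

lemmas den_num = den_zero den_one den_add den_mul den_len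
lemmas den_form = den_eqn den_le den_mem den_neg den_conj den_disj den_imp den_iff den_ite
  den_all_le den_ex_le den_all_from1 den_ex_from1

text \<open>Definability by a \<Sigma>^B_0-formula with parameters: the environments of the world w
  hold the parameters, and x stands for the argument.\<close>

definition definable :: "('a \<Rightarrow> bool) \<Rightarrow> bool" where
  "definable B \<longleftrightarrow> (\<exists>w F. \<forall>w' x v. w \<lesssim> w' \<longrightarrow> denN w' x v \<longrightarrow> denF w' (F x) (B v))"

text \<open>Each parameter becomes the value of one more variable pushed onto the environment.
  Denotations persist under extension, so all parameters are available in the last world.\<close>

lemma definableI:
  fixes a b c d :: 'a and A B :: 'b
  assumes "\<And>w x y z u X Y t v. denN w x a \<Longrightarrow> denN w y b \<Longrightarrow> denN w z c \<Longrightarrow> denN w u d \<Longrightarrow>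
    denS w X A \<Longrightarrow> denS w Y B \<Longrightarrow> denN w t v \<Longrightarrow> denF w (F x y z u X Y t) (P v)"
  shows "definable P"
proof -
  obtain w1 x where 1: "denN w1 x a" using ex_denN by blast
  obtain w2 y where 2: "denN w2 y b" "w1 \<lesssim> w2" using ex_denN by blast
  obtain w3 z where 3: "denN w3 z c" "w2 \<lesssim> w3" using ex_denN by blast
  obtain w4 u where 4: "denN w4 u d" "w3 \<lesssim> w4" using ex_denN by blast
  obtain w5 X where 5: "denS w5 X A" "w4 \<lesssim> w5" using ex_denS by blast
  obtain w6 Y where 6: "denS w6 Y B" "w5 \<lesssim> w6" using ex_denS by blast
  note ext5 = 6(2) and ext4 = extends_trans[OF 5(2) 6(2)]
  note ext3 = extends_trans[OF 4(2) ext4]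
  note ext2 = extends_trans[OF 3(2) ext3]
  note ext1 = extends_trans[OF 2(2) ext2]
  have "denF w' (F x y z u X Y t) (P v)" if "w6 \<lesssim> w'" "denN w' t v" for w' t v
    using that 1 2 3 4 5 6
    by (intro assms) (blast intro: denN_mono denS_mono extends_trans ext1 ext2 ext3 ext4 ext5)+
  then show ?thesis unfolding definable_def by blast
qed

lemma definable_all_below: "definable B \<Longrightarrow> definable (\<lambda>v. \<forall>u. u \<preceq> v \<longrightarrow> B u)"
  unfolding definable_def
proof (elim exE)
  fix w F
  assume F: "\<forall>w' x v. w \<lesssim> w' \<longrightarrow> denN w' x v \<longrightarrow> denF w' (F x) (B v)"
  show "\<exists>w F. \<forall>w' x v. w \<lesssim> w' \<longrightarrow> denN w' x v \<longrightarrow> denF w' (F x) (\<forall>u. u \<preceq> v \<longrightarrow> B u)"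
    by (rule exI[of _ w], rule exI[of _ "\<lambda>x. all_le x F"])
      (use F extends_trans in \<open>blast intro: den_all_le\<close>)
qed

end


section \<open>Number theory in models of \<open>V\<^sup>0\<close>\<close>

context v0_model
begin

abbreviation lt :: "'a \<Rightarrow> 'a \<Rightarrow> bool" (infix "\<prec>" 50) where
  "x \<prec> y \<equiv> x \<preceq> y \<and> x \<noteq> y"

lemma BASIC:
  "x \<oplus> \<one> \<noteq> \<zero>"
  "x \<oplus> \<one> = y \<oplus> \<one> \<Longrightarrow> x = y"
  "x \<oplus> \<zero> = x"
  "x \<oplus> (y \<oplus> \<one>) = (x \<oplus> y) \<oplus> \<one>"
  "x \<otimes> \<zero> = \<zero>"
  "x \<otimes> (y \<oplus> \<one>) = x \<otimes> y \<oplus> x"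
  "x \<preceq> y \<Longrightarrow> y \<preceq> x \<Longrightarrow> x = y"
  "x \<preceq> x \<oplus> y"
  "\<zero> \<preceq> x"
  "x \<preceq> y \<or> y \<preceq> x"
  "x \<preceq> y \<longleftrightarrow> x \<prec> y \<oplus> \<one>"
  "x \<noteq> \<zero> \<Longrightarrow> \<exists>y. y \<preceq> x \<and> y \<oplus> \<one> = x"
  "y \<epsilon> X \<Longrightarrow> y \<prec> siz X"
  "y \<oplus> \<one> = siz X \<Longrightarrow> y \<epsilon> X"
proof -
  have *: "\<forall>p\<in>BASIC2. sat (case_nat x (\<lambda>i. y)) (\<lambda>i. X) p"
    using V0 unfolding V0_def by blast
  note B = *[unfolded BASIC2_def Let_def, simplified]
  show "x \<oplus> \<one> \<noteq> \<zero>" "x \<oplus> \<one> = y \<oplus> \<one> \<Longrightarrow> x = y" "x \<oplus> \<zero> = x"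
    "x \<oplus> (y \<oplus> \<one>) = (x \<oplus> y) \<oplus> \<one>" "x \<otimes> \<zero> = \<zero>" "x \<otimes> (y \<oplus> \<one>) = x \<otimes> y \<oplus> x"
    "x \<preceq> y \<Longrightarrow> y \<preceq> x \<Longrightarrow> x = y" "x \<preceq> x \<oplus> y" "\<zero> \<preceq> x" "x \<preceq> y \<or> y \<preceq> x"
    "x \<preceq> y \<longleftrightarrow> x \<prec> y \<oplus> \<one>" "x \<noteq> \<zero> \<Longrightarrow> \<exists>y. y \<preceq> x \<and> y \<oplus> \<one> = x"
    "y \<epsilon> X \<Longrightarrow> y \<prec> siz X" "y \<oplus> \<one> = siz X \<Longrightarrow> y \<epsilon> X"
    using B by blast+
qed

lemma comprehension:
  assumes "definable B"
  obtains X where "siz X \<preceq> y" "\<And>z. z \<prec> y \<Longrightarrow> z \<epsilon> X \<longleftrightarrow> B z"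
proof -
  obtain k e l s F where F: "\<And>w' x v. (k, e, l, s) \<lesssim> w' \<Longrightarrow> denN w' x v \<Longrightarrow> denF w' (F x) (B v)"
    using assms unfolding definable_def by (metis prod.exhaust)
  \<comment> \<open>In the axiom scheme, variable 1 of the formula is the bound y and variable 0 the
    element z. The defining formula is therefore placed below two new number variables.\<close>
  define p where "p = F (\<lambda>k' l'. NV (k' - Suc (Suc k))) (Suc (Suc k)) l"
  have "denF (Suc (Suc k), case_nat z (case_nat y e), l, s) (F (\<lambda>k' l'. NV (k' - Suc (Suc k)))) (B z)"
    for z
    by (rule F[OF _ denN_var]) (rule extends_trans[OF extends_num extends_num])
  then have p: "SigmaB0 p" "sat (case_nat z (case_nat y e)) s p \<longleftrightarrow> B z" for z
    using extends_refl unfolding denF_def p_def by blast+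
  then have "sat (case_nat y e) s (comprehension p)"
    by (intro V0) (auto simp: V0_def)
  then show ?thesis
    using p(2) that by (auto simp: comprehension_def sat_subst)
qed

lemma le_cases: "x \<preceq> y \<oplus> \<one> \<Longrightarrow> x = y \<oplus> \<one> \<or> x \<preceq> y"
  using BASIC(11) by blast

text \<open>The length of a set acts as a maximum principle. Let Y consist of the z below x such
  that B holds up to z. It contains 0, so it has a greatest element z, with z + 1 the length of Y.
  Then B holds up to z + 1, which differs from x and so lies in Y, contrary to maximality of
  z.\<close>

lemma induction:
  assumes "definable B" "B \<zero>" "\<And>x. B x \<Longrightarrow> B (x \<oplus> \<one>)"
  shows "B x"
proof (rule ccontr)
  assume "\<not> B x"
  obtain Y where Y: "siz Y \<preceq> x" "\<And>z. z \<prec> x \<Longrightarrow> z \<epsilon> Y \<longleftrightarrow> (\<forall>u. u \<preceq> z \<longrightarrow> B u)"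
    using comprehension[OF definable_all_below[OF assms(1)], of x] by blast
  have "\<zero> \<prec> x" using BASIC(9) \<open>\<not> B x\<close> assms(2) by blast
  moreover have "\<forall>u. u \<preceq> \<zero> \<longrightarrow> B u" using BASIC(7,9) assms(2) by metis
  ultimately have "\<zero> \<epsilon> Y" using Y(2) by blast
  then have "siz Y \<noteq> \<zero>" using BASIC(13) by metis
  then obtain z where z: "z \<oplus> \<one> = siz Y" using BASIC(12) by blast
  then have "z \<epsilon> Y" by (rule BASIC(14))
  have "\<not> x \<preceq> z" using BASIC(11)[of x z] BASIC(7)[of x "z \<oplus> \<one>"] Y(1) z by metis
  then have "z \<prec> x" using BASIC(10) by metis
  then have below: "\<forall>u. u \<preceq> z \<longrightarrow> B u" using Y(2) \<open>z \<epsilon> Y\<close> by blast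
  then have "B (z \<oplus> \<one>)" using assms(3) BASIC(10) by blast
  then have below': "\<forall>u. u \<preceq> z \<oplus> \<one> \<longrightarrow> B u" using below le_cases by blast
  then have "z \<oplus> \<one> \<prec> x" using Y(1) z \<open>\<not> B x\<close> \<open>B (z \<oplus> \<one>)\<close> by metis
  then have "z \<oplus> \<one> \<epsilon> Y" using Y(2) below' by blast
  then show False using BASIC(13) z by metis
qed

section \<open>Commutative semiring laws by definable induction\<close>

lemma add_left_zero: "\<zero> \<oplus> x = x"
proof (induction x rule: induction)
  show "definable (\<lambda>x. \<zero> \<oplus> x = x)"
    by (rule definableI[where F = "\<lambda>_ _ _ _ _ _ x. \<^bold>0 \<^bold>+ x \<^bold>= x"]) (intro den_form den_num)
qed (simp_all only: BASIC(3-6))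

lemma add_left_one: "(y \<oplus> \<one>) \<oplus> x = (y \<oplus> x) \<oplus> \<one>"
proof (induction x rule: induction)
  show "definable (\<lambda>x. (y \<oplus> \<one>) \<oplus> x = (y \<oplus> x) \<oplus> \<one>)"
    by (rule definableI[where a = y and F = "\<lambda>y _ _ _ _ _ x. (y \<^bold>+ \<^bold>1) \<^bold>+ x \<^bold>= (y \<^bold>+ x) \<^bold>+ \<^bold>1"])
      (intro den_form den_num)
qed (simp_all only: BASIC(3-6))

lemma add_commutes: "y \<oplus> x = x \<oplus> y"
proof (induction x rule: induction)
  show "definable (\<lambda>x. y \<oplus> x = x \<oplus> y)"
    by (rule definableI[where a = y and F = "\<lambda>y _ _ _ _ _ x. y \<^bold>+ x \<^bold>= x \<^bold>+ y"])
      (intro den_form den_num)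
qed (simp_all only: BASIC(3-6) add_left_zero add_left_one)

lemma add_associates: "(x \<oplus> y) \<oplus> z = x \<oplus> (y \<oplus> z)"
proof (induction z rule: induction)
  show "definable (\<lambda>z. (x \<oplus> y) \<oplus> z = x \<oplus> (y \<oplus> z))"
    by (rule definableI[where a = x and b = y and
          F = "\<lambda>x y _ _ _ _ z. (x \<^bold>+ y) \<^bold>+ z \<^bold>= x \<^bold>+ (y \<^bold>+ z)"]) (intro den_form den_num)
qed (simp_all only: BASIC(3-6))

sublocale N: comm_monoid_add pls zer
  by standard (rule add_associates add_commutes add_left_zero)+

lemma mult_left_zero: "\<zero> \<otimes> x = \<zero>"
proof (induction x rule: induction)
  show "definable (\<lambda>x. \<zero> \<otimes> x = \<zero>)"
    by (rule definableI[where F = "\<lambda>_ _ _ _ _ _ x. \<^bold>0 \<^bold>* x \<^bold>= \<^bold>0"]) (intro den_form den_num)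
qed (simp_all only: BASIC(3-6))

lemma mult_left_add_one: "(y \<oplus> \<one>) \<otimes> x = y \<otimes> x \<oplus> x"
proof (induction x rule: induction)
  show "definable (\<lambda>x. (y \<oplus> \<one>) \<otimes> x = y \<otimes> x \<oplus> x)"
    by (rule definableI[where a = y and F = "\<lambda>y _ _ _ _ _ x. (y \<^bold>+ \<^bold>1) \<^bold>* x \<^bold>= y \<^bold>* x \<^bold>+ x"])
      (intro den_form den_num)
qed (simp_all add: BASIC(5,6) N.add_ac)

lemma mult_commutes: "y \<otimes> x = x \<otimes> y"
proof (induction x rule: induction)
  show "definable (\<lambda>x. y \<otimes> x = x \<otimes> y)"
    by (rule definableI[where a = y and F = "\<lambda>y _ _ _ _ _ x. y \<^bold>* x \<^bold>= x \<^bold>* y"])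
      (intro den_form den_num)
qed (simp_all only: BASIC(3-6) mult_left_zero mult_left_add_one)

lemma mult_distributes: "(x \<oplus> y) \<otimes> z = x \<otimes> z \<oplus> y \<otimes> z"
proof (induction z rule: induction)
  show "definable (\<lambda>z. (x \<oplus> y) \<otimes> z = x \<otimes> z \<oplus> y \<otimes> z)"
    by (rule definableI[where a = x and b = y and
          F = "\<lambda>x y _ _ _ _ z. (x \<^bold>+ y) \<^bold>* z \<^bold>= x \<^bold>* z \<^bold>+ y \<^bold>* z"]) (intro den_form den_num)
qed (simp_all add: BASIC(5,6) N.add_ac)

lemma mult_associates: "(x \<otimes> y) \<otimes> z = x \<otimes> (y \<otimes> z)"
proof (induction z rule: induction)
  show "definable (\<lambda>z. (x \<otimes> y) \<otimes> z = x \<otimes> (y \<otimes> z))"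
    by (rule definableI[where a = x and b = y and
          F = "\<lambda>x y _ _ _ _ z. (x \<^bold>* y) \<^bold>* z \<^bold>= x \<^bold>* (y \<^bold>* z)"]) (intro den_form den_num)
next
  fix z assume "x \<otimes> y \<otimes> z = x \<otimes> (y \<otimes> z)"
  then show "x \<otimes> y \<otimes> (z \<oplus> \<one>) = x \<otimes> (y \<otimes> (z \<oplus> \<one>))"
    by (simp add: BASIC(6) mult_commutes[of x] mult_distributes)
qed (simp_all only: BASIC(3-6))

lemma mult_left_one: "\<one> \<otimes> x = x"
  using mult_left_add_one[of \<zero> x] by (simp add: mult_left_zero)

section \<open>Cancellation, order and subtraction\<close>

lemma cancel: "x \<oplus> z = y \<oplus> z \<Longrightarrow> x = y"
proof (induction z rule: induction)
  show "definable (\<lambda>z. x \<oplus> z = y \<oplus> z \<longrightarrow> x = y)"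
    by (rule definableI[where a = x and b = y and
          F = "\<lambda>x y _ _ _ _ z. x \<^bold>+ z \<^bold>= y \<^bold>+ z \<^bold>\<longrightarrow> x \<^bold>= y"]) (intro den_form den_num)
qed (auto simp: BASIC(4) dest: BASIC(2))

text \<open>The bounds on the differences make the statement a bounded formula, as induction
  requires. Through it the order becomes the natural order of addition in
  \<open>le_iff\<close>.\<close>

lemma le_or_ge_diff: "(\<exists>d. d \<preceq> y \<and> x \<oplus> d = y) \<or> (\<exists>d. d \<preceq> x \<and> y \<oplus> d = x)"
proof (induction y rule: induction)
  show "definable (\<lambda>y. (\<exists>d. d \<preceq> y \<and> x \<oplus> d = y) \<or> (\<exists>d. d \<preceq> x \<and> y \<oplus> d = x))"
    by (rule definableI[where a = x and
        F = "\<lambda>x _ _ _ _ _ y. ex_le y (\<lambda>d. x \<^bold>+ d \<^bold>= y) \<^bold>\<or> ex_le x (\<lambda>d. y \<^bold>+ d \<^bold>= x)"])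
      (intro den_form den_num; (assumption | erule denN_mono))
  show "(\<exists>d. d \<preceq> \<zero> \<and> x \<oplus> d = \<zero>) \<or> (\<exists>d. d \<preceq> x \<and> \<zero> \<oplus> d = x)"
    using BASIC(10) by auto
  fix y assume "(\<exists>d. d \<preceq> y \<and> x \<oplus> d = y) \<or> (\<exists>d. d \<preceq> x \<and> y \<oplus> d = x)"
  then consider d where "x \<oplus> d = y" | d where "y \<oplus> d = x" by blast
  then show "(\<exists>d. d \<preceq> y \<oplus> \<one> \<and> x \<oplus> d = y \<oplus> \<one>) \<or> (\<exists>d. d \<preceq> x \<and> y \<oplus> \<one> \<oplus> d = x)"
  proof cases
    case 1
    then have "x \<oplus> (d \<oplus> \<one>) = y \<oplus> \<one>" by (simp add: BASIC(4))
    then show ?thesis using BASIC(8) N.add_commute by metis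
  next
    case (2 d)
    show ?thesis
    proof (cases "d = \<zero>")
      case True
      then have "x \<oplus> \<one> = y \<oplus> \<one>" using 2 by simp
      then show ?thesis using BASIC(8) N.add_commute by metis
    next
      case False
      then obtain d' where "d = d' \<oplus> \<one>" using BASIC(12) by metis
      then have "y \<oplus> \<one> \<oplus> d' = x" using 2 by (simp add: N.add_ac)
      then show ?thesis using BASIC(8) N.add_commute by metis
    qed
  qed
qed

lemma le_iff: "x \<preceq> y \<longleftrightarrow> (\<exists>d. y = x \<oplus> d)"
  using le_or_ge_diff BASIC(3,7,8) by metis

lemma no_zero_divisors: "x \<otimes> y = \<zero> \<Longrightarrow> x = \<zero> \<or> y = \<zero>"
proof (rule ccontr)
  assume "x \<otimes> y = \<zero>" "\<not> (x = \<zero> \<or> y = \<zero>)"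
  then obtain x' y' where "x = x' \<oplus> \<one>" "y = y' \<oplus> \<one>" using BASIC(12) by metis
  with \<open>x \<otimes> y = \<zero>\<close> show False by (simp add: BASIC(1,4,6))
qed

text \<open>Truncated subtraction only serves to instantiate \<open>linordered_semidom\<close>.\<close>

definition monus :: "'a \<Rightarrow> 'a \<Rightarrow> 'a" (infixl "\<ominus>" 65) where
  "x \<ominus> y = (if y \<preceq> x then THE d. x = y \<oplus> d else \<zero>)"

lemma cancel_left: "z \<oplus> x = z \<oplus> y \<Longrightarrow> x = y"
  using cancel N.add_commute by metis

lemma monus_add: "y \<oplus> d \<ominus> y = d"
  using cancel_left[of y] by (simp add: monus_def BASIC(8)) (blast intro: the_equality)

lemma monus_le: "x \<preceq> y \<Longrightarrow> x \<ominus> y = \<zero>"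
  using BASIC(7)[of x y] monus_add[of x \<zero>] by (cases "y \<preceq> x") (auto simp: monus_def)

sublocale N: linordered_semidom where plus = pls and zero = zer and one = uno and times = tms
  and less_eq = leq and less = lt and minus = monus
proof unfold_locales
  fix a b c
  show "a \<oplus> b \<ominus> a = b" by (rule monus_add)
  show refl: "a \<preceq> a" using BASIC(10) by blast
  show trans: "a \<preceq> b \<Longrightarrow> b \<preceq> c \<Longrightarrow> a \<preceq> c" by (auto simp: le_iff N.add_assoc)
  show antisym: "a \<preceq> b \<Longrightarrow> b \<preceq> a \<Longrightarrow> a = b" by (rule BASIC(7))
  show linear: "a \<preceq> b \<or> b \<preceq> a" by (rule BASIC(10))
  show "a \<prec> b \<longleftrightarrow> a \<preceq> b \<and> \<not> b \<preceq> a" using refl antisym by blast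
  show "a \<preceq> b \<Longrightarrow> c \<oplus> a \<preceq> c \<oplus> b" by (auto simp: le_iff N.add_assoc)
  show "a \<otimes> b \<otimes> c = a \<otimes> (b \<otimes> c)" by (rule mult_associates)
  show "a \<otimes> b = b \<otimes> a" by (rule mult_commutes)
  show "(a \<oplus> b) \<otimes> c = a \<otimes> c \<oplus> b \<otimes> c" by (rule mult_distributes)
  show distrib: "a \<otimes> (b \<oplus> c) = a \<otimes> b \<oplus> a \<otimes> c" for a b c
    by (simp add: mult_commutes[of a] mult_distributes)
  show "\<zero> \<otimes> a = \<zero>" by (rule mult_left_zero)
  show mult_zero: "a \<otimes> \<zero> = \<zero>" for a by (rule BASIC(5))
  show "\<one> \<otimes> a = a" by (rule mult_left_one)
  show "\<zero> \<noteq> \<one>" using BASIC(1)[of \<zero>] by simp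
  then show "\<zero> \<prec> \<one>" using BASIC(9) by simp
  show "a \<noteq> \<zero> \<Longrightarrow> b \<noteq> \<zero> \<Longrightarrow> a \<otimes> b \<noteq> \<zero>" using no_zero_divisors by blast
  show "b \<preceq> a \<Longrightarrow> a \<ominus> b \<oplus> b = a"
    by (auto simp: le_iff monus_add) (rule N.add_commute)
  show "c \<otimes> a \<prec> c \<otimes> b" if ab: "a \<prec> b" and c: "\<zero> \<prec> c"
  proof -
    obtain d where d: "b = a \<oplus> d" using ab le_iff[of a b] by blast
    have "d \<noteq> \<zero>" using ab d by auto
    then have "c \<otimes> d \<noteq> \<zero>" using no_zero_divisors c by metis
    then have "c \<otimes> a \<noteq> c \<otimes> a \<oplus> c \<otimes> d" using cancel_left[of "c \<otimes> a" \<zero> "c \<otimes> d"] by auto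
    then show ?thesis using BASIC(8) by (simp add: d distrib)
  qed
  show "a \<otimes> (b \<ominus> c) = a \<otimes> b \<ominus> a \<otimes> c"
  proof (cases "b \<preceq> c")
    case True
    then have "a \<otimes> b \<preceq> a \<otimes> c" by (auto simp: le_iff distrib)
    with True show ?thesis by (simp add: monus_le mult_zero)
  next
    case False
    then obtain d where "b = c \<oplus> d" using BASIC(10)[of b c] le_iff[of c b] by blast
    then show ?thesis by (simp add: monus_add distrib)
  qed
  show "a \<ominus> b \<ominus> c = a \<ominus> (b \<oplus> c)"
  proof (cases "b \<preceq> a")
    case True
    then obtain d where d: "a = b \<oplus> d" using le_iff[of b a] by blast
    show ?thesis
    proof (cases "c \<preceq> d")
      case True
      then obtain d' where "d = c \<oplus> d'" using le_iff[of c d] by blast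
      then show ?thesis unfolding d by (metis monus_add N.add_assoc)
    next
      case False
      then have "d \<preceq> c" using BASIC(10) by blast
      then have "b \<oplus> d \<preceq> b \<oplus> c" by (auto simp: le_iff N.add_assoc)
      with \<open>d \<preceq> c\<close> show ?thesis by (simp add: d monus_add monus_le)
    qed
  next
    case False
    then have "a \<preceq> b" using BASIC(10) by blast
    then have "a \<preceq> b \<oplus> c" by (auto simp: le_iff N.add_assoc)
    with \<open>a \<preceq> b\<close> BASIC(9) show ?thesis by (simp add: monus_le)
  qed
qed

text \<open>Sums of ones are to stay in the form in which \<open>two\<close> and
  \<open>three\<close> are defined, rather than become numerals.\<close>

declare N.one_add_one [simp del]

lemma less_iff: "x \<prec> y \<longleftrightarrow> x \<oplus> \<one> \<preceq> y"
  using BASIC(11) N.not_le by metis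

lemma le_add_one_iff: "x \<preceq> y \<oplus> \<one> \<longleftrightarrow> x \<preceq> y \<or> x = y \<oplus> \<one>"
  using BASIC(11)[of x y] by auto

lemma one_le_iff: "\<one> \<preceq> x \<longleftrightarrow> x \<noteq> \<zero>"
  using less_iff[of \<zero> x] BASIC(9) by auto


section \<open>The Cantor pairing in models\<close>

lemma double_strict: "x \<prec> y \<Longrightarrow> x \<oplus> x \<prec> y \<oplus> y"
  by (rule N.add_strict_mono)

lemma double_inj: "x \<oplus> x = y \<oplus> y \<longleftrightarrow> x = y"
  using double_strict[of x y] double_strict[of y x] N.linear by metis

text \<open>If z is half of s(s+1), then z + (s+1) is half of (s+1)(s+2). The bound on z makes the
  induction hypothesis definable.\<close>

lemma pronic_even: "\<exists>z. z \<oplus> z = s \<otimes> (s \<oplus> \<one>)"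
proof -
  have "\<exists>z. z \<preceq> s \<otimes> (s \<oplus> \<one>) \<and> z \<oplus> z = s \<otimes> (s \<oplus> \<one>)"
  proof (induction s rule: induction)
    show "definable (\<lambda>s. \<exists>z. z \<preceq> s \<otimes> (s \<oplus> \<one>) \<and> z \<oplus> z = s \<otimes> (s \<oplus> \<one>))"
      by (rule definableI[where F = "\<lambda>_ _ _ _ _ _ s. ex_le (s \<^bold>* (s \<^bold>+ \<^bold>1))
            (\<lambda>z. z \<^bold>+ z \<^bold>= s \<^bold>* (s \<^bold>+ \<^bold>1))"])
        (intro den_form den_num; (assumption | erule denN_mono))
    show "\<exists>z. z \<preceq> \<zero> \<otimes> (\<zero> \<oplus> \<one>) \<and> z \<oplus> z = \<zero> \<otimes> (\<zero> \<oplus> \<one>)"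
      by (intro exI[of _ \<zero>]) simp
    fix s assume "\<exists>z. z \<preceq> s \<otimes> (s \<oplus> \<one>) \<and> z \<oplus> z = s \<otimes> (s \<oplus> \<one>)"
    then obtain z where "z \<oplus> z = s \<otimes> (s \<oplus> \<one>)" by blast
    then have *: "(z \<oplus> (s \<oplus> \<one>)) \<oplus> (z \<oplus> (s \<oplus> \<one>)) = (s \<oplus> \<one>) \<otimes> (s \<oplus> \<one> \<oplus> \<one>)"
      by (simp add: N.distrib_left N.distrib_right N.add_ac)
    then show "\<exists>z. z \<preceq> (s \<oplus> \<one>) \<otimes> (s \<oplus> \<one> \<oplus> \<one>) \<and> z \<oplus> z = (s \<oplus> \<one>) \<otimes> (s \<oplus> \<one> \<oplus> \<one>)"
      using BASIC(8) by metis
  qed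
  then show ?thesis by blast
qed

definition cp :: "'a \<Rightarrow> 'a \<Rightarrow> 'a" where
  "cp x y = (THE z. z \<oplus> z = (x \<oplus> y) \<otimes> (x \<oplus> y \<oplus> \<one>) \<oplus> (x \<oplus> x))"

lemma cp_iff: "z \<oplus> z = (x \<oplus> y) \<otimes> (x \<oplus> y \<oplus> \<one>) \<oplus> (x \<oplus> x) \<longleftrightarrow> z = cp x y"
proof -
  obtain t where "t \<oplus> t = (x \<oplus> y) \<otimes> (x \<oplus> y \<oplus> \<one>)" using pronic_even by blast
  then have "(t \<oplus> x) \<oplus> (t \<oplus> x) = (x \<oplus> y) \<otimes> (x \<oplus> y \<oplus> \<one>) \<oplus> (x \<oplus> x)"
    by (metis N.add_assoc N.add.left_commute)
  then have "\<exists>!z. z \<oplus> z = (x \<oplus> y) \<otimes> (x \<oplus> y \<oplus> \<one>) \<oplus> (x \<oplus> x)" by (metis double_inj)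
  from theI'[OF this] show ?thesis unfolding cp_def[symmetric] by (metis double_inj)
qed

text \<open>Pairs on different diagonals have different codes. With s = x + y, twice the code of
  (x,y) is s(s+1) + 2x, which is less than (s+1)(s+2) because x < s + 1, and (s+1)(s+2) is at most
  s'(s'+1) for a larger sum s'.\<close>

lemma cp_less:
  assumes "x \<oplus> y \<prec> x' \<oplus> y'"
  shows "cp x y \<noteq> cp x' y'"
proof
  assume "cp x y = cp x' y'"
  define s where "s = x \<oplus> y"
  define s' where "s' = x' \<oplus> y'"
  have eq: "s \<otimes> (s \<oplus> \<one>) \<oplus> (x \<oplus> x) = s' \<otimes> (s' \<oplus> \<one>) \<oplus> (x' \<oplus> x')"
    using cp_iff \<open>cp x y = cp x' y'\<close> unfolding s_def s'_def by metis
  have "x \<preceq> s" unfolding s_def by (rule BASIC(8))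
  then have "x \<prec> s \<oplus> \<one>" using BASIC(11) by blast
  then have less: "s \<otimes> (s \<oplus> \<one>) \<oplus> (x \<oplus> x) \<prec>
      s \<otimes> (s \<oplus> \<one>) \<oplus> ((s \<oplus> \<one>) \<oplus> (s \<oplus> \<one>))"
    by (intro N.add_strict_left_mono double_strict)
  have "s \<otimes> (s \<oplus> \<one>) \<oplus> ((s \<oplus> \<one>) \<oplus> (s \<oplus> \<one>)) = (s \<oplus> \<one>) \<otimes> (s \<oplus> \<one> \<oplus> \<one>)"
    by (simp add: N.distrib_left N.distrib_right N.add_ac)
  also have "\<dots> \<preceq> s' \<otimes> (s' \<oplus> \<one>)"
    using assms unfolding less_iff s_def s'_def by (intro N.mult_mono N.add_right_mono BASIC(9))
  also have "\<dots> \<preceq> s' \<otimes> (s' \<oplus> \<one>) \<oplus> (x' \<oplus> x')" by (rule BASIC(8))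
  finally show False using less BASIC(7) unfolding eq by metis
qed

lemma cp_inj: "cp x y = cp x' y' \<longleftrightarrow> x = x' \<and> y = y'"
proof
  assume eq: "cp x y = cp x' y'"
  then have s: "x \<oplus> y = x' \<oplus> y'" using cp_less N.linear by metis
  have "(x \<oplus> y) \<otimes> (x \<oplus> y \<oplus> \<one>) \<oplus> (x \<oplus> x) = (x \<oplus> y) \<otimes> (x \<oplus> y \<oplus> \<one>) \<oplus> (x' \<oplus> x')"
    using cp_iff eq s by metis
  then have "x = x'" using cancel_left double_inj by metis
  then show "x = x' \<and> y = y'" using s cancel_left by metis
qed simp

lemma cp_bounded: "\<exists>c. \<forall>x y. x \<preceq> a \<longrightarrow> y \<preceq> b \<longrightarrow> cp x y \<preceq> c"
proof (intro exI allI impI)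
  fix x y assume "x \<preceq> a" "y \<preceq> b"
  \<comment> \<open>The double of a code is a monotone polynomial in its arguments, so bounding the
    double avoids halving. The resulting bound is twice the code of (a,b).\<close>
  have "cp x y \<preceq> cp x y \<oplus> cp x y" by (rule BASIC(8))
  also have "\<dots> = (x \<oplus> y) \<otimes> (x \<oplus> y \<oplus> \<one>) \<oplus> (x \<oplus> x)" using cp_iff by blast
  also have "\<dots> \<preceq> (a \<oplus> b) \<otimes> (a \<oplus> b \<oplus> \<one>) \<oplus> (a \<oplus> a)"
    using \<open>x \<preceq> a\<close> \<open>y \<preceq> b\<close> by (intro N.add_mono N.mult_mono BASIC(9) N.order_refl)
  finally show "cp x y \<preceq> (a \<oplus> b) \<otimes> (a \<oplus> b \<oplus> \<one>) \<oplus> (a \<oplus> a)" .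
qed

text \<open>The defining equation leaves one possible value of the quantified z, and the code
  satisfies the bound since it is at most its double. Hence the quantifier disappears from the
  semantics.\<close>

lemma den_pair:
  assumes "denN w x a" "denN w y b"
    and "\<And>w' z c. w \<lesssim> w' \<Longrightarrow> denN w' z c \<Longrightarrow> denF w' (K z) (B c)"
  shows "denF w (pair x y K) (B (cp a b))"
proof (rule den_cong)
  show "denF w (pair x y K) (\<exists>z. z \<preceq> (a \<oplus> b) \<otimes> (a \<oplus> b \<oplus> \<one>) \<oplus> (a \<oplus> a) \<and>
      z \<oplus> z = (a \<oplus> b) \<otimes> (a \<oplus> b \<oplus> \<one>) \<oplus> (a \<oplus> a) \<and> B z)"
    unfolding pair_def
    by (intro den_form den_num; (assumption | rule assms denN_mono[OF assms(1)] denN_mono[OF assms(2)])+)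
  show "(\<exists>z. z \<preceq> (a \<oplus> b) \<otimes> (a \<oplus> b \<oplus> \<one>) \<oplus> (a \<oplus> a) \<and>
      z \<oplus> z = (a \<oplus> b) \<otimes> (a \<oplus> b \<oplus> \<one>) \<oplus> (a \<oplus> a) \<and> B z) \<longleftrightarrow> B (cp a b)"
    using BASIC(8)[of "cp a b" "cp a b", unfolded cp_iff[THEN iffD2, OF refl]] cp_iff[of _ a b]
    by auto
qed

end


section \<open>Semantics of the coded objects\<close>

datatype 'a st = St (srow: 'a) (scol: 'a) (sflag: 'a) (sav: 'a) (spd: 'a) (spc: 'a) (slabel: 'a)

context v0_model
begin

definition two :: 'a where "two = \<one> \<oplus> \<one>"
definition three :: 'a where "three = \<one> \<oplus> \<one> \<oplus> \<one>"

lemma den_two: "denN w \<^bold>2 two"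
  unfolding two_def by (intro den_num)

lemma den_three: "denN w \<^bold>3 three"
  unfolding three_def by (intro den_num)

definition signv :: "'a \<Rightarrow> bool" where "signv v \<longleftrightarrow> v = two \<or> v = \<zero> \<or> v = \<one>"
definition bitv :: "'a \<Rightarrow> bool" where "bitv v \<longleftrightarrow> v = \<zero> \<or> v = \<one>"
definition evenv :: "'a \<Rightarrow> bool" where "evenv x \<longleftrightarrow> (\<exists>h. h \<preceq> x \<and> x = h \<oplus> h)"
definition oddv :: "'a \<Rightarrow> bool" where "oddv x \<longleftrightarrow> (\<exists>h. h \<preceq> x \<and> x = h \<oplus> h \<oplus> \<one>)"

definition in2 :: "'a \<Rightarrow> 'a \<Rightarrow> 'b \<Rightarrow> bool" where "in2 x y X \<longleftrightarrow> cp x y \<epsilon> X"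
definition in3 :: "'a \<Rightarrow> 'a \<Rightarrow> 'a \<Rightarrow> 'b \<Rightarrow> bool" where "in3 x y z X \<longleftrightarrow> cp (cp x y) z \<epsilon> X"

lemma den_is_sign: "denN w x v \<Longrightarrow> denF w (is_sign x) (signv v)"
  unfolding is_sign_def signv_def by (intro den_form den_two den_num)

lemma den_is_bit: "denN w x v \<Longrightarrow> denF w (is_bit x) (bitv v)"
  unfolding is_bit_def bitv_def by (intro den_form den_num)

lemma den_evn: "denN w x v \<Longrightarrow> denF w (evn x) (evenv v)"
  unfolding evn_def evenv_def by (intro den_form den_num; (assumption | erule denN_mono)+)

lemma den_odd1: "denN w x v \<Longrightarrow> denF w (odd1 x) (oddv v)"
  unfolding odd1_def oddv_def by (intro den_form den_num; (assumption | erule denN_mono)+)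

lemma den_mem2: "denN w x a \<Longrightarrow> denN w y b \<Longrightarrow> denS w X A \<Longrightarrow> denF w (mem2 x y X) (in2 a b A)"
  unfolding mem2_def in2_def
  by (rule den_pair[where B = "\<lambda>z. z \<epsilon> A"]; (assumption | rule den_mem | erule denS_mono)+)

lemma den_triple:
  assumes "denN w x a" "denN w y b" "denN w z c"
    and "\<And>w' u d. w \<lesssim> w' \<Longrightarrow> denN w' u d \<Longrightarrow> denF w' (K u) (B d)"
  shows "denF w (triple x y z K) (B (cp (cp a b) c))"
  unfolding triple_def
  by (rule den_pair[where B = "\<lambda>d. B (cp d c)"], rule assms, rule assms, rule den_pair[where B = B],
      assumption, erule denN_mono[OF assms(3)], rule assms(4), erule (1) extends_trans)

lemma den_mem3:
  "denN w x a \<Longrightarrow> denN w y b \<Longrightarrow> denN w z c \<Longrightarrow> denS w X A \<Longrightarrow>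
    denF w (mem3 x y z X) (in3 a b c A)"
  unfolding mem3_def in3_def
  by (rule den_triple[where B = "\<lambda>z. z \<epsilon> A"]; (assumption | rule den_mem | erule denS_mono)+)

lemma den_triple_eq:
  "denN w x a \<Longrightarrow> denN w y b \<Longrightarrow> denN w z c \<Longrightarrow> denN w u d \<Longrightarrow>
    denF w (triple x y z (\<lambda>v. v \<^bold>= u)) (cp (cp a b) c = d)"
  by (rule den_triple[where B = "\<lambda>z. z = d"]; (assumption | rule den_eqn | erule denN_mono)+)

lemmas den_obj = den_two den_three den_is_sign den_is_bit den_evn den_odd1 den_mem2 den_mem3
  den_triple_eq

text \<open>This predicate and the following ones keep the bounded quantifiers and the order of the
  conjuncts of the formulas. The \<open>den_\<close> rules compute exactly this shape, so that the
  translations need no rewriting.\<close>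

definition cnfv :: "'a \<Rightarrow> 'a \<Rightarrow> 'b \<Rightarrow> bool" where
  "cnfv n m \<Phi> \<longleftrightarrow>
    (\<forall>z. z \<preceq> siz \<Phi> \<longrightarrow> z \<epsilon> \<Phi> \<longrightarrow> (\<exists>i. i \<preceq> n \<and> \<one> \<preceq> i \<and> (\<exists>j. j \<preceq> m \<and> \<one> \<preceq> j \<and>
        (\<exists>s. s \<preceq> two \<and> signv s \<and> cp (cp i j) s = z)))) \<and>
    (\<forall>i. i \<preceq> n \<longrightarrow> \<one> \<preceq> i \<longrightarrow> (\<forall>j. j \<preceq> m \<longrightarrow> \<one> \<preceq> j \<longrightarrow>
        (\<exists>s. s \<preceq> two \<and> signv s \<and> in3 i j s \<Phi>) \<and>
        (\<forall>s. s \<preceq> two \<longrightarrow> (\<forall>s'. s' \<preceq> two \<longrightarrow> in3 i j s \<Phi> \<and> in3 i j s' \<Phi> \<longrightarrow> s = s'))))"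

lemma den_CNF:
  "denN w n a \<Longrightarrow> denN w m b \<Longrightarrow> denS w \<phi> \<Phi> \<Longrightarrow> denF w (CNF n m \<phi>) (cnfv a b \<Phi>)"
  unfolding CNF_def cnfv_def
  by (intro den_form den_num den_obj; (assumption | erule denN_mono denS_mono extends_trans)+)

definition satv :: "'a \<Rightarrow> 'a \<Rightarrow> 'b \<Rightarrow> 'b \<Rightarrow> bool" where
  "satv n m A \<Phi> \<longleftrightarrow>
    (\<forall>i. i \<preceq> n \<longrightarrow> \<one> \<preceq> i \<longrightarrow> (\<exists>j. j \<preceq> m \<and> \<one> \<preceq> j \<and> (\<exists>s. s \<preceq> two \<and> (s = two \<or> s = \<one>) \<and>
      in3 i j s \<Phi> \<and> (s = \<one> \<and> in2 j \<one> A \<or> s = two \<and> in2 j \<zero> A))))"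

lemma den_Sat:
  "denN w n a \<Longrightarrow> denN w m b \<Longrightarrow> denS w \<phi> \<Phi> \<Longrightarrow> denS w x A \<Longrightarrow>
    denF w (Sat n m x \<phi>) (satv a b A \<Phi>)"
  unfolding Sat_def satv_def
  by (intro den_form den_num den_obj; (assumption | erule denN_mono denS_mono extends_trans)+)

definition asgv :: "'a \<Rightarrow> 'b \<Rightarrow> bool" where
  "asgv m A \<longleftrightarrow>
    (\<forall>z. z \<preceq> siz A \<longrightarrow> z \<epsilon> A \<longrightarrow>
      (\<exists>j. j \<preceq> m \<and> \<one> \<preceq> j \<and> (\<exists>v. v \<preceq> \<one> \<and> bitv v \<and> cp j v = z))) \<and>
    (\<forall>j. j \<preceq> m \<longrightarrow> \<one> \<preceq> j \<longrightarrow>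
      (\<exists>v. v \<preceq> \<one> \<and> bitv v \<and> in2 j v A) \<and>
      (\<forall>v. v \<preceq> \<one> \<longrightarrow> (\<forall>v'. v' \<preceq> \<one> \<longrightarrow> in2 j v A \<and> in2 j v' A \<longrightarrow> v = v')))"

lemma den_assignment:
  "denN w m b \<Longrightarrow> denS w x A \<Longrightarrow> denF w (assignment m x) (asgv b A)"
  unfolding assignment_def asgv_def
  by (intro den_form den_num den_obj den_pair[where B = "\<lambda>z. z = u" for u];
      (assumption | erule denN_mono denS_mono extends_trans)+)

definition denT :: "('a, 'b) world \<Rightarrow> state \<Rightarrow> 'a st \<Rightarrow> bool" where
  "denT w s t \<longleftrightarrow> denN w (row s) (srow t) \<and> denN w (col s) (scol t) \<and> denN w (flag s) (sflag t) \<and>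
    denN w (av s) (sav t) \<and> denN w (pd s) (spd t) \<and> denN w (pc s) (spc t) \<and>
    denN w (label s) (slabel t)"

lemma denT_mono: "denT w s t \<Longrightarrow> w \<lesssim> w' \<Longrightarrow> denT w' s t"
  unfolding denT_def using denN_mono by blast

lemma denT_components:
  "denT w s t \<Longrightarrow> denN w (row s) (srow t)"
  "denT w s t \<Longrightarrow> denN w (col s) (scol t)"
  "denT w s t \<Longrightarrow> denN w (flag s) (sflag t)"
  "denT w s t \<Longrightarrow> denN w (av s) (sav t)"
  "denT w s t \<Longrightarrow> denN w (pd s) (spd t)"
  "denT w s t \<Longrightarrow> denN w (pc s) (spc t)"
  "denT w s t \<Longrightarrow> denN w (label s) (slabel t)"
  unfolding denT_def by blast+

definition qst :: "'a \<Rightarrow> 'a \<Rightarrow> 'a st" where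
  "qst n m = St (n \<oplus> m \<oplus> two) (n \<oplus> m \<oplus> two) three three three three three"

lemma denT_quiescent: "denN w n a \<Longrightarrow> denN w m b \<Longrightarrow> denT w (quiescent n m) (qst a b)"
  unfolding denT_def quiescent_def qst_def by (simp add: den_add den_two den_three)

lemma den_state_eq: "denT w s t \<Longrightarrow> denT w s' t' \<Longrightarrow> denF w (state_eq s s') (t = t')"
  unfolding state_eq_def
  by (rule den_cong, (rule den_conj den_eqn denT_components | assumption)+) (auto intro: st.expand)

definition smallv :: "'a \<Rightarrow> 'a \<Rightarrow> 'a st \<Rightarrow> bool" where
  "smallv n m t \<longleftrightarrow> srow t \<preceq> n \<oplus> m \<oplus> three \<and> scol t \<preceq> n \<oplus> m \<oplus> three \<and>
    sflag t \<preceq> n \<oplus> m \<oplus> three \<and> sav t \<preceq> n \<oplus> m \<oplus> three \<and> spd t \<preceq> n \<oplus> m \<oplus> three \<and>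
    spc t \<preceq> n \<oplus> m \<oplus> three \<and> slabel t \<preceq> n \<oplus> m \<oplus> three"

text \<open>Seven bounded number quantifiers are merged into one quantifier over records;
  \<open>smallv\<close> collects the bounds.\<close>

lemma den_ex_state:
  assumes n: "denN w n a" and m: "denN w m b"
    and F: "\<And>w' s t. w \<lesssim> w' \<Longrightarrow> denT w' s t \<Longrightarrow> denF w' (F s) (B t)"
  shows "denF w (ex_state n m F) (\<exists>t. smallv a b t \<and> B t)"
proof (rule den_cong)
  let ?c = "a \<oplus> b \<oplus> three"
  have bound: "denN w' (n \<^bold>+ m \<^bold>+ \<^bold>3) ?c" if "w \<lesssim> w'" for w'
    using that n m by (intro den_add den_three) (blast intro: denN_mono)+
  have F': "denF w' (F (State i j f x d c e)) (B (St r k f' x' d' c' e'))"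
    if "w \<lesssim> w'" "denN w' i r" "denN w' j k" "denN w' f f'" "denN w' x x'" "denN w' d d'" "denN w' c c'"
      "denN w' e e'" for w' i j f x d c e r k f' x' d' c' e'
    using that by (intro F) (simp_all add: denT_def)
  show "denF w (ex_state n m F) (\<exists>r. r \<preceq> ?c \<and> (\<exists>k. k \<preceq> ?c \<and> (\<exists>f. f \<preceq> ?c \<and> (\<exists>x. x \<preceq> ?c \<and>
      (\<exists>d. d \<preceq> ?c \<and> (\<exists>c. c \<preceq> ?c \<and> (\<exists>e. e \<preceq> ?c \<and> B (St r k f x d c e))))))))"
    unfolding ex_state_def Let_def
    by (intro den_ex_le F' bound extends_refl;
        (assumption | erule denN_mono extends_trans)+)
  show "(\<exists>r. r \<preceq> ?c \<and> (\<exists>k. k \<preceq> ?c \<and> (\<exists>f. f \<preceq> ?c \<and> (\<exists>x. x \<preceq> ?c \<and>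
      (\<exists>d. d \<preceq> ?c \<and> (\<exists>c. c \<preceq> ?c \<and> (\<exists>e. e \<preceq> ?c \<and> B (St r k f x d c e)))))))) \<longleftrightarrow>
      (\<exists>t. smallv a b t \<and> B t)" (is "?l \<longleftrightarrow> ?r")
  proof
    assume ?l
    then show ?r
      by (elim exE conjE) (rule exI, rule conjI[rotated], assumption, simp add: smallv_def)
  next
    assume ?r
    then obtain t where "smallv a b t" "B t" by blast
    then have t: "B (St (srow t) (scol t) (sflag t) (sav t) (spd t) (spc t) (slabel t))"
      "srow t \<preceq> ?c" "scol t \<preceq> ?c" "sflag t \<preceq> ?c" "sav t \<preceq> ?c" "spd t \<preceq> ?c" "spc t \<preceq> ?c" "slabel t \<preceq> ?c"
      unfolding smallv_def st.collapse by simp_all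
    show ?l
      by (rule exI[of _ "srow t"], rule conjI, rule t(2),
          rule exI[of _ "scol t"], rule conjI, rule t(3),
          rule exI[of _ "sflag t"], rule conjI, rule t(4),
          rule exI[of _ "sav t"], rule conjI, rule t(5),
          rule exI[of _ "spd t"], rule conjI, rule t(6),
          rule exI[of _ "spc t"], rule conjI, rule t(7),
          rule exI[of _ "slabel t"], rule conjI, rule t(8),
          rule t(1))
  qed
qed

definition scode :: "'a st \<Rightarrow> 'a" where
  "scode t = cp (cp (cp (cp (cp (cp (srow t) (scol t)) (sflag t)) (sav t)) (spd t)) (spc t)) (slabel t)"

lemma scode_inj: "scode t = scode t' \<longleftrightarrow> t = t'"
  unfolding scode_def cp_inj by (auto intro: st.expand)

text \<open>At each of the six nested pairings the predicate of the partial code is given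
  explicitly: it describes how the remaining components complete the code, which unification would
  not determine.\<close>

lemma den_state_code:
  assumes "denT w s t" and "\<And>w' u d. w \<lesssim> w' \<Longrightarrow> denN w' u d \<Longrightarrow> denF w' (K u) (B d)"
  shows "denF w (state_code s K) (B (scode t))"
  unfolding state_code_def scode_def
  by (rule den_pair[where B = "\<lambda>z. B (cp (cp (cp (cp (cp z (sflag t)) (sav t)) (spd t)) (spc t)) (slabel t))"], (assumption | rule extends_refl denT_components denT_mono[OF assms(1)] |
         erule extends_trans)+,
      rule den_pair[where B = "\<lambda>z. B (cp (cp (cp (cp z (sav t)) (spd t)) (spc t)) (slabel t))"], (assumption | rule extends_refl denT_components denT_mono[OF assms(1)] |
         erule extends_trans)+,
      rule den_pair[where B = "\<lambda>z. B (cp (cp (cp z (spd t)) (spc t)) (slabel t))"], (assumption | rule extends_refl denT_components denT_mono[OF assms(1)] |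
         erule extends_trans)+,
      rule den_pair[where B = "\<lambda>z. B (cp (cp z (spc t)) (slabel t))"], (assumption | rule extends_refl denT_components denT_mono[OF assms(1)] |
         erule extends_trans)+,
      rule den_pair[where B = "\<lambda>z. B (cp z (slabel t))"], (assumption | rule extends_refl denT_components denT_mono[OF assms(1)] |
         erule extends_trans)+,
      rule den_pair[where B = "\<lambda>z. B (z)"], (assumption | rule extends_refl denT_components denT_mono[OF assms(1)] |
         erule extends_trans)+,
      rule assms(2), (assumption | rule extends_refl denT_components denT_mono[OF assms(1)] |
         erule extends_trans)+)

lemma den_state_mem:
  "denT w s t \<Longrightarrow> denN w x a \<Longrightarrow> denN w y b \<Longrightarrow> denS w X A \<Longrightarrow>
    denF w (state_code s (\<lambda>u. mem3 x y u X)) (in3 a b (scode t) A)"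
  by (intro den_state_code[where B = "\<lambda>z. in3 a b z A"] den_obj;
      (assumption | erule denN_mono denS_mono)+)

lemma den_state_triple:
  "denT w s t \<Longrightarrow> denN w x a \<Longrightarrow> denN w y b \<Longrightarrow> denN w z c \<Longrightarrow>
    denF w (state_code s (\<lambda>u. triple x y u (\<lambda>v. v \<^bold>= z))) (cp (cp a b) (scode t) = c)"
  by (intro den_state_code[where B = "\<lambda>z. cp (cp a b) z = c"] den_obj;
      (assumption | erule denN_mono)+)

lemmas den_state = denT_components denT_quiescent den_state_eq den_ex_state den_state_mem
  den_state_triple

definition activev :: "'a \<Rightarrow> 'a \<Rightarrow> 'a st \<Rightarrow> bool" where
  "activev n m t \<longleftrightarrow> bitv (slabel t) \<and>
    (srow t = \<zero> \<and> scol t = \<zero> \<and> sflag t = three \<and> sav t = three \<and> spd t = three \<and> spc t = three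
    \<or> \<one> \<preceq> srow t \<and> srow t \<preceq> n \<and> scol t = \<zero> \<and> sflag t = three \<and> sav t = three \<and>
        spd t = three \<and> spc t = three
    \<or> srow t = \<zero> \<and> \<one> \<preceq> scol t \<and> scol t \<preceq> m \<and> sflag t = three \<and> bitv (sav t) \<and>
        spd t = three \<and> spc t = three
    \<or> srow t = \<zero> \<and> scol t = m \<oplus> \<one> \<and> sflag t = three \<and> sav t = three \<and>
        spd t = three \<and> spc t = three
    \<or> \<one> \<preceq> srow t \<and> srow t \<preceq> n \<and> scol t = m \<oplus> \<one> \<and> sflag t = three \<and> sav t = three \<and>
        spd t = three \<and> bitv (spc t)
    \<or> \<one> \<preceq> srow t \<and> srow t \<preceq> n \<and> \<one> \<preceq> scol t \<and> scol t \<preceq> m \<and> signv (sflag t) \<and>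
        bitv (sav t) \<and> bitv (spd t) \<and> spc t = three)"

lemma den_active_state:
  "denN w n a \<Longrightarrow> denN w m b \<Longrightarrow> denT w s t \<Longrightarrow> denF w (active_state n m s) (activev a b t)"
  unfolding active_state_def activev_def by (intro den_form den_obj den_state den_num; assumption)

definition configv :: "'a \<Rightarrow> 'a \<Rightarrow> 'b \<Rightarrow> bool" where
  "configv n m C \<longleftrightarrow>
    (\<forall>z. z \<preceq> siz C \<longrightarrow> z \<epsilon> C \<longrightarrow> (\<exists>p. p \<preceq> n \<and> (\<exists>q. q \<preceq> m \<oplus> \<one> \<and>
      (\<exists>t. smallv n m t \<and> activev n m t \<and> cp (cp p q) (scode t) = z)))) \<and>
    (\<forall>p. p \<preceq> n \<longrightarrow> (\<forall>q. q \<preceq> m \<oplus> \<one> \<longrightarrow>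
      (\<exists>t. smallv n m t \<and> activev n m t \<and> in3 p q (scode t) C) \<and>
      (\<forall>z. z \<preceq> siz C \<longrightarrow> (\<forall>z'. z' \<preceq> siz C \<longrightarrow> in3 p q z C \<and> in3 p q z' C \<longrightarrow> z = z'))))"

lemma den_config:
  "denN w n a \<Longrightarrow> denN w m b \<Longrightarrow> denS w X C \<Longrightarrow> denF w (config n m X) (configv a b C)"
  unfolding config_def configv_def
  by (intro den_form den_num den_obj den_state den_active_state;
      (assumption | erule denN_mono denS_mono denT_mono extends_trans)+)

fun stepv :: "dir \<Rightarrow> 'a \<Rightarrow> 'a \<Rightarrow> 'a \<Rightarrow> 'a \<Rightarrow> bool" where
  "stepv Right p q p' q' \<longleftrightarrow> p' = p \<and> q' = q \<oplus> \<one>"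
| "stepv Left p q p' q' \<longleftrightarrow> p' = p \<and> q' \<oplus> \<one> = q"
| "stepv Below p q p' q' \<longleftrightarrow> p' = p \<oplus> \<one> \<and> q' = q"
| "stepv Above p q p' q' \<longleftrightarrow> p' \<oplus> \<one> = p \<and> q' = q"

lemma den_step:
  "denN w x p \<Longrightarrow> denN w y q \<Longrightarrow> denN w x' p' \<Longrightarrow> denN w y' q' \<Longrightarrow>
    denF w (step d x y x' y') (stepv d p q p' q')"
  by (cases d; simp only: step.simps stepv.simps) (intro den_form den_num; assumption)+

definition at_nbr :: "'a \<Rightarrow> 'a \<Rightarrow> dir \<Rightarrow> 'a \<Rightarrow> 'a \<Rightarrow> ('a \<Rightarrow> 'a \<Rightarrow> bool) \<Rightarrow> bool \<Rightarrow> bool" where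
  "at_nbr n m d p q P Q \<longleftrightarrow>
    (\<exists>p'. p' \<preceq> n \<and> (\<exists>q'. q' \<preceq> m \<oplus> \<one> \<and> stepv d p q p' q' \<and> P p' q')) \<or>
    \<not> (\<exists>p'. p' \<preceq> n \<and> (\<exists>q'. q' \<preceq> m \<oplus> \<one> \<and> stepv d p q p' q')) \<and> Q"

lemma den_at_neighbour:
  assumes "denN w n a" "denN w m b" "denN w x p" "denN w y q"
    and "\<And>w' x' y' p' q'. w \<lesssim> w' \<Longrightarrow> denN w' x' p' \<Longrightarrow> denN w' y' q' \<Longrightarrow> denF w' (P x' y') (B p' q')"
    and "denF w Q Q'"
  shows "denF w (at_neighbour n m d x y P Q) (at_nbr a b d p q B Q')"
  unfolding at_neighbour_def at_nbr_def
  by (intro den_form den_num den_step;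
      (assumption | rule assms denF_mono[OF assms(6)] assms(1-4)[THEN denN_mono] |
        erule denN_mono extends_trans)+)

definition nbr_state :: "'a \<Rightarrow> 'a \<Rightarrow> 'b \<Rightarrow> dir \<Rightarrow> 'a \<Rightarrow> 'a \<Rightarrow> 'a st \<Rightarrow> bool" where
  "nbr_state n m C d p q t \<longleftrightarrow>
    at_nbr n m d p q (\<lambda>p' q'. in3 p' q' (scode t) C) (t = qst n m)"

lemma den_neighbour_state:
  "denN w n a \<Longrightarrow> denN w m b \<Longrightarrow> denS w X C \<Longrightarrow> denN w x p \<Longrightarrow> denN w y q \<Longrightarrow> denT w s t \<Longrightarrow>
    denF w (neighbour_state n m X d x y s) (nbr_state a b C d p q t)"
  unfolding neighbour_state_def nbr_state_def
  by (intro den_at_neighbour den_state;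
      (assumption | erule denN_mono denS_mono denT_mono extends_trans)+)

definition nbhd :: "'a \<Rightarrow> 'a \<Rightarrow> 'b \<Rightarrow> 'a \<Rightarrow> 'a \<Rightarrow>
    'a st \<Rightarrow> 'a st \<Rightarrow> 'a st \<Rightarrow> 'a st \<Rightarrow> 'a st \<Rightarrow> bool" where
  "nbhd n m C p q t1 t2 t3 t4 t5 \<longleftrightarrow>
    in3 p q (scode t1) C \<and> nbr_state n m C Right p q t2 \<and> nbr_state n m C Left p q t3 \<and>
    nbr_state n m C Below p q t4 \<and> nbr_state n m C Above p q t5"

lemma den_neighbourhood:
  "denN w n a \<Longrightarrow> denN w m b \<Longrightarrow> denS w X C \<Longrightarrow> denN w x p \<Longrightarrow> denN w y q \<Longrightarrow>
    denT w s1 t1 \<Longrightarrow> denT w s2 t2 \<Longrightarrow> denT w s3 t3 \<Longrightarrow> denT w s4 t4 \<Longrightarrow> denT w s5 t5 \<Longrightarrow>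
    denF w (neighbourhood n m X x y s1 s2 s3 s4 s5) (nbhd a b C p q t1 t2 t3 t4 t5)"
  unfolding neighbourhood_def nbhd_def
  by (intro den_form den_state den_neighbour_state; assumption)

definition litv :: "'a st \<Rightarrow> bool" where
  "litv t \<longleftrightarrow> sflag t = \<one> \<and> sav t = \<one> \<or> sflag t = two \<and> sav t = \<zero>"

lemma den_lit_true: "denT w s t \<Longrightarrow> denF w (lit_true s) (litv t)"
  unfolding lit_true_def litv_def by (intro den_form den_obj den_num den_state; assumption)

definition coordv :: "'a \<Rightarrow> 'a \<Rightarrow> 'a st \<Rightarrow> dir \<Rightarrow> 'a st \<Rightarrow> bool" where
  "coordv n m t1 d t \<longleftrightarrow>
    at_nbr n m d (srow t1) (scol t1) (\<lambda>i j. srow t = i \<and> scol t = j) (t = qst n m)"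

lemma den_coord_ok:
  "denN w n a \<Longrightarrow> denN w m b \<Longrightarrow> denT w s1 t1 \<Longrightarrow> denT w s t \<Longrightarrow>
    denF w (coord_ok n m s1 d s) (coordv a b t1 d t)"
  unfolding coord_ok_def coordv_def
  by (intro den_at_neighbour den_form den_state;
      (assumption | erule denN_mono denT_mono extends_trans)+)

definition correctv :: "'a \<Rightarrow> 'a \<Rightarrow> 'b \<Rightarrow>
    'a st \<Rightarrow> 'a st \<Rightarrow> 'a st \<Rightarrow> 'a st \<Rightarrow> 'a st \<Rightarrow> bool" where
  "correctv n m \<Phi> t1 t2 t3 t4 t5 \<longleftrightarrow>
    (let i = srow t1; j = scol t1; q = qst n m;
         clause_row = (\<one> \<preceq> i \<and> i \<preceq> n);
         variable_col = (\<one> \<preceq> j \<and> j \<preceq> m);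
         pos = in3 i j \<one> \<Phi>;
         ngt = in3 i j two \<Phi>
     in
      (coordv n m t1 Right t2 \<and> coordv n m t1 Left t3 \<and>
       coordv n m t1 Below t4 \<and> coordv n m t1 Above t5) \<and>
      (clause_row \<and> variable_col \<longrightarrow>
        (sflag t1 = \<one> \<longleftrightarrow> pos) \<and> (sflag t1 = two \<longleftrightarrow> ngt) \<and> (sflag t1 = \<zero> \<longleftrightarrow> \<not> pos \<and> \<not> ngt)) \<and>
      (variable_col \<longrightarrow> (\<not> t4 = q \<longrightarrow> sav t4 = sav t1) \<and> (\<not> t5 = q \<longrightarrow> sav t5 = sav t1)) \<and>
      (j = m \<oplus> \<one> \<and> two \<preceq> i \<longrightarrow> (spc t1 = \<one> \<longleftrightarrow> spc t5 = \<one> \<and> spd t3 = \<one>)) \<and>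
      (i = \<one> \<and> j = m \<oplus> \<one> \<longrightarrow> (spc t1 = \<one> \<longleftrightarrow> spd t3 = \<one>)) \<and>
      (clause_row \<and> two \<preceq> j \<and> j \<preceq> m \<longrightarrow> (spd t1 = \<one> \<longleftrightarrow> spd t3 = \<one> \<or> litv t1)) \<and>
      (clause_row \<and> j = \<one> \<longrightarrow> (spd t1 = \<one> \<longleftrightarrow> litv t1)) \<and>
      ((\<not> (clause_row \<and> variable_col) \<longrightarrow> sflag t1 = three \<and> spd t1 = three) \<and>
       (\<not> variable_col \<longrightarrow> sav t1 = three) \<and>
       (\<not> (clause_row \<and> j = m \<oplus> \<one>) \<longrightarrow> spc t1 = three)))"

lemma den_locally_correct:
  "denN w n a \<Longrightarrow> denN w m b \<Longrightarrow> denS w \<phi> \<Phi> \<Longrightarrow>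
    denT w s1 t1 \<Longrightarrow> denT w s2 t2 \<Longrightarrow> denT w s3 t3 \<Longrightarrow> denT w s4 t4 \<Longrightarrow> denT w s5 t5 \<Longrightarrow>
    denF w (locally_correct n m \<phi> s1 s2 s3 s4 s5) (correctv a b \<Phi> t1 t2 t3 t4 t5)"
  unfolding locally_correct_def correctv_def Let_def
  by (intro den_form den_obj den_num den_state den_lit_true den_coord_ok; assumption)

definition bluev :: "'a \<Rightarrow> 'a \<Rightarrow> 'b \<Rightarrow> 'a st \<Rightarrow> 'a st \<Rightarrow> 'a st \<Rightarrow> 'a st \<Rightarrow> 'a st \<Rightarrow> bool" where
  "bluev n m \<Phi> t1 t2 t3 t4 t5 \<longleftrightarrow>
    \<not> t1 = qst n m \<and> correctv n m \<Phi> t1 t2 t3 t4 t5 \<and>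
    (srow t1 = n \<and> scol t1 = m \<oplus> \<one> \<longrightarrow> spc t1 = \<one>)"

lemma den_blue:
  "denN w n a \<Longrightarrow> denN w m b \<Longrightarrow> denS w \<phi> \<Phi> \<Longrightarrow>
    denT w s1 t1 \<Longrightarrow> denT w s2 t2 \<Longrightarrow> denT w s3 t3 \<Longrightarrow> denT w s4 t4 \<Longrightarrow> denT w s5 t5 \<Longrightarrow>
    denF w (blue n m \<phi> s1 s2 s3 s4 s5) (bluev a b \<Phi> t1 t2 t3 t4 t5)"
  unfolding blue_def bluev_def
  by (intro den_form den_num den_state den_locally_correct; assumption)

definition sucv :: "'a \<Rightarrow> 'a \<Rightarrow> 'a \<Rightarrow> 'a \<Rightarrow> 'a \<Rightarrow> 'a \<Rightarrow> bool" where
  "sucv n m i j i' j' \<longleftrightarrow>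
    (if i = \<zero> \<and> j = \<zero> \<or> evenv i \<and> \<one> \<preceq> j \<and> j \<preceq> m then stepv Right i j i' j'
     else if i = n \<and> j = \<one> \<or> oddv i \<and> two \<preceq> j \<and> j \<preceq> m \<oplus> \<one> then stepv Left i j i' j'
     else if oddv i \<and> j = \<one> \<or> evenv i \<and> j = m \<oplus> \<one> then stepv Below i j i' j'
     else \<one> \<preceq> i \<and> j = \<zero> \<and> stepv Above i j i' j')"

lemma den_successor:
  "denN w n a \<Longrightarrow> denN w m b \<Longrightarrow> denN w x p \<Longrightarrow> denN w y q \<Longrightarrow> denN w x' p' \<Longrightarrow> denN w y' q' \<Longrightarrow>
    denF w (successor n m x y x' y') (sucv a b p q p' q')"
  unfolding successor_def sucv_def by (intro den_form den_obj den_num den_step; assumption)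

definition xorv :: "'a st \<Rightarrow> 'a st \<Rightarrow> 'a st \<Rightarrow> bool" where
  "xorv v t1 t \<longleftrightarrow> srow v = srow t1 \<and> scol v = scol t1 \<and> sflag v = sflag t1 \<and> sav v = sav t1 \<and>
    spd v = spd t1 \<and> spc v = spc t1 \<and>
    (if slabel t1 = slabel t then slabel v = \<zero> else slabel v = \<one>)"

definition xor_sucv :: "'a \<Rightarrow> 'a \<Rightarrow> 'a st \<Rightarrow> 'a st \<Rightarrow> 'a st \<Rightarrow> bool" where
  "xor_sucv n m t1 t v \<longleftrightarrow> sucv n m (srow t1) (scol t1) (srow t) (scol t) \<and> xorv v t1 t"

lemma den_xor_if_successor:
  "denN w n a \<Longrightarrow> denN w m b \<Longrightarrow> denT w s1 t1 \<Longrightarrow> denT w s t \<Longrightarrow> denT w v u \<Longrightarrow>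
    denF w (xor_if_successor n m s1 s v) (xor_sucv a b t1 t u)"
  unfolding xor_if_successor_def xor_sucv_def xor_label_def xorv_def
  by (intro den_form den_num den_state den_successor; assumption)

definition rulev :: "'a \<Rightarrow> 'a \<Rightarrow> 'b \<Rightarrow>
    'a st \<Rightarrow> 'a st \<Rightarrow> 'a st \<Rightarrow> 'a st \<Rightarrow> 'a st \<Rightarrow> 'a st \<Rightarrow> bool" where
  "rulev n m \<Phi> t1 t2 t3 t4 t5 v \<longleftrightarrow>
    (if bluev n m \<Phi> t1 t2 t3 t4 t5
     then xor_sucv n m t1 t2 v \<or> xor_sucv n m t1 t3 v \<or> xor_sucv n m t1 t4 v \<or> xor_sucv n m t1 t5 v
     else v = t1)"

lemma den_local_rule:
  "denN w n a \<Longrightarrow> denN w m b \<Longrightarrow> denS w \<phi> \<Phi> \<Longrightarrow> denT w s1 t1 \<Longrightarrow> denT w s2 t2 \<Longrightarrow>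
    denT w s3 t3 \<Longrightarrow> denT w s4 t4 \<Longrightarrow> denT w s5 t5 \<Longrightarrow> denT w v u \<Longrightarrow>
    denF w (local_rule n m \<phi> s1 s2 s3 s4 s5 v) (rulev a b \<Phi> t1 t2 t3 t4 t5 u)"
  unfolding local_rule_def rulev_def
  by (intro den_form den_state den_blue den_xor_if_successor; assumption)

definition imagev :: "'a \<Rightarrow> 'a \<Rightarrow> 'b \<Rightarrow> 'b \<Rightarrow> 'a \<Rightarrow> 'a \<Rightarrow> 'a st \<Rightarrow> bool" where
  "imagev n m \<Phi> C p q v \<longleftrightarrow>
    (\<exists>t1. smallv n m t1 \<and> (\<exists>t2. smallv n m t2 \<and> (\<exists>t3. smallv n m t3 \<and> (\<exists>t4. smallv n m t4 \<and>
      (\<exists>t5. smallv n m t5 \<and> nbhd n m C p q t1 t2 t3 t4 t5 \<and> rulev n m \<Phi> t1 t2 t3 t4 t5 v)))))"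

lemma den_image_state:
  "denN w n a \<Longrightarrow> denN w m b \<Longrightarrow> denS w \<phi> \<Phi> \<Longrightarrow> denS w X C \<Longrightarrow> denN w x p \<Longrightarrow> denN w y q \<Longrightarrow>
    denT w v u \<Longrightarrow> denF w (image_state n m \<phi> X x y v) (imagev a b \<Phi> C p q u)"
  unfolding image_state_def imagev_def
  by (intro den_form den_state den_neighbourhood den_local_rule;
      (assumption | erule denN_mono denS_mono denT_mono extends_trans)+)

lemma den_same_image:
  "denN w n a \<Longrightarrow> denN w m b \<Longrightarrow> denS w \<phi> \<Phi> \<Longrightarrow> denS w X C \<Longrightarrow> denS w X' C' \<Longrightarrow>
    denF w (same_image n m \<phi> X X')
      (\<forall>p. p \<preceq> a \<longrightarrow> (\<forall>q. q \<preceq> b \<oplus> \<one> \<longrightarrow>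
        (\<exists>v. smallv a b v \<and> imagev a b \<Phi> C p q v \<and> imagev a b \<Phi> C' p q v)))"
  unfolding same_image_def
  by (intro den_form den_num den_state den_image_state;
      (assumption | erule denN_mono denS_mono denT_mono extends_trans)+)

end


section \<open>A satisfying assignment yields two configurations with the same image\<close>

text \<open>Both recursions of the local conditions are solved in closed form, which makes the state
  \<Sigma>^B_0-definable at each position: \<open>pd\<close> says that some literal among the first
  q columns of clause p is true, and \<open>pc\<close> is constantly 1 because all clauses are to be
  satisfied.\<close>

definition witness_state ::
  "nexp \<Rightarrow> nexp \<Rightarrow> sexp \<Rightarrow> sexp \<Rightarrow> nexp \<Rightarrow> nexp \<Rightarrow> nexp \<Rightarrow> state \<Rightarrow> form" where
  "witness_state n m \<phi> a p q e s =
    (row s \<^bold>= p \<^bold>\<and> col s \<^bold>= q \<^bold>\<and> label s \<^bold>= e \<^bold>\<and>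
     ite ((\<^bold>1 \<^bold>\<le> p \<^bold>\<and> p \<^bold>\<le> n) \<^bold>\<and> \<^bold>1 \<^bold>\<le> q \<^bold>\<and> q \<^bold>\<le> m)
       (ite (mem3 p q \<^bold>1 \<phi>) (flag s \<^bold>= \<^bold>1)
          (ite (mem3 p q minus1 \<phi>) (flag s \<^bold>= minus1) (flag s \<^bold>= \<^bold>0)) \<^bold>\<and>
        ite (ex_from1 q (\<lambda>j. ite (mem2 j \<^bold>1 a) (mem3 p j \<^bold>1 \<phi>) (mem3 p j minus1 \<phi>)))
          (pd s \<^bold>= \<^bold>1) (pd s \<^bold>= \<^bold>0))
       (flag s \<^bold>= absent \<^bold>\<and> pd s \<^bold>= absent) \<^bold>\<and>
     ite (\<^bold>1 \<^bold>\<le> q \<^bold>\<and> q \<^bold>\<le> m) (ite (mem2 q \<^bold>1 a) (av s \<^bold>= \<^bold>1) (av s \<^bold>= \<^bold>0)) (av s \<^bold>= absent) \<^bold>\<and>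
     ite ((\<^bold>1 \<^bold>\<le> p \<^bold>\<and> p \<^bold>\<le> n) \<^bold>\<and> q \<^bold>= m \<^bold>+ \<^bold>1) (pc s \<^bold>= \<^bold>1) (pc s \<^bold>= absent))"

context v0_model
begin

section \<open>Constants, parity and the successor position\<close>

lemma const_distinct [simp]:
  "\<zero> \<noteq> two" "two \<noteq> \<zero>" "\<one> \<noteq> two" "two \<noteq> \<one>" "\<zero> \<noteq> three" "three \<noteq> \<zero>"
  "\<one> \<noteq> three" "three \<noteq> \<one>" "two \<noteq> three" "three \<noteq> two"
proof -
  have 1: "x \<noteq> x \<oplus> \<one>" for x using cancel_left[of x \<zero> \<one>] by auto
  have 2: "three = two \<oplus> \<one>" unfolding two_def three_def ..
  show "two \<noteq> \<zero>" "three \<noteq> \<zero>" using BASIC(1) unfolding two_def three_def by blast+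
  then show "\<zero> \<noteq> two" "\<zero> \<noteq> three" by simp_all
  show "\<one> \<noteq> two" "two \<noteq> three" using 1 unfolding 2 unfolding two_def by blast+
  then show "two \<noteq> \<one>" "three \<noteq> two" by metis+
  have "two \<noteq> \<zero>" by fact
  then show "\<one> \<noteq> three" using BASIC(2)[of two \<zero>] unfolding 2 by auto
  then show "three \<noteq> \<one>" by simp
qed

lemma le_add_left: "x \<preceq> y \<oplus> x"
  using BASIC(8)[of x y] by (simp add: N.add_commute)

lemma le_refl: "x \<preceq> x"
  using BASIC(10) by blast

lemma le_trans: "x \<preceq> y \<Longrightarrow> y \<preceq> z \<Longrightarrow> x \<preceq> z"
  by (rule N.order_trans)

lemma not_suc_le: "\<not> x \<oplus> \<one> \<preceq> x"
  using less_iff[of x x] by blast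

lemma two_le_iff: "two \<preceq> x \<longleftrightarrow> x \<noteq> \<zero> \<and> x \<noteq> \<one>"
  using less_iff[of \<one> x] one_le_iff[of x] unfolding two_def by auto

lemma even_or_odd: "evenv x \<or> oddv x"
proof (induction x rule: induction)
  show "definable (\<lambda>x. evenv x \<or> oddv x)"
    by (rule definableI[where F = "\<lambda>_ _ _ _ _ _ x. evn x \<^bold>\<or> odd1 x"]) (intro den_form den_obj)
  show "evenv \<zero> \<or> oddv \<zero>" unfolding evenv_def by (auto intro: BASIC(9))
  fix x assume "evenv x \<or> oddv x"
  then consider h where "h \<preceq> x" "x = h \<oplus> h" | h where "h \<preceq> x" "x = h \<oplus> h \<oplus> \<one>"
    unfolding evenv_def oddv_def by blast
  then show "evenv (x \<oplus> \<one>) \<or> oddv (x \<oplus> \<one>)"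
  proof cases
    case (1 h)
    have "h \<preceq> x \<oplus> \<one>" using 1 BASIC(8) le_trans by blast
    then have "oddv (x \<oplus> \<one>)" using 1 unfolding oddv_def by blast
    then show ?thesis ..
  next
    case (2 h)
    have "x \<oplus> \<one> = (h \<oplus> \<one>) \<oplus> (h \<oplus> \<one>)" using 2 by (simp add: N.add_ac)
    moreover have "h \<oplus> \<one> \<preceq> x \<oplus> \<one>" using 2 N.add_right_mono by blast
    ultimately have "evenv (x \<oplus> \<one>)" unfolding evenv_def by blast
    then show ?thesis ..
  qed
qed

lemma not_even_and_odd: "\<not> (evenv x \<and> oddv x)"
proof
  assume "evenv x \<and> oddv x"
  then obtain h k where eq: "h \<oplus> h = k \<oplus> k \<oplus> \<one>" unfolding evenv_def oddv_def by metis
  show False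
  proof (cases "h \<preceq> k")
    case True
    then have "h \<oplus> h \<preceq> k \<oplus> k" using N.add_mono by blast
    then show False using not_suc_le unfolding eq by blast
  next
    case False
    then have "k \<oplus> \<one> \<preceq> h" using less_iff[of k h] BASIC(10) by blast
    then have "(k \<oplus> \<one>) \<oplus> (k \<oplus> \<one>) \<preceq> h \<oplus> h" using N.add_mono by blast
    moreover have "(k \<oplus> \<one>) \<oplus> (k \<oplus> \<one>) = k \<oplus> k \<oplus> \<one> \<oplus> \<one>" by (simp add: N.add_ac)
    ultimately show False using not_suc_le unfolding eq by simp
  qed
qed

text \<open>The successor of a position in the rectangle exists, is a neighbour and lies in the
  rectangle again. The critical cases are downward steps in row n and positions caught by the last
  case.\<close>

lemma successor_exists:
  assumes "oddv n" "\<one> \<preceq> m" "i \<preceq> n" "j \<preceq> m \<oplus> \<one>"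
  shows "\<exists>d i' j'. i' \<preceq> n \<and> j' \<preceq> m \<oplus> \<one> \<and> stepv d i j i' j' \<and> sucv n m i j i' j'"
proof -
  let ?c1 = "i = \<zero> \<and> j = \<zero> \<or> evenv i \<and> \<one> \<preceq> j \<and> j \<preceq> m"
  let ?c2 = "i = n \<and> j = \<one> \<or> oddv i \<and> two \<preceq> j \<and> j \<preceq> m \<oplus> \<one>"
  let ?c3 = "oddv i \<and> j = \<one> \<or> evenv i \<and> j = m \<oplus> \<one>"
  consider (1) ?c1 | (2) "\<not> ?c1" ?c2 | (3) "\<not> ?c1" "\<not> ?c2" ?c3 | (4) "\<not> ?c1" "\<not> ?c2" "\<not> ?c3"
    by blast
  then show ?thesis
  proof cases
    case 1
    then have "j \<preceq> m" using BASIC(9) by blast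
    then have "j \<oplus> \<one> \<preceq> m \<oplus> \<one>" by (rule N.add_right_mono)
    moreover have "sucv n m i j i (j \<oplus> \<one>)" unfolding sucv_def using 1 by simp
    ultimately show ?thesis using assms(3) stepv.simps(1) by blast
  next
    case 2
    have "j = \<one> \<or> two \<preceq> j" using 2(2) by blast
    then have "j \<noteq> \<zero>" using two_le_iff[of j] by auto
    then obtain j' where j': "j' \<preceq> j" "j' \<oplus> \<one> = j" using BASIC(12) by blast
    then have "j' \<preceq> m \<oplus> \<one>" using assms(4) le_trans by blast
    moreover have "sucv n m i j i j'" unfolding sucv_def if_not_P[OF 2(1)] if_P[OF 2(2)]
      using j' by simp
    ultimately show ?thesis using assms(3) j' stepv.simps(2) by blast
  next
    case 3
    \<comment> \<open>In the odd row n a downward step could only start in column 1, but there the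
      preceding case already moves left.\<close>
    have "i \<noteq> n" using 3 assms(1) not_even_and_odd by blast
    then have "i \<oplus> \<one> \<preceq> n" using less_iff assms(3) by blast
    moreover have "sucv n m i j (i \<oplus> \<one>) j"
      unfolding sucv_def if_not_P[OF 3(1)] if_not_P[OF 3(2)] if_P[OF 3(3)] by simp
    ultimately show ?thesis using assms(4) stepv.simps(3) by blast
  next
    case 4
    have j: "j = \<zero>"
    proof (rule ccontr)
      assume "j \<noteq> \<zero>"
      then have "\<one> \<preceq> j" by (simp add: one_le_iff)
      have "j \<preceq> m \<or> j = m \<oplus> \<one>" using assms(4) le_add_one_iff by blast
      \<comment> \<open>Off column 0 an earlier case applies: in an even row the first or the third
        according to whether j is at most m or equal to m + 1, in an odd row the third or the second
        according to whether j is 1 or at least 2.\<close>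
      then show False using 4 \<open>\<one> \<preceq> j\<close> \<open>j \<noteq> \<zero>\<close> assms(4) even_or_odd[of i] two_le_iff[of j] by blast
    qed
    then have "i \<noteq> \<zero>" using 4 by blast
    then obtain i' where i': "i' \<preceq> i" "i' \<oplus> \<one> = i" using BASIC(12) by blast
    then have "i' \<preceq> n" using assms(3) le_trans by blast
    moreover have "sucv n m i j i' j"
      unfolding sucv_def if_not_P[OF 4(1)] if_not_P[OF 4(2)] if_not_P[OF 4(3)]
      using i' j \<open>i \<noteq> \<zero>\<close> by (simp add: one_le_iff)
    ultimately show ?thesis using assms(4) i' stepv.simps(4) by blast
  qed
qed

section \<open>Neighbours and the witness states\<close>

lemma stepv_unique: "stepv d p q p' q' \<Longrightarrow> stepv d p q p'' q'' \<Longrightarrow> p' = p'' \<and> q' = q''"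
  by (cases d) (auto dest: BASIC(2))

lemma at_nbr_mono:
  assumes "at_nbr n m d p q P Q" "Q \<Longrightarrow> Q'"
    and "\<And>p' q'. p' \<preceq> n \<Longrightarrow> q' \<preceq> m \<oplus> \<one> \<Longrightarrow> stepv d p q p' q' \<Longrightarrow> P p' q' \<Longrightarrow> P' p' q'"
  shows "at_nbr n m d p q P' Q'"
  using assms unfolding at_nbr_def by blast

lemma at_nbr_inside:
  assumes "at_nbr n m d p q P Q" "p' \<preceq> n" "q' \<preceq> m \<oplus> \<one>" "stepv d p q p' q'"
  shows "P p' q'"
  using assms stepv_unique unfolding at_nbr_def by metis

lemma at_nbr_ex: "\<exists>t. at_nbr n m d p q (\<lambda>p' q'. t = f p' q') (t = c)"
  unfolding at_nbr_def by metis

definition lit_sat :: "'b \<Rightarrow> 'b \<Rightarrow> 'a \<Rightarrow> 'a \<Rightarrow> bool" where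
  "lit_sat \<Phi> A p j \<longleftrightarrow> (if in2 j \<one> A then in3 p j \<one> \<Phi> else in3 p j two \<Phi>)"

definition wst :: "'a \<Rightarrow> 'a \<Rightarrow> 'b \<Rightarrow> 'b \<Rightarrow> 'a \<Rightarrow> 'a \<Rightarrow> 'a \<Rightarrow> 'a st" where
  "wst n m \<Phi> A e p q = St p q
    (if (\<one> \<preceq> p \<and> p \<preceq> n) \<and> \<one> \<preceq> q \<and> q \<preceq> m
     then if in3 p q \<one> \<Phi> then \<one> else if in3 p q two \<Phi> then two else \<zero> else three)
    (if \<one> \<preceq> q \<and> q \<preceq> m then if in2 q \<one> A then \<one> else \<zero> else three)
    (if (\<one> \<preceq> p \<and> p \<preceq> n) \<and> \<one> \<preceq> q \<and> q \<preceq> m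
     then if \<exists>j. j \<preceq> q \<and> \<one> \<preceq> j \<and> lit_sat \<Phi> A p j then \<one> else \<zero> else three)
    (if (\<one> \<preceq> p \<and> p \<preceq> n) \<and> q = m \<oplus> \<one> then \<one> else three) e"

lemma den_witness_state:
  assumes "denN w n a" "denN w m b" "denS w \<phi> \<Phi>" "denS w X A" "denN w x p" "denN w y q"
    "denN w z e" "denT w s t"
  shows "denF w (witness_state n m \<phi> X x y z s) (t = wst a b \<Phi> A e p q)"
proof -
  \<comment> \<open>All conditions are abstracted to truth values, which leaves a finite case
    distinction between the componentwise formula and the record.\<close>
  have *: "(r = p \<and> k = q \<and> l = e \<and>
      (if c1 then (if c2 then f = \<one> else if c3 then f = two else f = \<zero>) \<and>
         (if c4 then d = \<one> else d = \<zero>) else f = three \<and> d = three) \<and>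
      (if c5 then if c6 then v = \<one> else v = \<zero> else v = three) \<and>
      (if c7 then c = \<one> else c = three)) \<longleftrightarrow>
    St r k f v d c l = St p q (if c1 then if c2 then \<one> else if c3 then two else \<zero> else three)
      (if c5 then if c6 then \<one> else \<zero> else three)
      (if c1 then if c4 then \<one> else \<zero> else three) (if c7 then \<one> else three) e"
    for r k f v d c l c1 c2 c3 c4 c5 c6 c7
    by (cases c1; cases c2; cases c3; cases c4; cases c5; cases c6; cases c7) auto
  have "denF w (witness_state n m \<phi> X x y z s)
    (srow t = p \<and> scol t = q \<and> slabel t = e \<and>
     (if (\<one> \<preceq> p \<and> p \<preceq> a) \<and> \<one> \<preceq> q \<and> q \<preceq> b
      then (if in3 p q \<one> \<Phi> then sflag t = \<one> else if in3 p q two \<Phi> then sflag t = two else sflag t = \<zero>) \<and>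
        (if \<exists>j. j \<preceq> q \<and> \<one> \<preceq> j \<and> (if in2 j \<one> A then in3 p j \<one> \<Phi> else in3 p j two \<Phi>)
         then spd t = \<one> else spd t = \<zero>)
      else sflag t = three \<and> spd t = three) \<and>
     (if \<one> \<preceq> q \<and> q \<preceq> b then if in2 q \<one> A then sav t = \<one> else sav t = \<zero> else sav t = three) \<and>
     (if (\<one> \<preceq> p \<and> p \<preceq> a) \<and> q = b \<oplus> \<one> then spc t = \<one> else spc t = three))"
    unfolding witness_state_def
    by (insert assms, intro den_form den_obj den_num den_state;
        (assumption | erule denN_mono denS_mono denT_mono extends_trans)+)
  then show ?thesis
    by (rule den_cong) (cases t, simp only: st.sel wst_def lit_sat_def, rule *)
qed

lemma smallv_const:
  "\<zero> \<preceq> c \<oplus> three" "\<one> \<preceq> c \<oplus> three" "two \<preceq> c \<oplus> three" "three \<preceq> c \<oplus> three"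
  "two \<preceq> three"
proof -
  show "two \<preceq> three" unfolding three_def two_def by (rule BASIC(8))
  moreover have "\<one> \<preceq> two" unfolding two_def by (rule BASIC(8))
  moreover show "three \<preceq> c \<oplus> three" by (rule le_add_left)
  ultimately show "two \<preceq> c \<oplus> three" "\<one> \<preceq> c \<oplus> three" using le_trans by blast+
  show "\<zero> \<preceq> c \<oplus> three" by (rule BASIC(9))
qed

lemma smallv_qst: "smallv n m (qst n m)"
  unfolding smallv_def qst_def by (simp add: smallv_const BASIC(9))

lemma row_bound: "p \<preceq> n \<Longrightarrow> p \<preceq> n \<oplus> m \<oplus> three"
  using BASIC(8) le_trans by metis

lemma col_bound: "q \<preceq> m \<oplus> \<one> \<Longrightarrow> q \<preceq> n \<oplus> m \<oplus> three"
proof -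
  assume "q \<preceq> m \<oplus> \<one>"
  moreover have "m \<oplus> \<one> \<preceq> (n \<oplus> m) \<oplus> three"
    using smallv_const(2)[of \<zero>] by (intro N.add_mono le_add_left) simp
  ultimately show ?thesis by (rule le_trans)
qed

lemma smallv_wst:
  "e = \<zero> \<or> e = \<one> \<Longrightarrow> p \<preceq> n \<Longrightarrow> q \<preceq> m \<oplus> \<one> \<Longrightarrow> smallv n m (wst n m \<Phi> A e p q)"
  unfolding smallv_def wst_def by (auto simp: smallv_const BASIC(9) row_bound col_bound)

text \<open>The number n + m + 2 that represents an absent coordinate exceeds every row.\<close>

lemma wst_not_qst: "p \<preceq> n \<Longrightarrow> wst n m \<Phi> A e p q \<noteq> qst n m"
proof
  assume "p \<preceq> n" "wst n m \<Phi> A e p q = qst n m"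
  then have "n \<oplus> m \<oplus> two \<preceq> n" by (simp add: wst_def qst_def)
  moreover have "n \<oplus> \<one> \<preceq> n \<oplus> m \<oplus> two"
    unfolding N.add_assoc two_def by (rule N.add_left_mono, rule le_trans[OF le_add_left le_add_left])
  ultimately show False using le_trans not_suc_le by blast
qed

lemma activev_wst:
  assumes "e = \<zero> \<or> e = \<one>" "\<one> \<preceq> m" "p \<preceq> n" "q \<preceq> m \<oplus> \<one>"
  shows "activev n m (wst n m \<Phi> A e p q)"
proof -
  have q: "q \<preceq> m \<longleftrightarrow> q \<noteq> m \<oplus> \<one>"
    using assms(4) le_add_one_iff not_suc_le by blast
  show ?thesis
  proof (cases "q = m \<oplus> \<one>")
    case True
    then show ?thesis using assms(1,3)
      by (cases "p = \<zero>") (simp_all add: activev_def wst_def bitv_def one_le_iff not_suc_le BASIC(1))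
  next
    case False
    then show ?thesis using assms(1,3) q
      by (cases "p = \<zero>"; cases "q = \<zero>")
        (simp_all add: activev_def wst_def bitv_def signv_def one_le_iff)
  qed
qed

text \<open>Comprehension yields only sets below a given number, so a common bound for all the codes
  is needed.\<close>

lemma witness_set:
  assumes e: "e = \<zero> \<or> e = \<one>"
  shows "\<exists>C. \<forall>z. z \<epsilon> C \<longleftrightarrow>
    (\<exists>p q. p \<preceq> n \<and> q \<preceq> m \<oplus> \<one> \<and> cp (cp p q) (scode (wst n m \<Phi> A e p q)) = z)"
proof -
  let ?B = "\<lambda>z. \<exists>p. p \<preceq> n \<and> (\<exists>q. q \<preceq> m \<oplus> \<one> \<and> (\<exists>t. smallv n m t \<and>
    t = wst n m \<Phi> A e p q \<and> cp (cp p q) (scode t) = z))"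
  have "definable ?B"
    by (rule definableI[where a = n and b = m and c = e and A = \<Phi> and B = A and
        F = "\<lambda>n m e _ \<phi> a z. ex_le n (\<lambda>p. ex_le (m \<^bold>+ \<^bold>1) (\<lambda>q. ex_state n m (\<lambda>s.
          witness_state n m \<phi> a p q e s \<^bold>\<and> state_code s (\<lambda>w. triple p q w (\<lambda>u. u \<^bold>= z)))))"])
      (intro den_form den_num den_state den_witness_state;
        (assumption | erule denN_mono denS_mono denT_mono extends_trans)+)
  let ?c = "n \<oplus> m \<oplus> three"
  \<comment> \<open>\<open>b1\<close> bounds codes of coordinate pairs; \<open>b2\<close> to
    \<open>b6\<close> add flag, assignment value, partial disjunction, partial conjunction and label
    in turn; \<open>b7\<close> bounds a position paired with a state code.\<close>
  obtain b1 where b1: "\<And>x y. x \<preceq> ?c \<Longrightarrow> y \<preceq> ?c \<Longrightarrow> cp x y \<preceq> b1" using cp_bounded by metis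
  obtain b2 where b2: "\<And>x y. x \<preceq> b1 \<Longrightarrow> y \<preceq> ?c \<Longrightarrow> cp x y \<preceq> b2" using cp_bounded by metis
  obtain b3 where b3: "\<And>x y. x \<preceq> b2 \<Longrightarrow> y \<preceq> ?c \<Longrightarrow> cp x y \<preceq> b3" using cp_bounded by metis
  obtain b4 where b4: "\<And>x y. x \<preceq> b3 \<Longrightarrow> y \<preceq> ?c \<Longrightarrow> cp x y \<preceq> b4" using cp_bounded by metis
  obtain b5 where b5: "\<And>x y. x \<preceq> b4 \<Longrightarrow> y \<preceq> ?c \<Longrightarrow> cp x y \<preceq> b5" using cp_bounded by metis
  obtain b6 where b6: "\<And>x y. x \<preceq> b5 \<Longrightarrow> y \<preceq> ?c \<Longrightarrow> cp x y \<preceq> b6" using cp_bounded by metis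
  obtain b7 where b7: "\<And>x y. x \<preceq> b1 \<Longrightarrow> y \<preceq> b6 \<Longrightarrow> cp x y \<preceq> b7" using cp_bounded by metis
  have bound: "z \<prec> b7 \<oplus> \<one>" if z: "?B z" for z
  proof -
    obtain p q t where *: "p \<preceq> n" "q \<preceq> m \<oplus> \<one>" "smallv n m t" "z = cp (cp p q) (scode t)"
      using z by blast
    have "scode t \<preceq> b6" using *(3) unfolding smallv_def scode_def by (intro b6 b5 b4 b3 b2 b1) blast+
    then have "z \<preceq> b7" unfolding *(4) by (intro b7 b1 row_bound col_bound *)
    then show ?thesis using BASIC(11) by blast
  qed
  obtain C where C: "siz C \<preceq> b7 \<oplus> \<one>" "\<And>z. z \<prec> b7 \<oplus> \<one> \<Longrightarrow> z \<epsilon> C \<longleftrightarrow> ?B z"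
    using comprehension[OF \<open>definable ?B\<close>] by blast
  have "z \<epsilon> C \<longleftrightarrow> ?B z" for z
  proof
    assume "z \<epsilon> C"
    then have "z \<prec> siz C" by (rule BASIC(13))
    then have "z \<prec> b7 \<oplus> \<one>" using C(1) le_trans BASIC(7) by blast
    then show "?B z" using C(2) \<open>z \<epsilon> C\<close> by blast
  next
    assume "?B z"
    then show "z \<epsilon> C" using C(2) bound by blast
  qed
  moreover have "?B z \<longleftrightarrow>
      (\<exists>p q. p \<preceq> n \<and> q \<preceq> m \<oplus> \<one> \<and> cp (cp p q) (scode (wst n m \<Phi> A e p q)) = z)" for z
    using smallv_wst[OF e] by blast
  ultimately show ?thesis by (intro exI[of _ C]) blast
qed

section \<open>Local correctness and common image of the witnesses\<close>

context
  fixes n m :: 'a and \<Phi> A :: 'b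
  assumes n_pos: "\<one> \<preceq> n" and n_odd: "oddv n" and m_pos: "\<one> \<preceq> m"
    and cnf: "cnfv n m \<Phi>" and asg: "asgv m A" and sat: "satv n m A \<Phi>"
begin

abbreviation W :: "'a \<Rightarrow> 'a \<Rightarrow> 'a \<Rightarrow> 'a st" where
  "W \<equiv> wst n m \<Phi> A"

lemma in3_exclusive:
  assumes "p \<preceq> n" "\<one> \<preceq> p" "q \<preceq> m" "\<one> \<preceq> q"
  shows "\<not> (in3 p q \<one> \<Phi> \<and> in3 p q two \<Phi>)"
proof -
  have "\<one> \<preceq> two" "two \<preceq> two" using BASIC(8) le_refl unfolding two_def by auto
  then have "in3 p q \<one> \<Phi> \<and> in3 p q two \<Phi> \<longrightarrow> \<one> = two"
    using cnf assms unfolding cnfv_def by blast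
  then show ?thesis by simp
qed

lemma in2_exclusive: "q \<preceq> m \<Longrightarrow> \<one> \<preceq> q \<Longrightarrow> in2 q \<zero> A \<Longrightarrow> \<not> in2 q \<one> A"
proof
  assume "q \<preceq> m" "\<one> \<preceq> q" "in2 q \<zero> A" "in2 q \<one> A"
  moreover have "\<zero> \<preceq> \<one>" "\<one> \<preceq> \<one>" using BASIC(9) le_refl by auto
  ultimately have "\<zero> = \<one>" using asg unfolding asgv_def by blast
  then show False by simp
qed

text \<open>\<open>litv\<close> starts from the flag and \<open>lit_sat\<close> from the assignment.
  They agree because a clause does not contain a variable with both signs.\<close>

lemma litv_W:
  assumes "p \<preceq> n" "\<one> \<preceq> p" "q \<preceq> m" "\<one> \<preceq> q"
  shows "litv (W e p q) \<longleftrightarrow> lit_sat \<Phi> A p q"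
  using in3_exclusive[OF assms] assms by (auto simp: litv_def lit_sat_def wst_def)

lemma spd_W:
  assumes "p \<preceq> n" "\<one> \<preceq> p" "q \<preceq> m" "\<one> \<preceq> q"
  shows "spd (W e p q) = \<one> \<longleftrightarrow> (\<exists>j. j \<preceq> q \<and> \<one> \<preceq> j \<and> lit_sat \<Phi> A p j)"
  using assms by (simp add: wst_def)

text \<open>Satisfaction of the formula enters here: each row contains a true literal, so the
  disjunction over the full row is 1.\<close>

lemma spd_last:
  assumes "p \<preceq> n" "\<one> \<preceq> p"
  shows "spd (W e p m) = \<one>"
proof -
  obtain j s where j: "j \<preceq> m" "\<one> \<preceq> j" and s: "in3 p j s \<Phi>"
      "s = \<one> \<and> in2 j \<one> A \<or> s = two \<and> in2 j \<zero> A"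
    using sat assms unfolding satv_def by blast
  then have "lit_sat \<Phi> A p j" using in2_exclusive unfolding lit_sat_def by auto
  then show ?thesis using spd_W[OF assms le_refl m_pos] j by blast
qed

text \<open>The four neighbours are described by \<open>at_nbr\<close>, which treats interior and
  border positions uniformly. The label e is the same at all positions.\<close>

lemma correctv_W:
  assumes p: "p \<preceq> n" and q: "q \<preceq> m \<oplus> \<one>"
    and right: "at_nbr n m Right p q (\<lambda>p' q'. t2 = W e p' q') (t2 = qst n m)"
    and left: "at_nbr n m Left p q (\<lambda>p' q'. t3 = W e p' q') (t3 = qst n m)"
    and below: "at_nbr n m Below p q (\<lambda>p' q'. t4 = W e p' q') (t4 = qst n m)"
    and above: "at_nbr n m Above p q (\<lambda>p' q'. t5 = W e p' q') (t5 = qst n m)"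
  shows "correctv n m \<Phi> (W e p q) t2 t3 t4 t5"
proof -
  have coord: "coordv n m (W e p q) d t"
    if "at_nbr n m d p q (\<lambda>p' q'. t = W e p' q') (t = qst n m)" for d t
    unfolding coordv_def by (simp add: wst_def) (rule at_nbr_mono[OF that], simp_all add: wst_def)
  have B: "(sflag (W e p q) = \<one> \<longleftrightarrow> in3 p q \<one> \<Phi>) \<and> (sflag (W e p q) = two \<longleftrightarrow> in3 p q two \<Phi>) \<and>
      (sflag (W e p q) = \<zero> \<longleftrightarrow> \<not> in3 p q \<one> \<Phi> \<and> \<not> in3 p q two \<Phi>)"
    if "\<one> \<preceq> p \<and> p \<preceq> n" "\<one> \<preceq> q \<and> q \<preceq> m"
    using that in3_exclusive[of p q] by (auto simp: wst_def)
  \<comment> \<open>A vertical neighbour is in the same column, and the assignment component depends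
    on the column alone.\<close>
  have C1: "sav t = sav (W e p q)"
    if t: "at_nbr n m d p q (\<lambda>p' q'. t = W e p' q') (t = qst n m)" "t \<noteq> qst n m"
      and d: "d = Below \<or> d = Above" for d t
  proof -
    obtain p' where "t = W e p' q" using t d unfolding at_nbr_def by auto
    then show ?thesis by (simp add: wst_def)
  qed
  \<comment> \<open>In the last column the left neighbour is in column m, so all quantities compared
    in (C2) and (C3) equal 1.\<close>
  have last: "spd t3 = \<one> \<and> spc (W e p q) = \<one>" if "q = m \<oplus> \<one>" "\<one> \<preceq> p"
  proof -
    have "t3 = W e p m"
      using at_nbr_inside[OF left p, of m] BASIC(8) that(1) by simp
    then show ?thesis using spd_last[OF p that(2)] p that by (simp add: wst_def)
  qed
  \<comment> \<open>From row 2 on, the state above is still in a clause row and thus carries a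
    partial conjunction.\<close>
  have C2: "spc t5 = \<one>" if "q = m \<oplus> \<one>" "two \<preceq> p"
  proof -
    have "p \<noteq> \<zero>" "p \<noteq> \<one>" using that two_le_iff by auto
    then obtain p' where p': "p' \<preceq> p" "p' \<oplus> \<one> = p" using BASIC(12) by blast
    then have "p' \<noteq> \<zero>" "p' \<preceq> n" using \<open>p \<noteq> \<one>\<close> p le_trans by auto
    moreover have "t5 = W e p' q"
      using at_nbr_inside[OF above \<open>p' \<preceq> n\<close> q] p' by simp
    ultimately show ?thesis using that by (simp add: wst_def one_le_iff)
  qed
  have D1: "spd (W e p q) = \<one> \<longleftrightarrow> spd t3 = \<one> \<or> litv (W e p q)"
    if "\<one> \<preceq> p" "two \<preceq> q" "q \<preceq> m"
  proof -
    have "q \<noteq> \<zero>" "q \<noteq> \<one>" using that two_le_iff by auto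
    then obtain q' where q': "q' \<preceq> q" "q' \<oplus> \<one> = q" using BASIC(12) by blast
    have "q' \<noteq> \<zero>" using q' \<open>q \<noteq> \<one>\<close> by auto
    then have "\<one> \<preceq> q'" by (simp add: one_le_iff)
    have "q' \<preceq> m" "q' \<preceq> m \<oplus> \<one>" using q' q that le_trans by blast+
    have "\<one> \<preceq> q" using \<open>q \<noteq> \<zero>\<close> by (simp add: one_le_iff)
    have t3: "t3 = W e p q'"
      using at_nbr_inside[OF left p \<open>q' \<preceq> m \<oplus> \<one>\<close>] q' by simp
    \<comment> \<open>The existential in \<open>pd\<close> at q = q' + 1 splits into the one at q'
      and the literal at q itself, which is the recursion (D1).\<close>
    have le: "j \<preceq> q \<longleftrightarrow> j \<preceq> q' \<or> j = q" for j
      using le_add_one_iff[of j q'] q' by simp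
    show ?thesis
      unfolding t3 spd_W[OF p that(1) that(3) \<open>\<one> \<preceq> q\<close>] spd_W[OF p that(1) \<open>q' \<preceq> m\<close> \<open>\<one> \<preceq> q'\<close>]
        litv_W[OF p that(1) that(3) \<open>\<one> \<preceq> q\<close>] le
      using \<open>\<one> \<preceq> q\<close> by auto
  qed
  have D2: "spd (W e p q) = \<one> \<longleftrightarrow> litv (W e p q)" if "\<one> \<preceq> p" "q = \<one>"
  proof -
    have "j \<preceq> \<one> \<and> \<one> \<preceq> j \<longleftrightarrow> j = \<one>" for j using BASIC(7) le_refl by blast
    then show ?thesis
      using spd_W[OF p that(1), of \<one>] litv_W[OF p that(1), of \<one>] m_pos le_refl that(2) by metis
  qed
  have two_le: "\<one> \<preceq> x" if "two \<preceq> x" for x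
    using that two_le_iff one_le_iff by blast
  have W: "srow (W e p q) = p" "scol (W e p q) = q" by (simp_all add: wst_def)
  show ?thesis
    unfolding correctv_def Let_def W
  proof (intro conjI impI coord right left below above)
    assume 1: "(\<one> \<preceq> p \<and> p \<preceq> n) \<and> \<one> \<preceq> q \<and> q \<preceq> m"
    show "sflag (W e p q) = \<one> \<longleftrightarrow> in3 p q \<one> \<Phi>" "sflag (W e p q) = two \<longleftrightarrow> in3 p q two \<Phi>"
      "sflag (W e p q) = \<zero> \<longleftrightarrow> \<not> in3 p q \<one> \<Phi> \<and> \<not> in3 p q two \<Phi>"
      using B 1 by blast+
  next
    assume "t4 \<noteq> qst n m" then show "sav t4 = sav (W e p q)" using C1 below by blast
  next
    assume "t5 \<noteq> qst n m" then show "sav t5 = sav (W e p q)" using C1 above by blast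
  next
    assume "q = m \<oplus> \<one> \<and> two \<preceq> p"
    then show "spc (W e p q) = \<one> \<longleftrightarrow> spc t5 = \<one> \<and> spd t3 = \<one>" using last C2 two_le by blast
  next
    assume "p = \<one> \<and> q = m \<oplus> \<one>"
    then show "spc (W e p q) = \<one> \<longleftrightarrow> spd t3 = \<one>" using last le_refl by blast
  next
    assume "(\<one> \<preceq> p \<and> p \<preceq> n) \<and> two \<preceq> q \<and> q \<preceq> m"
    then show "spd (W e p q) = \<one> \<longleftrightarrow> spd t3 = \<one> \<or> litv (W e p q)" using D1 by blast
  next
    assume "(\<one> \<preceq> p \<and> p \<preceq> n) \<and> q = \<one>"
    then show "spd (W e p q) = \<one> \<longleftrightarrow> litv (W e p q)" using D2 by blast
  next
    assume 1: "\<not> ((\<one> \<preceq> p \<and> p \<preceq> n) \<and> \<one> \<preceq> q \<and> q \<preceq> m)"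
    show "sflag (W e p q) = three" "spd (W e p q) = three"
      unfolding wst_def st.sel if_not_P[OF 1] by (rule refl)+
  next
    assume 1: "\<not> (\<one> \<preceq> q \<and> q \<preceq> m)"
    show "sav (W e p q) = three" unfolding wst_def st.sel if_not_P[OF 1] by (rule refl)
  next
    assume 1: "\<not> ((\<one> \<preceq> p \<and> p \<preceq> n) \<and> q = m \<oplus> \<one>)"
    show "spc (W e p q) = three" unfolding wst_def st.sel if_not_P[OF 1] by (rule refl)
  qed
qed

context
  fixes e :: 'a and C :: 'b
  assumes e: "e = \<zero> \<or> e = \<one>"
    and C: "z \<epsilon> C \<longleftrightarrow> (\<exists>p q. p \<preceq> n \<and> q \<preceq> m \<oplus> \<one> \<and> cp (cp p q) (scode (W e p q)) = z)"
begin

text \<open>By injectivity of pairing, the set of codes is the graph of the intended map; its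
  elements can be read off at each position.\<close>

lemma in3_witness: "p \<preceq> n \<Longrightarrow> q \<preceq> m \<oplus> \<one> \<Longrightarrow> in3 p q u C \<longleftrightarrow> u = scode (W e p q)"
  unfolding in3_def C cp_inj by blast

lemma configv_witness: "configv n m C"
  unfolding configv_def
proof (intro conjI allI impI)
  fix z assume "z \<epsilon> C"
  then obtain p q where "p \<preceq> n" "q \<preceq> m \<oplus> \<one>" "cp (cp p q) (scode (W e p q)) = z"
    unfolding C by blast
  then show "\<exists>p. p \<preceq> n \<and> (\<exists>q. q \<preceq> m \<oplus> \<one> \<and>
      (\<exists>t. smallv n m t \<and> activev n m t \<and> cp (cp p q) (scode t) = z))"
    using smallv_wst[OF e] activev_wst[OF e m_pos] by blast
next
  fix p q assume "p \<preceq> n" "q \<preceq> m \<oplus> \<one>"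
  then show "\<exists>t. smallv n m t \<and> activev n m t \<and> in3 p q (scode t) C"
    using smallv_wst[OF e] activev_wst[OF e m_pos] in3_witness by blast
next
  fix p q z z' assume "p \<preceq> n" "q \<preceq> m \<oplus> \<one>" "in3 p q z C \<and> in3 p q z' C"
  then show "z = z'" by (simp add: in3_witness)
qed

text \<open>The image does not depend on e: a blue state and its successor both have label e, so the
  new label is 0 whichever neighbour is the successor.\<close>

lemma imagev_witness:
  assumes p: "p \<preceq> n" and q: "q \<preceq> m \<oplus> \<one>"
  shows "imagev n m \<Phi> C p q (W \<zero> p q)"
proof -
  let ?N = "\<lambda>d t. at_nbr n m d p q (\<lambda>p' q'. t = W e p' q') (t = qst n m)"
  obtain t2 t3 t4 t5 where t: "?N Right t2" "?N Left t3" "?N Below t4" "?N Above t5"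
    using at_nbr_ex[of n m _ p q "W e" "qst n m"] by metis
  have nbr: "nbr_state n m C d p q t \<and> smallv n m t" if "?N d t" for d t
  proof
    show "nbr_state n m C d p q t"
      unfolding nbr_state_def by (rule at_nbr_mono[OF that]) (simp_all add: in3_witness)
    show "smallv n m t"
      using that smallv_wst[OF e] smallv_qst unfolding at_nbr_def by blast
  qed
  have nbhd: "nbhd n m C p q (W e p q) t2 t3 t4 t5"
    unfolding nbhd_def using nbr t p q by (simp add: in3_witness)
  \<comment> \<open>The additional requirement at the corner (n,m+1) holds since n is positive, so
    that the partial conjunction there is 1.\<close>
  have blue: "bluev n m \<Phi> (W e p q) t2 t3 t4 t5"
    unfolding bluev_def using wst_not_qst[OF p] correctv_W[OF p q t] n_pos
    by (auto simp: wst_def le_refl)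
  have xor: "xor_sucv n m (W e p q) (W e p' q') (W \<zero> p q)" if "sucv n m p q p' q'" for p' q'
    using that by (simp add: xor_sucv_def xorv_def wst_def)
  obtain d p' q' where suc: "p' \<preceq> n" "q' \<preceq> m \<oplus> \<one>" "stepv d p q p' q'" "sucv n m p q p' q'"
    using successor_exists[OF n_odd m_pos p q] by blast
  have "?N d t \<Longrightarrow> xor_sucv n m (W e p q) t (W \<zero> p q)" for t
    using at_nbr_inside[OF _ suc(1-3)] xor[OF suc(4)] by blast
  then have "rulev n m \<Phi> (W e p q) t2 t3 t4 t5 (W \<zero> p q)"
    unfolding rulev_def if_P[OF blue] using t by (cases d) blast+
  then show ?thesis
    unfolding imagev_def using nbhd nbr t smallv_wst[OF e p q] by blast
qed

end

lemma not_injective: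
  "\<exists>C C'. configv n m C \<and> configv n m C' \<and> \<not> C \<simeq> C' \<and>
    (\<forall>p. p \<preceq> n \<longrightarrow> (\<forall>q. q \<preceq> m \<oplus> \<one> \<longrightarrow>
      (\<exists>v. smallv n m v \<and> imagev n m \<Phi> C p q v \<and> imagev n m \<Phi> C' p q v)))"
proof -
  obtain C where C: "\<And>z. z \<epsilon> C \<longleftrightarrow>
      (\<exists>p q. p \<preceq> n \<and> q \<preceq> m \<oplus> \<one> \<and> cp (cp p q) (scode (W \<zero> p q)) = z)"
    using witness_set[of \<zero> n m \<Phi> A] by blast
  obtain C' where C': "\<And>z. z \<epsilon> C' \<longleftrightarrow>
      (\<exists>p q. p \<preceq> n \<and> q \<preceq> m \<oplus> \<one> \<and> cp (cp p q) (scode (W \<one> p q)) = z)"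
    using witness_set[of \<one> n m \<Phi> A] by blast
  have "\<not> C \<simeq> C'"
  proof
    assume "C \<simeq> C'"
    \<comment> \<open>The states at the origin differ in their labels, so their codes separate the
      two sets.\<close>
    moreover have "cp (cp \<zero> \<zero>) (scode (W \<zero> \<zero> \<zero>)) \<epsilon> C" unfolding C using BASIC(9) by blast
    ultimately have "cp (cp \<zero> \<zero>) (scode (W \<zero> \<zero> \<zero>)) \<epsilon> C'" by (rule eqv_elt)
    then have "W \<zero> \<zero> \<zero> = W \<one> \<zero> \<zero>" unfolding C' cp_inj scode_inj by auto
    then show False by (simp add: wst_def)
  qed
  moreover have "configv n m C" "configv n m C'"
    using configv_witness[of \<zero> C] configv_witness[of \<one> C'] C C' by blast+
  moreover have "smallv n m (W \<zero> p q) \<and> imagev n m \<Phi> C p q (W \<zero> p q) \<and> imagev n m \<Phi> C' p q (W \<zero> p q)"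
    if "p \<preceq> n" "q \<preceq> m \<oplus> \<one>" for p q
    using imagev_witness[of \<zero> C p q] imagev_witness[of \<one> C' p q] C C' that smallv_wst by blast
  ultimately show ?thesis by blast
qed

end

text \<open>The outer layer of the sentence has unbounded number quantifiers and set quantifiers, so
  there only the truth value can be tracked, without the boundedness demanded by
  \<open>denF\<close>.\<close>

definition denG :: "('a, 'b) world \<Rightarrow> form \<Rightarrow> bool \<Rightarrow> bool" where
  "denG w P b \<longleftrightarrow> (\<forall>k e l s. w \<lesssim> (k, e, l, s) \<longrightarrow> (sat e s (P k l) \<longleftrightarrow> b))"

lemma denG_bounded: "denF w P p \<Longrightarrow> denG w P p"
  unfolding denF_def denG_def by blast

lemma denG_eqs: "denS w X A \<Longrightarrow> denS w Y B \<Longrightarrow> denG w (X \<^bold>\<approx> Y) (A \<simeq> B)"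
  unfolding denG_def denS_def eqs_def by simp

lemma denG_imp: "denG w P p \<Longrightarrow> denG w Q q \<Longrightarrow> denG w (P \<^bold>\<longrightarrow> Q) (p \<longrightarrow> q)"
  unfolding denG_def imp_def by simp

lemma denG_alln:
  assumes "\<And>w' x v. w \<lesssim> w' \<Longrightarrow> denN w' x v \<Longrightarrow> denG w' (F x) (B v)"
  shows "denG w (alln F) (\<forall>v. B v)"
  unfolding denG_def
proof (intro allI impI)
  fix k e l s assume w: "w \<lesssim> (k, e, l, s)"
  have "denG (Suc k, case_nat v e, l, s) (F (\<lambda>k' l'. NV (k' - Suc k))) (B v)" for v
    using extends_trans[OF w extends_num] denN_var by (rule assms)
  then have "sat (case_nat v e) s (F (\<lambda>k' l'. NV (k' - Suc k)) (Suc k) l) \<longleftrightarrow> B v" for v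
    using extends_refl unfolding denG_def by blast
  then show "sat e s (alln F k l) \<longleftrightarrow> (\<forall>v. B v)"
    unfolding alln_def by simp
qed

lemma denG_alls:
  assumes "\<And>w' X S. w \<lesssim> w' \<Longrightarrow> denS w' X S \<Longrightarrow> denG w' (F X) (B S)"
  shows "denG w (alls F) (\<forall>S. B S)"
  unfolding denG_def
proof (intro allI impI)
  fix k e l s assume w: "w \<lesssim> (k, e, l, s)"
  have "denG (k, e, Suc l, case_nat S s) (F (\<lambda>k' l'. l' - Suc l)) (B S)" for S
    using extends_trans[OF w extends_set] denS_var by (rule assms)
  then have "sat e (case_nat S s) (F (\<lambda>k' l'. l' - Suc l) k (Suc l)) \<longleftrightarrow> B S" for S
    using extends_refl unfolding denG_def by blast
  then show "sat e s (alls F k l) \<longleftrightarrow> (\<forall>S. B S)"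
    unfolding alls_def by simp
qed

text \<open>The denotation rules turn the sentence into its semantic reading, passing to the bounded
  calculus below the outer quantifiers; that reading then contradicts \<open>not_injective\<close>
  if a satisfying assignment exists.\<close>

lemma sat_injective_imp_unsatisfiable:
  "sat e s (sentence
    (\<^bold>\<forall>n. \<^bold>\<forall>m. \<^bold>\<forall>\<^sub>S \<phi>. \<^bold>1 \<^bold>\<le> n \<^bold>\<and> \<^bold>1 \<^bold>\<le> m \<^bold>\<and> odd1 n \<^bold>\<and> CNF n m \<phi> \<^bold>\<longrightarrow>
       (\<^bold>\<forall>\<^sub>S C. \<^bold>\<forall>\<^sub>S C'. config n m C \<^bold>\<and> config n m C' \<^bold>\<longrightarrow>
          same_image n m \<phi> C C' \<^bold>\<longrightarrow> C \<^bold>\<approx> C') \<^bold>\<longrightarrow>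
       (\<^bold>\<forall>\<^sub>S a. assignment m a \<^bold>\<longrightarrow> \<^bold>\<not> Sat n m a \<phi>)))"
proof -
  have "denG (0, e, 0, s)
    (\<^bold>\<forall>n. \<^bold>\<forall>m. \<^bold>\<forall>\<^sub>S \<phi>. \<^bold>1 \<^bold>\<le> n \<^bold>\<and> \<^bold>1 \<^bold>\<le> m \<^bold>\<and> odd1 n \<^bold>\<and> CNF n m \<phi> \<^bold>\<longrightarrow>
       (\<^bold>\<forall>\<^sub>S C. \<^bold>\<forall>\<^sub>S C'. config n m C \<^bold>\<and> config n m C' \<^bold>\<longrightarrow>
          same_image n m \<phi> C C' \<^bold>\<longrightarrow> C \<^bold>\<approx> C') \<^bold>\<longrightarrow>
       (\<^bold>\<forall>\<^sub>S a. assignment m a \<^bold>\<longrightarrow> \<^bold>\<not> Sat n m a \<phi>))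
    (\<forall>n m \<Phi>. \<one> \<preceq> n \<and> \<one> \<preceq> m \<and> oddv n \<and> cnfv n m \<Phi> \<longrightarrow>
       (\<forall>C C'. configv n m C \<and> configv n m C' \<longrightarrow>
          (\<forall>p. p \<preceq> n \<longrightarrow> (\<forall>q. q \<preceq> m \<oplus> \<one> \<longrightarrow>
            (\<exists>v. smallv n m v \<and> imagev n m \<Phi> C p q v \<and> imagev n m \<Phi> C' p q v))) \<longrightarrow>
          C \<simeq> C') \<longrightarrow>
       (\<forall>A. asgv m A \<longrightarrow> \<not> satv n m A \<Phi>))" (is "denG _ _ ?S")
    by (intro denG_alln denG_alls denG_imp denG_eqs; (rule denG_bounded)?;
        (intro den_form den_num den_obj den_CNF den_config den_same_image den_assignment den_Sat)?;
        (assumption | erule denN_mono denS_mono extends_trans)+)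
  moreover have ?S
    using not_injective by blast
  ultimately show ?thesis
    unfolding denG_def sentence_def using extends_refl by blast
qed

end

theorem theorem5p5:
  shows "V0 \<turnstile> sentence
    (\<^bold>\<forall>n. \<^bold>\<forall>m. \<^bold>\<forall>\<^sub>S \<phi>. \<^bold>1 \<^bold>\<le> n \<^bold>\<and> \<^bold>1 \<^bold>\<le> m \<^bold>\<and> odd1 n \<^bold>\<and> CNF n m \<phi> \<^bold>\<longrightarrow>
       (\<^bold>\<forall>\<^sub>S C. \<^bold>\<forall>\<^sub>S C'. config n m C \<^bold>\<and> config n m C' \<^bold>\<longrightarrow>
          same_image n m \<phi> C C' \<^bold>\<longrightarrow> C \<^bold>\<approx> C') \<^bold>\<longrightarrow>
       (\<^bold>\<forall>\<^sub>S a. assignment m a \<^bold>\<longrightarrow> \<^bold>\<not> Sat n m a \<phi>))"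
  by (rule ccontr, erule V0_countermodel, erule notE, rule v0_model.sat_injective_imp_unsatisfiable)

end
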